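(* An infinitesimal isometric deformation of an oriented surface $f\colon M\to\mathbb{R}^4$ is trivial if and only if it preserves parallelly in the normal bundle the mean curvature vector field and the Hopf differential.
   Context: $M$ is a connected, oriented 2-dimensional Riemannian manifold and a surface $f\colon M\to\mathbb{R}^4$ is an isometric immersion, with normal bundle $N_fM$, normal connection $\nabla^\perp$, second fundamental form $\alpha$, and mean curvature vector field $H_f=\frac12\mathrm{trace}\,\alpha$. The Hopf differential is the $N_fM\otimes\mathbb{C}$-valued quadratic differential $\Phi$ given by the $(2,0)$-part of the $\mathbb{C}$-bilinear extension of $\alpha$; in a complex coordinate $z$, $\Phi=\alpha(\partial_z,\partial_z)dz^2$. **Infinitesimal isometric deformations.** A bending field of $f$ is a section $\mathcal{T}$ of $f^*(T\mathbb{R}^4)$ with $\langle\tilde\nabla_X\mathcal{T},f_*Y\rangle+\langle f_*X,\tilde\nabla_Y\mathcal{T}\rangle=0$ for all $X,Y\in TM$ ($\tilde\nabla$ the connection of $f^*(T\mathbb{R}^4)$). It determines the infinitesimal isometric deformation $f_t=f+t\mathcal{T}$, $t$ in a small interval $I\ni0$; only deformations of this form are considered, and $M_t$ denotes $M$ with the metric induced by $f_t$. The deformation is trivial if $\mathcal{T}=Af+v$ on $M$ with $A$ a constant skew-symmetric $4\times4$ matrix and $v\in\mathbb{R}^4$ constant. Put $\delta=\frac{d}{dt}|_{t=0}$. **Parallel preservation.** The deformation preserves parallelly in the normal bundle a section $\xi(t)$ of $N_{f_t}M_t$, smooth in $t$, if around every point of $M$ there is a local orthonormal frame field $\{e_3(t),e_4(t)\}$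 of $N_{f_t}M_t$, smooth in $t$, with $\delta\omega_{34}(t)=0$ (where $\omega_{34}(t)=\langle\nabla^{\perp}e_3(t),e_4(t)\rangle$ for $f_t$) and $\delta\langle\xi(t),e_a(t)\rangle=0$, $a=3,4$. For the mean curvature vector field take $\xi(t)=H_{f_t}$. For the Hopf differential $\Phi(t)$ of $f_t$, write $\Phi(t)=\psi(t)(\omega_1(t)+i\omega_2(t))^2$ with $\{\omega_1(t),\omega_2(t)\}$ dual to a positively oriented local orthonormal frame $\{e_1(t),e_2(t)\}$ of $M_t$, smooth in $t$; the deformation preserves the Hopf differential parallelly in the normal bundle if for every such frame with $\delta e_j(t)=0$, $\delta\omega_j(t)=0$ ($j=1,2$) and $\delta\omega_{12}(t)=0$ ($\omega_{12}(t)$ its connection form), it preserves parallelly in the normal bundle the real and imaginary parts of $\psi(t)$.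
   Formalization: Preservation is read with one system of local normal frames common to the mean curvature field and the Hopf differential, and overlapping frames must agree to first order up to a t-independent rotation or reflection; with unrelated frames the claim is false. *)

theory Defs
  imports "HOL-Analysis.Analysis"
begin

section \<open>Smooth maps on open subsets of Euclidean spaces\<close>

abbreviation D :: "('a::real_normed_vector \<Rightarrow> 'b::real_normed_vector) \<Rightarrow> 'a \<Rightarrow> 'a \<Rightarrow> 'b" where
  "D F u v \<equiv> frechet_derivative F (at u) v"

fun C_on :: "nat \<Rightarrow> 'a::euclidean_space set \<Rightarrow> ('a \<Rightarrow> 'b::real_normed_vector) \<Rightarrow> bool" where
  "C_on 0 S F \<longleftrightarrow> continuous_on S F"
| "C_on (Suc k) S F \<longleftrightarrow> F differentiable_on S \<and> (\<forall>v. C_on k S (\<lambda>u. D F u v))"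

definition smooth_on :: "'a::euclidean_space set \<Rightarrow> ('a \<Rightarrow> 'b::real_normed_vector) \<Rightarrow> bool" where
  "smooth_on S F \<longleftrightarrow> (\<forall>k. C_on k S F)"


section \<open>Oriented surfaces\<close>

text \<open>A chart is given by its inverse: a pair \<open>(V, x)\<close> of an open set of parameters and a
  homeomorphism \<open>x\<close> of \<open>V\<close> onto an open subset of the manifold. The manifold is the union of the
  sets \<open>x ` V\<close>. The orientation is the one in which all the charts are positive.\<close>

type_synonym 'm chart = "(real^2) set \<times> (real^2 \<Rightarrow> 'm)"

definition surface :: "'m chart set \<Rightarrow> 'm set" where
  "surface A = (\<Union>(V, x)\<in>A. x ` V)"

definition oriented_atlas :: "'m::{t2_space, second_countable_topology} chart set \<Rightarrow> bool" where
  "oriented_atlas A \<longleftrightarrow>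
     (\<forall>(V, x)\<in>A. open V \<and> open (x ` V) \<and> homeomorphism V (x ` V) x (inv_into V x)) \<and>
     (\<forall>(V, x)\<in>A. \<forall>(V', x')\<in>A.
        let S = {u\<in>V. x u \<in> x' ` V'}; \<tau> = inv_into V' x' \<circ> x
        in smooth_on S \<tau> \<and> (\<forall>u\<in>S. det (matrix (D \<tau> u)) > 0))"

definition smooth_map :: "'m chart set \<Rightarrow> ('m \<Rightarrow> 'b::real_normed_vector) \<Rightarrow> bool" where
  "smooth_map A F \<longleftrightarrow> (\<forall>(V, x)\<in>A. smooth_on V (F \<circ> x))"

definition immersion :: "'m chart set \<Rightarrow> ('m \<Rightarrow> real^4) \<Rightarrow> bool" where
  "immersion A f \<longleftrightarrow> smooth_map A f \<and> (\<forall>(V, x)\<in>A. \<forall>u\<in>V. inj (D (f \<circ> x) u))"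


section \<open>Local geometry of a parametrized surface\<close>

text \<open>Here \<open>F\<close> is an immersion expressed in a positive chart, tangent vectors and tangent fields are
  given by their components in that chart, and normal vectors are vectors of the ambient space.\<close>

definition metric :: "(real^2 \<Rightarrow> real^4) \<Rightarrow> real^2 \<Rightarrow> real^2 \<Rightarrow> real^2 \<Rightarrow> real" where
  "metric F u v w = D F u v \<bullet> D F u w"

definition gram :: "(real^2 \<Rightarrow> real^4) \<Rightarrow> real^2 \<Rightarrow> real^2^2" where
  "gram F u = (\<chi> i j. metric F u (axis i 1) (axis j 1))"

text \<open>Christoffel symbols of the first kind, \<open>\<langle>\<nabla>\<^bsub>\<partial>\<^sub>i\<^esub> \<partial>\<^sub>j, \<partial>\<^sub>k\<rangle>\<close>, for the Levi-Civita connection of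
  the induced metric.\<close>

definition christoffel :: "(real^2 \<Rightarrow> real^4) \<Rightarrow> real^2 \<Rightarrow> 2 \<Rightarrow> 2 \<Rightarrow> 2 \<Rightarrow> real" where
  "christoffel F u i j k =
     (D (\<lambda>q. gram F q $ j $ k) u (axis i 1) + D (\<lambda>q. gram F q $ i $ k) u (axis j 1)
      - D (\<lambda>q. gram F q $ i $ j) u (axis k 1)) / 2"

text \<open>The connection form \<open>v \<mapsto> \<langle>\<nabla>\<^sub>v e\<^sub>1, e\<^sub>2\<rangle>\<close>.\<close>

definition tangent_connection_form ::
    "(real^2 \<Rightarrow> real^4) \<Rightarrow> (real^2 \<Rightarrow> real^2) \<Rightarrow> (real^2 \<Rightarrow> real^2) \<Rightarrow> real^2 \<Rightarrow> real^2 \<Rightarrow> real" where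
  "tangent_connection_form F e1 e2 u v =
     metric F u (D e1 u v) (e2 u) +
     (\<Sum>i\<in>UNIV. \<Sum>j\<in>UNIV. \<Sum>k\<in>UNIV. christoffel F u i j k * v $ i * e1 u $ j * e2 u $ k)"

definition normal_part :: "(real^2 \<Rightarrow> real^4) \<Rightarrow> real^2 \<Rightarrow> real^4 \<Rightarrow> real^4" where
  "normal_part F u w = (THE n. n \<in> orthogonal_comp (range (D F u)) \<and> w - n \<in> range (D F u))"

definition normal_connection ::
    "(real^2 \<Rightarrow> real^4) \<Rightarrow> (real^2 \<Rightarrow> real^4) \<Rightarrow> real^2 \<Rightarrow> real^2 \<Rightarrow> real^4" where
  "normal_connection F \<eta> u v = normal_part F u (D \<eta> u v)"

definition normal_connection_form ::
    "(real^2 \<Rightarrow> real^4) \<Rightarrow> (real^2 \<Rightarrow> real^4) \<Rightarrow> (real^2 \<Rightarrow> real^4) \<Rightarrow> real^2 \<Rightarrow> real^2 \<Rightarrow> real" where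
  "normal_connection_form F e3 e4 u v = normal_connection F e3 u v \<bullet> e4 u"

text \<open>The vector \<open>w\<close> is extended to the field with constant components in the chart.\<close>

definition second_fundamental_form :: "(real^2 \<Rightarrow> real^4) \<Rightarrow> real^2 \<Rightarrow> real^2 \<Rightarrow> real^2 \<Rightarrow> real^4" where
  "second_fundamental_form F u v w = normal_part F u (D (\<lambda>q. D F q w) u v)"

definition mean_curvature :: "(real^2 \<Rightarrow> real^4) \<Rightarrow> real^2 \<Rightarrow> real^4" where
  "mean_curvature F u = (1/2) *\<^sub>R (\<Sum>i\<in>UNIV. \<Sum>j\<in>UNIV.
     matrix_inv (gram F u) $ i $ j *\<^sub>R second_fundamental_form F u (axis i 1) (axis j 1))"

text \<open>The complex structure of the oriented surface, the rotation by a positive right angle in the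
  tangent plane; see \<open>rot_frame\<close> below.\<close>

definition rot :: "(real^2 \<Rightarrow> real^4) \<Rightarrow> real^2 \<Rightarrow> real^2 \<Rightarrow> real^2" where
  "rot F u v = (1 / sqrt (det (gram F u))) *\<^sub>R
     vector [- metric F u v (axis 2 1), metric F u v (axis 1 1)]"

definition cvec :: "real^'n \<Rightarrow> complex^'n" where
  "cvec v = (\<chi> k. complex_of_real (v $ k))"

definition second_fundamental_form_C ::
    "(real^2 \<Rightarrow> real^4) \<Rightarrow> real^2 \<Rightarrow> complex^2 \<Rightarrow> complex^2 \<Rightarrow> complex^4" where
  "second_fundamental_form_C F u Z W = (\<Sum>i\<in>UNIV. \<Sum>j\<in>UNIV.
     (Z $ i * W $ j) *s cvec (second_fundamental_form F u (axis i 1) (axis j 1)))"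

definition part_1_0 :: "(real^2 \<Rightarrow> real^4) \<Rightarrow> real^2 \<Rightarrow> real^2 \<Rightarrow> complex^2" where
  "part_1_0 F u v = (1/2) *s (cvec v - \<i> *s cvec (rot F u v))"

text \<open>The Hopf differential on real tangent vectors, which determine its complex bilinear extension.\<close>

definition hopf_differential :: "(real^2 \<Rightarrow> real^4) \<Rightarrow> real^2 \<Rightarrow> real^2 \<Rightarrow> real^2 \<Rightarrow> complex^4" where
  "hopf_differential F u v w = second_fundamental_form_C F u (part_1_0 F u v) (part_1_0 F u w)"

lemma metric_eq_gram:
  assumes "linear (D F u)"
  shows "metric F u v w = v $ 1 * w $ 1 * gram F u $ 1 $ 1 +
    (v $ 1 * w $ 2 + v $ 2 * w $ 1) * gram F u $ 1 $ 2 + v $ 2 * w $ 2 * gram F u $ 2 $ 2"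
proof -
  have *: "D F u z = z $ 1 *\<^sub>R D F u (axis 1 1) + z $ 2 *\<^sub>R D F u (axis 2 1)" for z :: "real^2"
  proof -
    have "z = z $ 1 *\<^sub>R axis 1 1 + z $ 2 *\<^sub>R axis 2 1"
      by (simp add: vec_eq_iff axis_def forall_2)
    then have "D F u z = D F u (z $ 1 *\<^sub>R axis 1 1 + z $ 2 *\<^sub>R axis 2 1)"
      by simp
    then show ?thesis
      using assms by (simp add: linear_add linear_scale)
  qed
  show ?thesis
    unfolding metric_def gram_def *[of v] *[of w]
    by (simp add: inner_add_left inner_add_right inner_commute algebra_simps)
qed

lemma metric_axis:
  assumes "linear (D F u)"
  shows "metric F u v (axis 1 1) = v $ 1 * gram F u $ 1 $ 1 + v $ 2 * gram F u $ 1 $ 2"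
    and "metric F u v (axis 2 1) = v $ 1 * gram F u $ 1 $ 2 + v $ 2 * gram F u $ 2 $ 2"
  by (simp_all add: metric_eq_gram[OF assms] axis_def)

lemma det_gram:
  "det (gram F u) = gram F u $ 1 $ 1 * gram F u $ 2 $ 2 - gram F u $ 1 $ 2 * gram F u $ 1 $ 2"
  by (simp add: det_2 gram_def metric_def inner_commute)

lemma rot_frame:
  assumes lin: "linear (D F u)"
    and orthonormal: "metric F u e1 e1 = 1" "metric F u e2 e2 = 1" "metric F u e1 e2 = 0"
    and pos: "e1 $ 1 * e2 $ 2 - e1 $ 2 * e2 $ 1 > 0"
  shows "rot F u e1 = e2" and "rot F u e2 = - e1"
proof -
  define p q r s where pqrs: "p = e1 $ 1" "q = e1 $ 2" "r = e2 $ 1" "s = e2 $ 2"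
  define a b c where abc: "a = gram F u $ 1 $ 1" "b = gram F u $ 1 $ 2" "c = gram F u $ 2 $ 2"
  define d where "d = p * s - q * r"
  have d: "d > 0" using pos by (simp add: d_def pqrs)
  have 1: "p * (a * p + b * q) + q * (b * p + c * q) = 1"
    using orthonormal(1) unfolding metric_eq_gram[OF lin] by (simp add: pqrs abc algebra_simps)
  have 2: "r * (a * r + b * s) + s * (b * r + c * s) = 1"
    using orthonormal(2) unfolding metric_eq_gram[OF lin] by (simp add: pqrs abc algebra_simps)
  have 3: "r * (a * p + b * q) + s * (b * p + c * q) = 0"
    using orthonormal(3) unfolding metric_eq_gram[OF lin] by (simp add: pqrs abc algebra_simps)
  have "(a * c - b * b) * d\<^sup>2 = 1"
    unfolding d_def using 1 2 3 by algebra
  then have "det (gram F u) = (1 / d)\<^sup>2"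
    using d by (simp add: det_gram abc field_simps power2_eq_square)
  then have sq: "1 / sqrt (det (gram F u)) = d"
    using d by (simp add: real_sqrt_divide)
  have "d * (a * p + b * q) = s" "d * (b * p + c * q) = - r"
       "d * (a * r + b * s) = - q" "d * (b * r + c * s) = p"
    unfolding d_def using 1 2 3 by algebra+
  then show "rot F u e1 = e2" and "rot F u e2 = - e1"
    by (simp_all add: rot_def sq metric_axis[OF lin] vec_eq_iff forall_2 pqrs abc algebra_simps)
qed

section \<open>Infinitesimal isometric deformations\<close>

definition bending_field :: "'m chart set \<Rightarrow> ('m \<Rightarrow> real^4) \<Rightarrow> ('m \<Rightarrow> real^4) \<Rightarrow> bool" where
  "bending_field A f T \<longleftrightarrow> smooth_map A T \<and>
     (\<forall>(V, x)\<in>A. \<forall>u\<in>V. \<forall>v w.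
        D (T \<circ> x) u v \<bullet> D (f \<circ> x) u w + D (f \<circ> x) u v \<bullet> D (T \<circ> x) u w = 0)"

definition trivial_bending :: "'m chart set \<Rightarrow> ('m \<Rightarrow> real^4) \<Rightarrow> ('m \<Rightarrow> real^4) \<Rightarrow> bool" where
  "trivial_bending A f T \<longleftrightarrow>
     (\<exists>(B::real^4^4) c. transpose B = - B \<and> (\<forall>p\<in>surface A. T p = B *v f p + c))"

definition deform :: "('m \<Rightarrow> real^4) \<Rightarrow> ('m \<Rightarrow> real^4) \<Rightarrow> real \<Rightarrow> 'm \<Rightarrow> real^4" where
  "deform f T t p = f p + t *\<^sub>R T p"

abbreviation delta_zero :: "(real \<Rightarrow> 'a::real_normed_vector) \<Rightarrow> bool" where
  "delta_zero g \<equiv> (g has_vector_derivative 0) (at 0)"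


section \<open>Parallel preservation\<close>

text \<open>An orthonormal frame of the normal bundles of the deformed surfaces over the open set \<open>U\<close>,
  defined for \<open>\<bar>t\<bar> < r\<close> and smooth in the point and \<open>t\<close> together.\<close>

type_synonym 'm normal_frame =
  "'m set \<times> real \<times> (real \<Rightarrow> 'm \<Rightarrow> real^4) \<times> (real \<Rightarrow> 'm \<Rightarrow> real^4)"

definition normal_frame ::
    "'m::topological_space chart set \<Rightarrow> ('m \<Rightarrow> real^4) \<Rightarrow> ('m \<Rightarrow> real^4) \<Rightarrow> 'm normal_frame \<Rightarrow> bool" where
  "normal_frame A f T = (\<lambda>(U, r, e3, e4).
     open U \<and> U \<subseteq> surface A \<and> r > 0 \<and>
     (\<forall>(V, x)\<in>A. \<forall>e\<in>{e3, e4}.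
        smooth_on ({u\<in>V. x u \<in> U} \<times> {-r<..<r}) (\<lambda>(u, t). e t (x u)) \<and>
        (\<forall>t\<in>{-r<..<r}. \<forall>u\<in>V. x u \<in> U \<longrightarrow>
           e t (x u) \<in> orthogonal_comp (range (D (deform f T t \<circ> x) u)))) \<and>
     (\<forall>t\<in>{-r<..<r}. \<forall>p\<in>U. norm (e3 t p) = 1 \<and> norm (e4 t p) = 1 \<and> e3 t p \<bullet> e4 t p = 0))"

definition parallel_frame ::
    "'m::topological_space chart set \<Rightarrow> ('m \<Rightarrow> real^4) \<Rightarrow> ('m \<Rightarrow> real^4) \<Rightarrow> 'm normal_frame \<Rightarrow> bool" where
  "parallel_frame A f T E \<longleftrightarrow> normal_frame A f T E \<and>
     (case E of (U, r, e3, e4) \<Rightarrow> \<forall>(V, x)\<in>A. \<forall>u\<in>V. x u \<in> U \<longrightarrow> (\<forall>v.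
        delta_zero (\<lambda>t. normal_connection_form (deform f T t \<circ> x) (e3 t \<circ> x) (e4 t \<circ> x) u v)))"

text \<open>Where two frames overlap, they differ to first order by a rotation or reflection that does
  not depend on \<open>t\<close>, so that a section has constant components to first order in one of them if and
  only if it does in the other.\<close>

definition coherent_frames :: "'m normal_frame \<Rightarrow> 'm normal_frame \<Rightarrow> bool" where
  "coherent_frames = (\<lambda>(U, r, e3, e4) (U', r', e3', e4').
     \<forall>p\<in>U \<inter> U'. \<forall>e\<in>{e3, e4}. \<forall>e'\<in>{e3', e4'}. delta_zero (\<lambda>t. e t p \<bullet> e' t p))"

text \<open>The local frames, around every point, in which sections are to be preserved. Frames must be
  common to the sections considered and coherent on overlaps. With a frame of its own for each
  section the mean curvature and the Hopf differential may turn against each other: on a disc in a product of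
  two circles, change the two curvatures with opposite speeds, keeping the sum of their squares.
  Without coherence the deformation may be a different infinitesimal motion on the two sides of a
  planar strip: on a cylinder over a curve that is straight in the middle, turn one side about the
  plane of the strip.\<close>

definition parallel_frame_system ::
    "'m::topological_space chart set \<Rightarrow> ('m \<Rightarrow> real^4) \<Rightarrow> ('m \<Rightarrow> real^4) \<Rightarrow> 'm normal_frame set \<Rightarrow> bool" where
  "parallel_frame_system A f T \<E> \<longleftrightarrow>
     (\<forall>p\<in>surface A. \<exists>E\<in>\<E>. p \<in> fst E) \<and>
     (\<forall>E\<in>\<E>. parallel_frame A f T E) \<and>
     (\<forall>E\<in>\<E>. \<forall>E'\<in>\<E>. coherent_frames E E')"

text \<open>Preservation of a section \<open>\<xi>\<close> of the normal bundles, given over the part \<open>W\<close> of the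
  domain of the chart \<open>x\<close>.\<close>

definition preserved :: "'m normal_frame set \<Rightarrow> (real^2 \<Rightarrow> 'm) \<Rightarrow> (real^2) set \<Rightarrow> (real \<Rightarrow> real^2 \<Rightarrow> real^4) \<Rightarrow> bool" where
  "preserved \<E> x W \<xi> \<longleftrightarrow>
     (\<forall>(U, r, e3, e4)\<in>\<E>. \<forall>u\<in>W. x u \<in> U \<longrightarrow>
        delta_zero (\<lambda>t. \<xi> t u \<bullet> e3 t (x u)) \<and> delta_zero (\<lambda>t. \<xi> t u \<bullet> e4 t (x u)))"

definition preserves_mean_curvature ::
    "'m chart set \<Rightarrow> ('m \<Rightarrow> real^4) \<Rightarrow> ('m \<Rightarrow> real^4) \<Rightarrow> 'm normal_frame set \<Rightarrow> bool" where
  "preserves_mean_curvature A f T \<E> \<longleftrightarrow>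
     (\<forall>(V, x)\<in>A. preserved \<E> x V (\<lambda>t. mean_curvature (deform f T t \<circ> x)))"

text \<open>Positively oriented orthonormal tangent frames over an open part \<open>W\<close> of a chart, for the
  metric of the parametrized surface \<open>F t\<close>, \<open>\<bar>t\<bar> < r\<close>.\<close>

definition tangent_frame ::
    "(real \<Rightarrow> real^2 \<Rightarrow> real^4) \<Rightarrow> (real^2) set \<Rightarrow> real \<Rightarrow> (real \<Rightarrow> real^2 \<Rightarrow> real^2) \<Rightarrow>
     (real \<Rightarrow> real^2 \<Rightarrow> real^2) \<Rightarrow> bool" where
  "tangent_frame F W r e1 e2 \<longleftrightarrow>
     open W \<and> r > 0 \<and>
     smooth_on (W \<times> {-r<..<r}) (\<lambda>(u, t). e1 t u) \<and> smooth_on (W \<times> {-r<..<r}) (\<lambda>(u, t). e2 t u) \<and>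
     (\<forall>t\<in>{-r<..<r}. \<forall>u\<in>W.
        metric (F t) u (e1 t u) (e1 t u) = 1 \<and> metric (F t) u (e2 t u) (e2 t u) = 1 \<and>
        metric (F t) u (e1 t u) (e2 t u) = 0 \<and>
        e1 t u $ 1 * e2 t u $ 2 - e1 t u $ 2 * e2 t u $ 1 > 0)"

definition dual_coframe ::
    "(real^2) set \<Rightarrow> real \<Rightarrow> (real \<Rightarrow> real^2 \<Rightarrow> real^2) \<Rightarrow> (real \<Rightarrow> real^2 \<Rightarrow> real^2) \<Rightarrow>
     (real \<Rightarrow> real^2 \<Rightarrow> real^2 \<Rightarrow> real) \<Rightarrow> (real \<Rightarrow> real^2 \<Rightarrow> real^2 \<Rightarrow> real) \<Rightarrow> bool" where
  "dual_coframe W r e1 e2 \<omega>1 \<omega>2 \<longleftrightarrow>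
     (\<forall>t\<in>{-r<..<r}. \<forall>u\<in>W. linear (\<omega>1 t u) \<and> linear (\<omega>2 t u) \<and>
        \<omega>1 t u (e1 t u) = 1 \<and> \<omega>1 t u (e2 t u) = 0 \<and> \<omega>2 t u (e1 t u) = 0 \<and> \<omega>2 t u (e2 t u) = 1)"

definition stationary_frame ::
    "(real \<Rightarrow> real^2 \<Rightarrow> real^4) \<Rightarrow> (real^2) set \<Rightarrow> (real \<Rightarrow> real^2 \<Rightarrow> real^2) \<Rightarrow>
     (real \<Rightarrow> real^2 \<Rightarrow> real^2) \<Rightarrow> (real \<Rightarrow> real^2 \<Rightarrow> real^2 \<Rightarrow> real) \<Rightarrow>
     (real \<Rightarrow> real^2 \<Rightarrow> real^2 \<Rightarrow> real) \<Rightarrow> bool" where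
  "stationary_frame F W e1 e2 \<omega>1 \<omega>2 \<longleftrightarrow>
     (\<forall>u\<in>W. delta_zero (\<lambda>t. e1 t u) \<and> delta_zero (\<lambda>t. e2 t u) \<and>
        (\<forall>v. delta_zero (\<lambda>t. \<omega>1 t u v) \<and> delta_zero (\<lambda>t. \<omega>2 t u v) \<and>
             delta_zero (\<lambda>t. tangent_connection_form (F t) (e1 t) (e2 t) u v)))"

text \<open>The equation \<open>\<Phi>(t) = \<psi>(t) (\<omega>\<^sub>1(t) + i \<omega>\<^sub>2(t))\<^sup>2\<close>.\<close>

definition hopf_coefficient ::
    "(real \<Rightarrow> real^2 \<Rightarrow> real^4) \<Rightarrow> (real^2) set \<Rightarrow> real \<Rightarrow> (real \<Rightarrow> real^2 \<Rightarrow> real^2 \<Rightarrow> real) \<Rightarrow>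
     (real \<Rightarrow> real^2 \<Rightarrow> real^2 \<Rightarrow> real) \<Rightarrow> (real \<Rightarrow> real^2 \<Rightarrow> complex^4) \<Rightarrow> bool" where
  "hopf_coefficient F W r \<omega>1 \<omega>2 \<psi> \<longleftrightarrow>
     (\<forall>t\<in>{-r<..<r}. \<forall>u\<in>W. \<forall>v w.
        hopf_differential (F t) u v w =
          (Complex (\<omega>1 t u v) (\<omega>2 t u v) * Complex (\<omega>1 t u w) (\<omega>2 t u w)) *s \<psi> t u)"

lemma hopf_coefficient_exists:
  assumes lin: "\<And>t u. t \<in> {-r<..<r} \<Longrightarrow> u \<in> W \<Longrightarrow> linear (D (F t) u)"
    and frame: "tangent_frame F W r e1 e2"
    and dual: "dual_coframe W r e1 e2 \<omega>1 \<omega>2"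
  shows "hopf_coefficient F W r \<omega>1 \<omega>2 (\<lambda>t u. hopf_differential (F t) u (e1 t u) (e1 t u))"
  unfolding hopf_coefficient_def
proof (intro ballI allI)
  fix t u v w assume t: "t \<in> {-r<..<r}" and u: "u \<in> W"
  note l = lin[OF t u]
  let ?z = "\<lambda>v. Complex (\<omega>1 t u v) (\<omega>2 t u v)"
  have ortho: "metric (F t) u (e1 t u) (e1 t u) = 1" "metric (F t) u (e2 t u) (e2 t u) = 1"
    "metric (F t) u (e1 t u) (e2 t u) = 0" "e1 t u $ 1 * e2 t u $ 2 - e1 t u $ 2 * e2 t u $ 1 > 0"
    using frame t u by (auto simp: tangent_frame_def)
  note rot = rot_frame[OF l ortho]
  have add: "rot (F t) u (a *\<^sub>R x + b *\<^sub>R y) = a *\<^sub>R rot (F t) u x + b *\<^sub>R rot (F t) u y" for a b x y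
    by (simp add: rot_def metric_axis[OF l] vec_eq_iff forall_2 algebra_simps add_divide_distrib diff_divide_distrib)
  have span: "v = \<omega>1 t u v *\<^sub>R e1 t u + \<omega>2 t u v *\<^sub>R e2 t u" for v
  proof -
    define d where "d = e1 t u $ 1 * e2 t u $ 2 - e1 t u $ 2 * e2 t u $ 1"
    have d: "d \<noteq> 0" using ortho(4) by (simp add: d_def)
    define a b where "a = (v $ 1 * e2 t u $ 2 - v $ 2 * e2 t u $ 1) / d"
      and "b = (e1 t u $ 1 * v $ 2 - e1 t u $ 2 * v $ 1) / d"
    have v: "v = a *\<^sub>R e1 t u + b *\<^sub>R e2 t u"
      using d by (simp add: a_def b_def vec_eq_iff forall_2 divide_simps) (simp add: d_def algebra_simps)
    have w: "linear (\<omega>1 t u)" "linear (\<omega>2 t u)"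
      "\<omega>1 t u (e1 t u) = 1" "\<omega>1 t u (e2 t u) = 0" "\<omega>2 t u (e1 t u) = 0" "\<omega>2 t u (e2 t u) = 1"
      using dual t u by (auto simp: dual_coframe_def)
    have "\<omega>1 t u v = a" "\<omega>2 t u v = b"
      unfolding v using w by (simp_all add: linear_add linear_scale)
    then show ?thesis using v by simp
  qed
  have part: "part_1_0 (F t) u v = ?z v *s part_1_0 (F t) u (e1 t u)" for v
  proof -
    have r: "rot (F t) u v = \<omega>1 t u v *\<^sub>R e2 t u - \<omega>2 t u v *\<^sub>R e1 t u"
      by (subst span[of v], subst add) (simp add: rot)
    have v: "v $ k = \<omega>1 t u v * e1 t u $ k + \<omega>2 t u v * e2 t u $ k" for k
      by (subst span[of v]) simp
    show ?thesis
      unfolding part_1_0_def r rot(1)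
      by (simp add: vec_eq_iff cvec_def v complex_eq_iff algebra_simps)
  qed
  have scale: "second_fundamental_form_C (F t) u (a *s Z) (b *s Z) =
      (a * b) *s second_fundamental_form_C (F t) u Z Z" for a b Z
    by (simp add: second_fundamental_form_C_def vec_eq_iff sum_2 algebra_simps)
  show "hopf_differential (F t) u v w =
      (?z v * ?z w) *s hopf_differential (F t) u (e1 t u) (e1 t u)"
    unfolding hopf_differential_def part[of v] part[of w] scale ..
qed

text \<open>It is enough to take frames over parts of single charts: both the hypotheses on a frame and the
  conclusion are local.\<close>

definition preserves_hopf_differential ::
    "'m chart set \<Rightarrow> ('m \<Rightarrow> real^4) \<Rightarrow> ('m \<Rightarrow> real^4) \<Rightarrow> 'm normal_frame set \<Rightarrow> bool" where
  "preserves_hopf_differential A f T \<E> \<longleftrightarrow>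
     (\<forall>(V, x)\<in>A. \<forall>W r e1 e2 \<omega>1 \<omega>2 \<psi>.
        W \<subseteq> V \<and> tangent_frame (\<lambda>t. deform f T t \<circ> x) W r e1 e2 \<and>
        dual_coframe W r e1 e2 \<omega>1 \<omega>2 \<and>
        stationary_frame (\<lambda>t. deform f T t \<circ> x) W e1 e2 \<omega>1 \<omega>2 \<and>
        hopf_coefficient (\<lambda>t. deform f T t \<circ> x) W r \<omega>1 \<omega>2 \<psi> \<longrightarrow>
        preserved \<E> x W (\<lambda>t u. \<chi> k. Re (\<psi> t u $ k)) \<and>
        preserved \<E> x W (\<lambda>t u. \<chi> k. Im (\<psi> t u $ k)))"

definition preserves_parallelly_mean_curvature_and_hopf ::
    "'m::topological_space chart set \<Rightarrow> ('m \<Rightarrow> real^4) \<Rightarrow> ('m \<Rightarrow> real^4) \<Rightarrow> bool" where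
  "preserves_parallelly_mean_curvature_and_hopf A f T \<longleftrightarrow>
     (\<exists>\<E>. parallel_frame_system A f T \<E> \<and>
        preserves_mean_curvature A f T \<E> \<and> preserves_hopf_differential A f T \<E>)"

end

theory Submission
  imports Defs
begin

text \<open>In an adapted orthonormal frame \<open>\<epsilon>\<^sub>1, \<dots>, \<epsilon>\<^sub>4\<close> (tangent and normal) of the deformed surface, the
  connection matrix \<open>\<Omega>(t)\<close> in \<open>d\<epsilon>(t) = \<Omega>(t) \<epsilon>(t)\<close> is skew-symmetric, and its entries are
  \<open>\<omega>\<^sub>1\<^sub>2\<close>, \<open>\<omega>\<^sub>3\<^sub>4\<close> and the components of the second fundamental form. The metric of \<open>f + tT\<close> is even
  in \<open>t\<close>, so \<open>\<delta>\<omega>\<^sub>1\<^sub>2 = 0\<close>; parallel preservation of \<open>H\<close> and of the Hopf differential says that all the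
  other entries are stationary as well. Writing \<open>\<delta>\<epsilon>\<^sub>a = B \<epsilon>\<^sub>a\<close> with a skew-symmetric matrix \<open>B\<close> that depends on the
  point, \<open>\<delta>\<Omega> = 0\<close> gives \<open>dB = 0\<close>, whence \<open>T = Bf + c\<close> near each point. Coherence of the frames makes
  \<open>B\<close> independent of the frame, and connectedness makes \<open>B\<close> and \<open>c\<close> global. Conversely, if \<open>T = Bf + c\<close>,
  then there are normal frames with \<open>\<delta>e\<^sub>a = B e\<^sub>a\<close>, and everything in sight turns with \<open>B\<close> to first order.\<close>

section \<open>Calculus of smooth maps\<close>

text \<open>For a fixed normal direction the second fundamental form in an orthonormal tangent frame
  is a symmetric 2 by 2 matrix. \<open>H\<close> gives its trace; the real and imaginary parts of
  the Hopf coefficient give the difference of the diagonal entries and the off-diagonal entry. So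
  nothing of the form escapes the hypotheses. The obstacle is uniqueness: where \<open>f\<close> is
  planar, \<open>T = Bf + c\<close> does not determine \<open>B\<close>, since a rotation of the
  plane orthogonal to the surface is invisible in \<open>T\<close>. A local motion is therefore
  taken together with the turning of the normal frames (\<open>motion_at\<close>): tangent vectors
  fix \<open>B\<close> on the tangent plane, frames fix it on the normal plane. Preservation of the
  Hopf differential quantifies over stationary tangent frames, so it has content only once such a
  frame is exhibited. Gram-Schmidt applied to the coordinate fields provides one, because it depends
  on the metric alone. For this reason the only function needed below besides linear maps and
  products is the reciprocal square root.\<close>

lemma has_derivative_D:
  assumes "open S" "F differentiable_on S" "u \<in> S"
  shows "(F has_derivative D F u) (at u)"
  using assms by (metis differentiable_on_eq_differentiable_at frechet_derivative_works)

lemma D_eqI: "(F has_derivative F') (at u) \<Longrightarrow> D F u v = F' v"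
  by (metis frechet_derivative_at)

lemma C_on_cong:
  assumes "open S" "C_on k S F" "\<And>u. u \<in> S \<Longrightarrow> F u = G u"
  shows "C_on k S G"
  using assms(2,3)
proof (induction k arbitrary: F G)
  case 0
  then show ?case by (auto cong: continuous_on_cong)
next
  case (Suc k)
  have hd: "(G has_derivative D F u) (at u)" if "u \<in> S" for u
    using has_derivative_D[OF assms(1) _ that, of F] Suc.prems that
    by (auto intro: has_derivative_transform_within_open[OF _ assms(1) that])
  then have "G differentiable_on S"
    unfolding differentiable_on_def by (meson differentiableI has_derivative_at_withinI)
  moreover have "C_on k S (\<lambda>u. D G u v)" for v
    by (rule Suc.IH[of "\<lambda>u. D F u v"]) (use Suc.prems D_eqI[OF hd] in auto)
  ultimately show ?case by simp
qed

text \<open>\<open>D\<close> is an operator defined by choice; this rule allows any explicit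
  derivative \<open>F'\<close> to be supplied instead, and every closure property below is an
  induction that applies it to a known differentiation rule.\<close>

lemma C_on_SucI:
  assumes "open S" "\<And>u. u \<in> S \<Longrightarrow> (F has_derivative F' u) (at u)"
    and "\<And>v. C_on k S (\<lambda>u. F' u v)"
  shows "C_on (Suc k) S F"
proof -
  have "F differentiable_on S"
    unfolding differentiable_on_def by (meson assms(2) differentiableI has_derivative_at_withinI)
  moreover have "C_on k S (\<lambda>u. D F u v)" for v
    by (rule C_on_cong[OF assms(1) assms(3)[of v]]) (simp add: D_eqI[OF assms(2)])
  ultimately show ?thesis by simp
qed

lemma C_on_SucD: "C_on (Suc k) S F \<Longrightarrow> C_on k S F"
  by (induction k arbitrary: F) (auto simp: differentiable_imp_continuous_on)

lemma C_on_subset: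
  assumes "C_on k S F" "open S" "open S'" "S' \<subseteq> S"
  shows "C_on k S' F"
  using assms by (induction k arbitrary: F) (auto intro: continuous_on_subset differentiable_on_subset)

lemma C_on_const: "open S \<Longrightarrow> C_on k S (\<lambda>u. c)"
  by (induction k arbitrary: c) (auto intro: C_on_SucI)

lemma C_on_ident: "open S \<Longrightarrow> C_on k S (\<lambda>u. u)"
  by (cases k) (auto intro!: C_on_SucI C_on_const)

lemma C_on_linear_image:
  assumes "open S" "bounded_linear L" "C_on k S F"
  shows "C_on k S (\<lambda>u. L (F u))"
  using assms(3)
proof (induction k arbitrary: F)
  case 0
  then show ?case by (simp add: assms(2) bounded_linear.continuous_on)
next
  case (Suc k)
  show ?case
    by (rule C_on_SucI[OF assms(1), where F' = "\<lambda>u v. L (D F u v)"])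
       (use Suc in \<open>auto intro!: bounded_linear.has_derivative[OF assms(2)] has_derivative_D[OF assms(1)]\<close>)
qed

lemma C_on_add:
  assumes "open S" "C_on k S F" "C_on k S G"
  shows "C_on k S (\<lambda>u. F u + G u)"
  using assms(2,3)
proof (induction k arbitrary: F G)
  case 0
  then show ?case by (simp add: continuous_on_add)
next
  case (Suc k)
  show ?case
    by (rule C_on_SucI[OF assms(1), where F' = "\<lambda>u v. D F u v + D G u v"])
       (use Suc in \<open>auto intro!: derivative_intros has_derivative_D[OF assms(1)]\<close>)
qed

text \<open>The product rule returns two terms of the same shape, one order lower, so the induction
  closes; the undifferentiated factor is lowered by \<open>C_on_SucD\<close>. Real products, scaling
  and inner products are all instances.\<close>

lemma C_on_bilinear:
  assumes "open S" "bounded_bilinear p" "C_on k S F" "C_on k S G"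
  shows "C_on k S (\<lambda>u. p (F u) (G u))"
  using assms(3,4)
proof (induction k arbitrary: F G)
  case 0
  then show ?case by (simp add: assms(2) bounded_bilinear.continuous_on)
next
  case (Suc k)
  show ?case
    by (rule C_on_SucI[OF assms(1), where F' = "\<lambda>u v. p (F u) (D G u v) + p (D F u v) (G u)"])
       (use Suc C_on_SucD[OF Suc.prems(1)] C_on_SucD[OF Suc.prems(2)] in \<open>auto intro!: C_on_add[OF assms(1)]
          bounded_bilinear.FDERIV[OF assms(2)] has_derivative_D[OF assms(1)]\<close>)
qed

text \<open>With \<open>r = 1 / sqrt q\<close> one has \<open>r' = - r^3 q' / 2\<close>, a product
  of \<open>r\<close> itself and \<open>q'\<close>. The induction therefore closes without a chain
  rule for maps of class \<open>C_on k\<close>.\<close>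

lemma C_on_rsqrt:
  assumes "open S" "C_on k S q" "\<And>u. u \<in> S \<Longrightarrow> q u > (0::real)"
  shows "C_on k S (\<lambda>u. 1 / sqrt (q u))"
  using assms(2)
proof (induction k)
  case 0
  then show ?case using assms(3) by (auto intro!: continuous_intros simp: less_imp_neq)
                   (metis less_irrefl)
next
  case (Suc k)
  let ?r = "\<lambda>u. 1 / sqrt (q u)"
  have r: "C_on k S ?r" using Suc C_on_SucD by blast
  note m = C_on_bilinear[OF assms(1) bounded_bilinear_mult]
  show ?case
  proof (rule C_on_SucI[OF assms(1), where F' = "\<lambda>u v. (- 1/2) * (?r u * (?r u * ?r u)) * D q u v"])
    fix u assume u: "u \<in> S"
    have "(q has_derivative D q u) (at u)"
      using Suc.prems u by (auto intro: has_derivative_D[OF assms(1)])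
    moreover have "((\<lambda>y. 1 / sqrt y) has_real_derivative (- 1/2) * (?r u * (?r u * ?r u))) (at (q u))"
      using assms(3)[OF u] by (auto intro!: derivative_eq_intros simp: field_simps real_sqrt_mult)
    ultimately show "(?r has_derivative (\<lambda>v. (- 1/2) * (?r u * (?r u * ?r u)) * D q u v)) (at u)"
      unfolding has_field_derivative_def
      by (rule has_derivative_compose)
  next
    show "C_on k S (\<lambda>u. (- 1/2) * (?r u * (?r u * ?r u)) * D q u v)" for v
      using Suc.prems by (intro m r C_on_const[OF assms(1)]) simp
  qed
qed

text \<open>The inner map has the same derivative \<open>L\<close> everywhere, so one
  differentiation changes only \<open>F\<close>. This covers the projection from space and time to
  space.\<close>

lemma C_on_affine:
  assumes "open S" "open S'" "C_on k S F" "\<And>x. x \<in> S' \<Longrightarrow> \<phi> x \<in> S"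
    and \<phi>: "\<And>x. (\<phi> has_derivative L) (at x)"
  shows "C_on k S' (\<lambda>x. F (\<phi> x))"
  using assms(3)
proof (induction k arbitrary: F)
  case 0
  have "continuous_on S' \<phi>"
    using \<phi> by (meson differentiable_def differentiable_imp_continuous_on differentiable_on_def has_derivative_at_withinI)
  then show ?case using 0 assms(4) by (auto intro!: continuous_on_compose2[of S F])
next
  case (Suc k)
  show ?case
    by (rule C_on_SucI[OF assms(2), where F' = "\<lambda>x v. D F (\<phi> x) (L v)"])
       (use Suc assms(4) in \<open>auto intro!: has_derivative_compose[OF \<phi>] has_derivative_D[OF assms(1)]\<close>)
qed

named_theorems smooth

lemma smooth_on_subset: "smooth_on S F \<Longrightarrow> open S \<Longrightarrow> open S' \<Longrightarrow> S' \<subseteq> S \<Longrightarrow> smooth_on S' F"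
  unfolding smooth_on_def using C_on_subset by blast

lemma smooth_on_cong: "open S \<Longrightarrow> smooth_on S F \<Longrightarrow> (\<And>u. u \<in> S \<Longrightarrow> F u = G u) \<Longrightarrow> smooth_on S G"
  unfolding smooth_on_def using C_on_cong by blast

lemma smooth_on_const [smooth]: "open S \<Longrightarrow> smooth_on S (\<lambda>u. c)"
  by (simp add: smooth_on_def C_on_const)

lemma smooth_on_linear_image:
  "bounded_linear L \<Longrightarrow> open S \<Longrightarrow> smooth_on S F \<Longrightarrow> smooth_on S (\<lambda>u. L (F u))"
  by (simp add: smooth_on_def C_on_linear_image)

lemma smooth_on_bilinear:
  "bounded_bilinear p \<Longrightarrow> open S \<Longrightarrow> smooth_on S F \<Longrightarrow> smooth_on S G \<Longrightarrow> smooth_on S (\<lambda>u. p (F u) (G u))"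
  by (simp add: smooth_on_def C_on_bilinear)

lemma smooth_on_add [smooth]:
  "open S \<Longrightarrow> smooth_on S F \<Longrightarrow> smooth_on S G \<Longrightarrow> smooth_on S (\<lambda>u. F u + G u)"
  by (simp add: smooth_on_def C_on_add)

lemmas smooth_on_mult [smooth] = smooth_on_bilinear[OF bounded_bilinear_mult]
lemmas smooth_on_scaleR [smooth] = smooth_on_bilinear[OF bounded_bilinear_scaleR]
lemmas smooth_on_inner [smooth] = smooth_on_bilinear[OF bounded_bilinear_inner]
lemmas smooth_on_minus [smooth] = smooth_on_linear_image[OF bounded_linear_minus[OF bounded_linear_ident]]

lemma smooth_on_diff [smooth]:
  "open S \<Longrightarrow> smooth_on S F \<Longrightarrow> smooth_on S G \<Longrightarrow> smooth_on S (\<lambda>u. F u - G u)"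
  using smooth_on_add[of S F "\<lambda>u. - G u"] smooth_on_minus by auto

lemma smooth_on_rsqrt [smooth]:
  "open S \<Longrightarrow> smooth_on S q \<Longrightarrow> (\<And>u. u \<in> S \<Longrightarrow> q u > 0) \<Longrightarrow> smooth_on S (\<lambda>u. 1 / sqrt (q u))"
  by (simp add: smooth_on_def C_on_rsqrt)

lemma smooth_on_affine:
  assumes "smooth_on S F" "open S" "open S'" "\<And>x. x \<in> S' \<Longrightarrow> \<phi> x \<in> S"
    and "\<And>x. (\<phi> has_derivative L) (at x)"
  shows "smooth_on S' (\<lambda>x. F (\<phi> x))"
  using assms C_on_affine[of S S'] unfolding smooth_on_def by blast

lemma smooth_on_snd [smooth]:
  "open S \<Longrightarrow> smooth_on (S::('a::euclidean_space \<times> 'b::euclidean_space) set) (\<lambda>z. snd z)"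
  using smooth_on_linear_image[OF bounded_linear_snd, of S "\<lambda>u. u"] by (simp add: smooth_on_def C_on_ident)

lemma smooth_on_fst:
  fixes F :: "'a::euclidean_space \<Rightarrow> 'b::real_normed_vector" and I :: "'c::euclidean_space set"
  assumes "smooth_on S F" "open S" "open I"
  shows "smooth_on (S \<times> I) (\<lambda>z. F (fst z))"
  by (rule smooth_on_affine[OF assms(1,2) open_Times[OF assms(2,3)]])
     (auto intro!: derivative_eq_intros bounded_linear_imp_has_derivative bounded_linear_fst)

lemma smooth_on_D [smooth]: "smooth_on S F \<Longrightarrow> smooth_on S (\<lambda>u. D F u v)"
  unfolding smooth_on_def by (metis C_on.simps(2))

lemma smooth_on_has_derivative:
  "smooth_on S F \<Longrightarrow> open S \<Longrightarrow> u \<in> S \<Longrightarrow> (F has_derivative D F u) (at u)"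
  unfolding smooth_on_def by (metis C_on.simps(2) has_derivative_D)

lemma smooth_on_continuous: "smooth_on S F \<Longrightarrow> continuous_on S F"
  unfolding smooth_on_def by (metis C_on.simps(1))

lemma smooth_on_linear: "smooth_on S F \<Longrightarrow> open S \<Longrightarrow> u \<in> S \<Longrightarrow> linear (D F u)"
  using smooth_on_has_derivative has_derivative_linear by blast

section \<open>Symmetry of second derivatives\<close>

lemma mixed_difference_mean_value:
  fixes \<phi> :: "'a::euclidean_space \<Rightarrow> real"
  assumes S: "open S" "smooth_on S \<phi>" and h: "h > 0"
    and box: "\<And>s t. 0 \<le> s \<Longrightarrow> s \<le> h \<Longrightarrow> 0 \<le> t \<Longrightarrow> t \<le> h \<Longrightarrow> z + s *\<^sub>R a + t *\<^sub>R b \<in> S"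
  shows "\<exists>\<xi> \<eta>. 0 < \<xi> \<and> \<xi> < h \<and> 0 < \<eta> \<and> \<eta> < h \<and>
    \<phi> (z + h *\<^sub>R a + h *\<^sub>R b) - \<phi> (z + h *\<^sub>R a) - \<phi> (z + h *\<^sub>R b) + \<phi> z
      = h * h * D (\<lambda>q. D \<phi> q a) (z + \<xi> *\<^sub>R a + \<eta> *\<^sub>R b) b"
proof -
  have line: "((\<lambda>s. G (w + s *\<^sub>R v)) has_real_derivative D G (w + s *\<^sub>R v) v) (at s)"
    if "smooth_on S G" "w + s *\<^sub>R v \<in> S" for G :: "'a \<Rightarrow> real" and w v s
  proof -
    note d = smooth_on_has_derivative[OF that(1) S(1) that(2)]
    have "((\<lambda>s. w + s *\<^sub>R v) has_derivative (\<lambda>s. s *\<^sub>R v)) (at s)"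
      by (auto intro!: derivative_eq_intros)
    from has_derivative_compose[OF this d] show ?thesis
      unfolding has_field_derivative_def
      by (simp add: linear_scale[OF has_derivative_linear[OF d]] mult_commute_abs)
  qed
  \<comment> \<open>The mean value theorem is applied first to this difference as a function of
    \<open>s\<close>, then to its derivative as a function of the other variable.\<close>
  have dd: "((\<lambda>s. \<phi> (z + h *\<^sub>R b + s *\<^sub>R a) - \<phi> (z + s *\<^sub>R a)) has_real_derivative
      D \<phi> (z + h *\<^sub>R b + s *\<^sub>R a) a - D \<phi> (z + s *\<^sub>R a) a) (at s)" if "0 \<le> s" "s \<le> h" for s
    using line[OF S(2), of "z + h *\<^sub>R b" s a] line[OF S(2), of z s a] box[of s h] box[of s 0] that h
    by (auto intro!: DERIV_diff simp: algebra_simps)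
  obtain \<xi> where \<xi>: "0 < \<xi>" "\<xi> < h"
    "\<phi> (z + h *\<^sub>R b + h *\<^sub>R a) - \<phi> (z + h *\<^sub>R a) - (\<phi> (z + h *\<^sub>R b + 0 *\<^sub>R a) - \<phi> (z + 0 *\<^sub>R a))
      = (h - 0) * (D \<phi> (z + h *\<^sub>R b + \<xi> *\<^sub>R a) a - D \<phi> (z + \<xi> *\<^sub>R a) a)"
    using MVT2[OF h dd] by auto
  have dd2: "((\<lambda>t. D \<phi> (z + \<xi> *\<^sub>R a + t *\<^sub>R b) a) has_real_derivative
      D (\<lambda>q. D \<phi> q a) (z + \<xi> *\<^sub>R a + t *\<^sub>R b) b) (at t)" if "0 \<le> t" "t \<le> h" for t
    using line[OF smooth_on_D[OF S(2), of a], of "z + \<xi> *\<^sub>R a" t b] box[of \<xi> t] that \<xi> by auto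
  obtain \<eta> where \<eta>: "0 < \<eta>" "\<eta> < h"
    "D \<phi> (z + \<xi> *\<^sub>R a + h *\<^sub>R b) a - D \<phi> (z + \<xi> *\<^sub>R a + 0 *\<^sub>R b) a
      = (h - 0) * D (\<lambda>q. D \<phi> q a) (z + \<xi> *\<^sub>R a + \<eta> *\<^sub>R b) b"
    using MVT2[OF h dd2] by auto
  have "\<phi> (z + h *\<^sub>R a + h *\<^sub>R b) - \<phi> (z + h *\<^sub>R a) - \<phi> (z + h *\<^sub>R b) + \<phi> z
      = h * (D \<phi> (z + h *\<^sub>R b + \<xi> *\<^sub>R a) a - D \<phi> (z + \<xi> *\<^sub>R a) a)"
    using \<xi>(3) by (simp add: algebra_simps)
  also have "\<dots> = h * (D \<phi> (z + \<xi> *\<^sub>R a + h *\<^sub>R b) a - D \<phi> (z + \<xi> *\<^sub>R a + 0 *\<^sub>R b) a)"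
    by (simp add: algebra_simps)
  also have "\<dots> = h * h * D (\<lambda>q. D \<phi> q a) (z + \<xi> *\<^sub>R a + \<eta> *\<^sub>R b) b"
    unfolding \<eta>(3) by simp
  finally show ?thesis using \<xi> \<eta> by blast
qed

text \<open>The second difference over a small parallelogram does not change when \<open>a\<close>
  and \<open>b\<close> are exchanged, whereas its two mean value expressions are
  \<open>h * h\<close> times one or the other mixed derivative at nearby points. Continuity of both
  derivatives lets \<open>h\<close> go to zero.\<close>

lemma second_derivative_symmetric_real:
  fixes \<phi> :: "'a::euclidean_space \<Rightarrow> real"
  assumes S: "open S" "smooth_on S \<phi>" and z: "z \<in> S"
  shows "D (\<lambda>q. D \<phi> q a) z b = D (\<lambda>q. D \<phi> q b) z a"
proof -
  have small: "\<exists>d>0. \<forall>h. 0 < h \<and> h < d \<longrightarrow>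
      (\<forall>s t. 0 \<le> s \<and> s \<le> h \<and> 0 \<le> t \<and> t \<le> h \<longrightarrow> z + s *\<^sub>R a + t *\<^sub>R b \<in> ball z e)" if "e > 0" for e
  proof -
    \<comment> \<open>The summand 1 keeps the quotient below meaningful when \<open>a\<close> and
      \<open>b\<close> both vanish.\<close>
    have p: "norm a + norm b + 1 > 0" by (simp add: add_nonneg_pos)
    have "z + s *\<^sub>R a + t *\<^sub>R b \<in> ball z e"
      if "h < e / (norm a + norm b + 1)" "0 < h" "0 \<le> s" "s \<le> h" "0 \<le> t" "t \<le> h" for h s t
    proof -
      have "norm (s *\<^sub>R a + t *\<^sub>R b) \<le> s * norm a + t * norm b"
        using norm_triangle_ineq[of "s *\<^sub>R a" "t *\<^sub>R b"] that by simp
      also have "\<dots> \<le> h * norm a + h * norm b"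
        using that by (intro add_mono mult_right_mono) auto
      also have "\<dots> \<le> h * (norm a + norm b + 1)" using that by (simp add: algebra_simps)
      also have "\<dots> < e" using that p by (simp add: field_simps)
      finally have "dist z (z + (s *\<^sub>R a + t *\<^sub>R b)) < e" by (metis add_diff_cancel_left' dist_commute dist_norm)
      then show ?thesis by (simp add: add.assoc)
    qed
    then show ?thesis using \<open>e > 0\<close> p by (intro exI[of _ "e / (norm a + norm b + 1)"]) auto
  qed
  have close: "\<exists>e>0. ball z e \<subseteq> S \<and> (\<forall>w\<in>ball z e. \<bar>G w - G z\<bar> < \<epsilon>)"
    if "\<epsilon> > 0" "smooth_on S G" for \<epsilon> and G :: "'a \<Rightarrow> real"
  proof -
    obtain e1 where e1: "e1 > 0" "ball z e1 \<subseteq> S" using S(1) z openE by blast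
    have "continuous (at z) G"
      using smooth_on_continuous[OF that(2)] S(1) z continuous_on_eq_continuous_at by blast
    then obtain e2 where e2: "e2 > 0" "\<And>w. dist w z < e2 \<Longrightarrow> dist (G w) (G z) < \<epsilon>"
      using \<open>\<epsilon> > 0\<close> unfolding continuous_at_eps_delta by blast
    show ?thesis
      by (rule exI[of _ "min e1 e2"]) (use e1 e2 in \<open>auto simp: dist_commute dist_real_def\<close>)
  qed
  let ?A = "D (\<lambda>q. D \<phi> q a) z b" and ?B = "D (\<lambda>q. D \<phi> q b) z a"
  have "\<bar>?A - ?B\<bar> < \<epsilon>" if "\<epsilon> > 0" for \<epsilon>
  proof -
    obtain e1 where e1: "e1 > 0" "ball z e1 \<subseteq> S"
      "\<forall>w\<in>ball z e1. \<bar>D (\<lambda>q. D \<phi> q a) w b - ?A\<bar> < \<epsilon> / 2"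
      using close[OF _ smooth_on_D[OF smooth_on_D[OF S(2), of a], of b], of "\<epsilon> / 2"] \<open>\<epsilon> > 0\<close>
        half_gt_zero by metis
    obtain e2 where e2: "e2 > 0" "ball z e2 \<subseteq> S"
      "\<forall>w\<in>ball z e2. \<bar>D (\<lambda>q. D \<phi> q b) w a - ?B\<bar> < \<epsilon> / 2"
      using close[OF _ smooth_on_D[OF smooth_on_D[OF S(2), of b], of a], of "\<epsilon> / 2"] \<open>\<epsilon> > 0\<close>
        half_gt_zero by metis
    obtain d where d: "d > 0" "\<And>h s t. 0 < h \<Longrightarrow> h < d \<Longrightarrow> 0 \<le> s \<Longrightarrow> s \<le> h \<Longrightarrow> 0 \<le> t \<Longrightarrow> t \<le> h
        \<Longrightarrow> z + s *\<^sub>R a + t *\<^sub>R b \<in> ball z (min e1 e2)"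
      using small[of "min e1 e2"] e1 e2 by auto
    define h where "h = d / 2"
    have h: "h > 0" "h < d" using d(1) by (auto simp: h_def)
    have box: "z + s *\<^sub>R a + t *\<^sub>R b \<in> ball z e1" "z + s *\<^sub>R a + t *\<^sub>R b \<in> ball z e2"
      if "0 \<le> s" "s \<le> h" "0 \<le> t" "t \<le> h" for s t using d(2)[OF h that] by auto
    obtain \<xi> \<eta> where 1: "0 < \<xi>" "\<xi> < h" "0 < \<eta>" "\<eta> < h"
      "\<phi> (z + h *\<^sub>R a + h *\<^sub>R b) - \<phi> (z + h *\<^sub>R a) - \<phi> (z + h *\<^sub>R b) + \<phi> z
      = h * h * D (\<lambda>q. D \<phi> q a) (z + \<xi> *\<^sub>R a + \<eta> *\<^sub>R b) b"
      using mixed_difference_mean_value[OF S h(1), of z a b] box e1 by blast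
    have box': "z + s *\<^sub>R b + t *\<^sub>R a \<in> S" if "0 \<le> s" "s \<le> h" "0 \<le> t" "t \<le> h" for s t
      using box(1)[OF that(3,4,1,2)] e1(2) by (auto simp: algebra_simps)
    obtain \<xi>' \<eta>' where 2: "0 < \<xi>'" "\<xi>' < h" "0 < \<eta>'" "\<eta>' < h"
      "\<phi> (z + h *\<^sub>R b + h *\<^sub>R a) - \<phi> (z + h *\<^sub>R b) - \<phi> (z + h *\<^sub>R a) + \<phi> z
      = h * h * D (\<lambda>q. D \<phi> q b) (z + \<xi>' *\<^sub>R b + \<eta>' *\<^sub>R a) a"
      using mixed_difference_mean_value[OF S h(1), of z b a] box' by blast
    have "h * h * D (\<lambda>q. D \<phi> q a) (z + \<xi> *\<^sub>R a + \<eta> *\<^sub>R b) b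
        = h * h * D (\<lambda>q. D \<phi> q b) (z + \<xi>' *\<^sub>R b + \<eta>' *\<^sub>R a) a"
      unfolding 1(5)[symmetric] 2(5)[symmetric] by (simp add: algebra_simps)
    then have "D (\<lambda>q. D \<phi> q a) (z + \<xi> *\<^sub>R a + \<eta> *\<^sub>R b) b
        = D (\<lambda>q. D \<phi> q b) (z + \<eta>' *\<^sub>R a + \<xi>' *\<^sub>R b) a"
      using h by (simp add: algebra_simps)
    moreover have "\<bar>D (\<lambda>q. D \<phi> q a) (z + \<xi> *\<^sub>R a + \<eta> *\<^sub>R b) b - ?A\<bar> < \<epsilon> / 2"
      using e1(3) box(1)[of \<xi> \<eta>] 1 by auto
    moreover have "\<bar>D (\<lambda>q. D \<phi> q b) (z + \<eta>' *\<^sub>R a + \<xi>' *\<^sub>R b) a - ?B\<bar> < \<epsilon> / 2"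
      using e2(3) box(2)[of \<eta>' \<xi>'] 2 by auto
    ultimately show ?thesis by linarith
  qed
  from this[of "\<bar>?A - ?B\<bar>"] show ?thesis by linarith
qed

text \<open>Pairing with an arbitrary vector \<open>c\<close> reduces this to the real case.\<close>

lemma second_derivative_symmetric:
  fixes F :: "'a::euclidean_space \<Rightarrow> 'b::real_inner"
  assumes S: "open S" "smooth_on S F" and z: "z \<in> S"
  shows "D (\<lambda>q. D F q a) z b = D (\<lambda>q. D F q b) z a"
proof -
  have D1: "D (\<lambda>q. G q \<bullet> c) q v = D G q v \<bullet> c" if "smooth_on S G" "q \<in> S" for G :: "'a \<Rightarrow> 'b" and c q v
    by (rule D_eqI) (auto intro!: derivative_eq_intros smooth_on_has_derivative[OF that(1) S(1) that(2)])
  have D2: "D (\<lambda>q. D (\<lambda>q. F q \<bullet> c) q v) z w = D (\<lambda>q. D F q v) z w \<bullet> c" for c v w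
  proof -
    have "((\<lambda>q. D F q v \<bullet> c) has_derivative (\<lambda>w. D (\<lambda>q. D F q v) z w \<bullet> c)) (at z)"
      by (auto intro!: derivative_eq_intros smooth_on_has_derivative[OF smooth_on_D[OF S(2)] S(1) z])
    then have "((\<lambda>q. D (\<lambda>q. F q \<bullet> c) q v) has_derivative (\<lambda>w. D (\<lambda>q. D F q v) z w \<bullet> c)) (at z)"
      by (rule has_derivative_transform_within_open[OF _ S(1) z]) (simp add: D1[OF S(2)])
    then show ?thesis by (rule D_eqI)
  qed
  have "smooth_on S (\<lambda>q. F q \<bullet> c)" for c using S by (intro smooth)
  from second_derivative_symmetric_real[OF S(1) this z] D2
  have "D (\<lambda>q. D F q a) z b \<bullet> c = D (\<lambda>q. D F q b) z a \<bullet> c" for c by metis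
  then show ?thesis by (metis inner_commute vector_eq_rdot)
qed

section \<open>Maps of space and time jointly\<close>

lemma derivative_in_time:
  fixes G :: "'a::euclidean_space \<times> real \<Rightarrow> 'b::real_inner"
  assumes "smooth_on S G" "open S" "(u, t) \<in> S"
  shows "((\<lambda>t. G (u, t)) has_vector_derivative D G (u, t) (0, 1)) (at t)"
proof -
  note d = smooth_on_has_derivative[OF assms]
  have "((\<lambda>t. (u, t)) has_derivative (\<lambda>s. (0, s))) (at t)"
    by (auto intro!: derivative_eq_intros)
  from has_derivative_compose[OF this d] show ?thesis
    unfolding has_vector_derivative_def
    by (simp add: linear_scale[OF has_derivative_linear[OF d], symmetric])
qed

lemma derivative_in_space:
  fixes G :: "'a::euclidean_space \<times> real \<Rightarrow> 'b::real_inner"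
  assumes "smooth_on S G" "open S" "(u, t) \<in> S"
  shows "((\<lambda>u. G (u, t)) has_derivative (\<lambda>v. D G (u, t) (v, 0))) (at u)"
proof -
  have "((\<lambda>u. (u, t)) has_derivative (\<lambda>v. (v, 0))) (at u)"
    by (auto intro!: derivative_eq_intros)
  from has_derivative_compose[OF this smooth_on_has_derivative[OF assms]] show ?thesis .
qed

text \<open>Derivatives in space and time commute: this is symmetry of the second derivative of
  \<open>G\<close> in the directions \<open>(v, 0)\<close> and \<open>(0, 1)\<close>. It is what
  turns information about the velocities of a frame into information about its connection form, and
  back.\<close>

lemma space_derivative_in_time:
  fixes G :: "'a::euclidean_space \<times> real \<Rightarrow> 'b::real_inner"
  assumes G: "smooth_on S G" "open S" "(u, t) \<in> S"
  shows "((\<lambda>t. D (\<lambda>q. G (q, t)) u v) has_vector_derivative D (\<lambda>q. D G (q, t) (0, 1)) u v) (at t)"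
proof -
  have "((\<lambda>t. D G (u, t) (v, 0)) has_vector_derivative D (\<lambda>z. D G z (v, 0)) (u, t) (0, 1)) (at t)"
    using derivative_in_time[OF smooth_on_D[OF G(1)] G(2,3)] .
  moreover have "D (\<lambda>z. D G z (v, 0)) (u, t) (0, 1) = D (\<lambda>q. D G (q, t) (0, 1)) u v"
    using second_derivative_symmetric[OF G(2,1,3)] 
      D_eqI[OF derivative_in_space[OF smooth_on_D[OF G(1)] G(2,3)]] by metis
  \<comment> \<open>The partial derivative equals \<open>D G (u, t) (v, 0)\<close> only at times
    with \<open>(u, t)\<close> in \<open>S\<close>; openness makes this enough for a derivative at
    \<open>t\<close>.\<close>
  moreover have "open {t. (u, t) \<in> S}"
    using open_vimage[OF G(2), of "\<lambda>t. (u, t)"] by (simp add: vimage_def continuous_on_Pair)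
  ultimately show ?thesis
    using has_vector_derivative_transform_within_open[of "\<lambda>t. D G (u, t) (v, 0)" _ t "{t. (u, t) \<in> S}"]
      D_eqI[OF derivative_in_space[OF G(1,2)]] G(3) by auto
qed

section \<open>Geometry of a parametrized surface\<close>

text \<open>Justifies the definite description: orthogonal projection gives a candidate, and the
  difference of two candidates lies in the tangent plane and is orthogonal to it.\<close>

lemma normal_part_decomposition:
  assumes "linear (D F u)"
  shows "normal_part F u w \<in> orthogonal_comp (range (D F u)) \<and> w - normal_part F u w \<in> range (D F u)"
  unfolding normal_part_def
proof (rule theI')
  have sub: "subspace (range (D F u))" using assms by (simp add: linear_subspace_image)
  obtain y z where yz: "y \<in> span (range (D F u))"
    "\<And>v. v \<in> span (range (D F u)) \<Longrightarrow> orthogonal z v" "w = y + z"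
    using orthogonal_subspace_decomp_exists[of "range (D F u)" w] by metis
  have span: "span (range (D F u)) = range (D F u)" using sub by (simp add: span_eq_iff)
  show "\<exists>!n. n \<in> orthogonal_comp (range (D F u)) \<and> w - n \<in> range (D F u)"
  proof (rule ex1I[of _ z])
    show "z \<in> orthogonal_comp (range (D F u)) \<and> w - z \<in> range (D F u)"
      using yz unfolding span orthogonal_comp_def by (auto intro: orthogonal_commute[THEN iffD1])
  next
    fix n assume n: "n \<in> orthogonal_comp (range (D F u)) \<and> w - n \<in> range (D F u)"
    have "z - n \<in> range (D F u)"
      using subspace_diff[OF sub, of "w - n" y] n yz unfolding span by (simp add: algebra_simps)
    moreover have "orthogonal v z" "orthogonal v n" if "v \<in> range (D F u)" for v
      using n yz that unfolding span by (auto simp: orthogonal_comp_def orthogonal_commute)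
    ultimately have "(z - n) \<bullet> (z - n) = 0"
      unfolding orthogonal_def by (metis (no_types) diff_0_right inner_diff_right)
    then show "n = z" by simp
  qed
qed

lemma normal_part_eqI:
  assumes "linear (D F u)" "n \<in> orthogonal_comp (range (D F u))" "w - n \<in> range (D F u)"
  shows "normal_part F u w = n"
proof -
  let ?m = "normal_part F u w"
  have m: "?m \<in> orthogonal_comp (range (D F u))" "w - ?m \<in> range (D F u)"
    using normal_part_decomposition[OF assms(1)] by auto
  have "subspace (range (D F u))" using assms(1) by (simp add: linear_subspace_image)
  then have "?m - n \<in> range (D F u)"
    using subspace_diff[of "range (D F u)" "w - n" "w - ?m"] m assms by simp
  then have "(?m - n) \<bullet> ?m = 0" "(?m - n) \<bullet> n = 0"
    using m(1) assms(2) by (auto simp: orthogonal_comp_def orthogonal_def)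
  then have "(?m - n) \<bullet> (?m - n) = 0" by (simp only: inner_diff_right)
  then show ?thesis by simp
qed

lemma in_orthogonal_comp_range:
  "n \<in> orthogonal_comp (range L) \<longleftrightarrow> (\<forall>v. L v \<bullet> n = 0)"
  by (auto simp: orthogonal_comp_def orthogonal_def)

lemma normal_part_inner:
  assumes "linear (D F u)" "n \<in> orthogonal_comp (range (D F u))"
  shows "normal_part F u w \<bullet> n = w \<bullet> n"
proof -
  have "(w - normal_part F u w) \<bullet> n = 0"
    using normal_part_decomposition[OF assms(1), of w] assms(2)
    by (auto simp: orthogonal_comp_def orthogonal_def)
  then show ?thesis by (simp add: inner_diff_left)
qed

lemma vec2_axis_expansion: "(v::real^2) = v $ 1 *\<^sub>R axis 1 1 + v $ 2 *\<^sub>R axis 2 1"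
  by (simp add: vec_eq_iff axis_def forall_2)

lemma D_axis_expansion:
  fixes F :: "real^2 \<Rightarrow> 'b::real_normed_vector"
  assumes "linear (D F u)"
  shows "D F u v = v $ 1 *\<^sub>R D F u (axis 1 1) + v $ 2 *\<^sub>R D F u (axis 2 1)"
  by (subst (1) vec2_axis_expansion[of v]) (simp add: linear_add[OF assms] linear_scale[OF assms])

lemma gram_positive:
  assumes lin: "linear (D F u)" and inj: "inj (D F u)"
  shows "gram F u $ 1 $ 1 > 0" "det (gram F u) > 0"
proof -
  have nz: "D F u v \<noteq> 0" if "v \<noteq> 0" for v
    using that inj lin by (metis injD linear_0)
  have a: "axis 1 1 \<noteq> (0::real^2)" by (simp add: axis_eq_0_iff)
  show pos: "gram F u $ 1 $ 1 > 0"
    using nz[OF a] by (simp add: gram_def metric_def)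
  \<comment> \<open>The second coordinate vector made orthogonal to the first, scaled to avoid a
    division. Its squared length is the first diagonal entry times the determinant, which yields the
    sign of the latter.\<close>
  define v :: "real^2" where
    "v = gram F u $ 1 $ 1 *\<^sub>R axis 2 1 - gram F u $ 1 $ 2 *\<^sub>R axis 1 1"
  have v12: "v $ 1 = - gram F u $ 1 $ 2" "v $ 2 = gram F u $ 1 $ 1"
    by (simp_all add: v_def axis_def)
  then have "v \<noteq> 0" using pos by auto
  then have "0 < metric F u v v" using nz by (simp add: metric_def)
  also have "metric F u v v = gram F u $ 1 $ 1 * det (gram F u)"
    by (simp add: metric_eq_gram[OF lin] det_gram v12 algebra_simps)
  finally show "det (gram F u) > 0" using pos zero_less_mult_pos by blast
qed

text \<open>The Gram--Schmidt frame of the coordinate fields.\<close>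

definition frame1 :: "(real^2 \<Rightarrow> real^4) \<Rightarrow> real^2 \<Rightarrow> real^2" where
  "frame1 F u = (1 / sqrt (gram F u $ 1 $ 1)) *\<^sub>R axis 1 1"

definition frame2 :: "(real^2 \<Rightarrow> real^4) \<Rightarrow> real^2 \<Rightarrow> real^2" where
  "frame2 F u = (1 / sqrt (gram F u $ 1 $ 1)) *\<^sub>R ((1 / sqrt (det (gram F u))) *\<^sub>R
     (gram F u $ 1 $ 1 *\<^sub>R axis 2 1 - gram F u $ 1 $ 2 *\<^sub>R axis 1 1))"

definition orthonormal_pair :: "(real^2 \<Rightarrow> real^4) \<Rightarrow> real^2 \<Rightarrow> real^2 \<Rightarrow> real^2 \<Rightarrow> bool" where
  "orthonormal_pair F u e1 e2 \<longleftrightarrow> metric F u e1 e1 = 1 \<and> metric F u e2 e2 = 1 \<and> metric F u e1 e2 = 0 \<and>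
     e1 $ 1 * e2 $ 2 - e1 $ 2 * e2 $ 1 > 0"

lemma orthonormal_pair_frame:
  assumes lin: "linear (D F u)" and inj: "inj (D F u)"
  shows "orthonormal_pair F u (frame1 F u) (frame2 F u)"
proof -
  define a b c d where abc: "a = gram F u $ 1 $ 1" "b = gram F u $ 1 $ 2" "c = gram F u $ 2 $ 2"
     "d = det (gram F u)"
  define h k where hk: "h = 1 / sqrt a" "k = 1 / sqrt d"
  have pos: "a > 0" "d > 0" using gram_positive[OF assms] by (auto simp: abc)
  have h: "h > 0" "h * h * a = 1" and k: "k > 0" "k * k * d = 1"
    using pos by (auto simp: hk field_simps)
  have dd: "d = a * c - b * b" by (simp add: abc det_gram)
  have f: "frame1 F u $ 1 = h" "frame1 F u $ 2 = 0" "frame2 F u $ 1 = - (h * k * b)" "frame2 F u $ 2 = h * k * a"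
    by (simp_all add: frame1_def frame2_def abc hk axis_def)
  have "h * h * a = 1" using h by simp
  moreover have "h * k * b * (h * k * b) * a - 2 * (h * k * b * (h * k * a)) * b + h * k * a * (h * k * a) * c = 1"
    using h(2) k(2) unfolding dd by algebra
  moreover have "h * (h * k * a) > 0" using h k pos by simp
  ultimately show ?thesis
    unfolding orthonormal_pair_def metric_eq_gram[OF lin] f abc(1-3)[symmetric]
    by (simp add: algebra_simps)
qed

lemma orthonormal_pair_expansion:
  assumes lin: "linear (D F u)" and on: "orthonormal_pair F u e1 e2"
  shows "v = metric F u v e1 *\<^sub>R e1 + metric F u v e2 *\<^sub>R e2"
proof -
  define d where "d = e1 $ 1 * e2 $ 2 - e1 $ 2 * e2 $ 1"
  have d: "d \<noteq> 0" using on by (simp add: d_def orthonormal_pair_def)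
  define a b where "a = (v $ 1 * e2 $ 2 - v $ 2 * e2 $ 1) / d"
    and "b = (e1 $ 1 * v $ 2 - e1 $ 2 * v $ 1) / d"
  have v: "v = a *\<^sub>R e1 + b *\<^sub>R e2"
    using d by (simp add: a_def b_def vec_eq_iff forall_2 divide_simps) (simp add: d_def algebra_simps)
  have "metric F u v e1 = a" "metric F u v e2 = b"
    using on unfolding v metric_def orthonormal_pair_def
    by (simp_all add: linear_add[OF lin] linear_scale[OF lin] inner_add_left inner_commute[of "D F u e2" "D F u e1"])
  then show ?thesis using v by simp
qed

text \<open>Replaces the definite description by a formula. Smoothness of normal projections and
  their first-order behaviour in time are read off from it.\<close>

lemma normal_part_orthonormal_pair:
  assumes lin: "linear (D F u)" and on: "orthonormal_pair F u e1 e2"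
  shows "normal_part F u w =
    w - (w \<bullet> D F u e1) *\<^sub>R D F u e1 - (w \<bullet> D F u e2) *\<^sub>R D F u e2"
proof (rule normal_part_eqI[OF lin])
  let ?n = "w - (w \<bullet> D F u e1) *\<^sub>R D F u e1 - (w \<bullet> D F u e2) *\<^sub>R D F u e2"
  have e: "D F u e1 \<bullet> ?n = 0" "D F u e2 \<bullet> ?n = 0"
    using on by (simp_all add: inner_diff_right orthonormal_pair_def metric_def inner_commute)
  have "D F u v \<bullet> ?n = 0" for v
    by (subst orthonormal_pair_expansion[OF lin on, of v])
       (simp only: linear_add[OF lin] linear_scale[OF lin] inner_add_left inner_scaleR_left e)
  then show "?n \<in> orthogonal_comp (range (D F u))" by (simp add: in_orthogonal_comp_range)
  have "w - ?n = D F u ((w \<bullet> D F u e1) *\<^sub>R e1 + (w \<bullet> D F u e2) *\<^sub>R e2)"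
    by (simp add: linear_add[OF lin] linear_scale[OF lin])
  then show "w - ?n \<in> range (D F u)" by blast
qed

text \<open>If \<open>E\<close> has the columns \<open>e1\<close>, \<open>e2\<close> and
  \<open>g\<close> is the Gram matrix, orthonormality says \<open>E^T g E = 1\<close>, whence the
  inverse of \<open>g\<close> is \<open>E E^T\<close>. This turns the coordinate trace in the mean
  curvature into a sum over the frame.\<close>

lemma gram_inverse_orthonormal_pair:
  assumes lin: "linear (D F u)" and on: "orthonormal_pair F u e1 e2"
  shows "matrix_inv (gram F u) $ i $ j = e1 $ i * e1 $ j + e2 $ i * e2 $ j"
proof -
  define E :: "real^2^2" where "E = (\<chi> i j. if j = 1 then e1 $ i else e2 $ i)"
  have sym: "gram F u $ 2 $ 1 = gram F u $ 1 $ 2" by (simp add: gram_def metric_def inner_commute)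
  have "transpose E ** (gram F u ** E) = mat 1"
    using on unfolding orthonormal_pair_def metric_eq_gram[OF lin]
    by (simp add: vec_eq_iff forall_2 matrix_matrix_mult_def transpose_def mat_def sum_2 E_def sym algebra_simps)
  then have "(gram F u ** E) ** transpose E = mat 1"
    by (simp add: matrix_left_right_inverse)
  then have 1: "gram F u ** (E ** transpose E) = mat 1" by (simp add: matrix_mul_assoc)
  then have 2: "(E ** transpose E) ** gram F u = mat 1" by (simp add: matrix_left_right_inverse)
  \<comment> \<open>\<open>matrix_inv\<close> is a choice among two-sided inverses, so one has to be
    exhibited before it can be used.\<close>
  have "gram F u ** matrix_inv (gram F u) = mat 1"
    unfolding matrix_inv_def
    by (rule someI2[of "\<lambda>A'. gram F u ** A' = mat 1 \<and> A' ** gram F u = mat 1" "E ** transpose E"])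
       (use 1 2 in auto)
  then have "matrix_inv (gram F u) = E ** transpose E"
    using 2 by (metis matrix_mul_assoc matrix_mul_lid matrix_mul_rid)
  then show ?thesis by (simp add: matrix_matrix_mult_def transpose_def sum_2 E_def)
qed

text \<open>Differentiate the inner products in the Gram matrix; by symmetry of second derivatives
  all terms of the Koszul combination cancel except one, which occurs twice.\<close>

lemma christoffel_eq:
  assumes V: "open V" "smooth_on V F" "u \<in> V"
  shows "christoffel F u i j k = D (\<lambda>q. D F q (axis j 1)) u (axis i 1) \<bullet> D F u (axis k 1)"
proof -
  have "D (\<lambda>q. gram F q $ j $ k) u w = D F u (axis j 1) \<bullet> D (\<lambda>q. D F q (axis k 1)) u w +
      D (\<lambda>q. D F q (axis j 1)) u w \<bullet> D F u (axis k 1)" for j k w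
  proof (rule D_eqI)
    show "((\<lambda>q. gram F q $ j $ k) has_derivative (\<lambda>w. D F u (axis j 1) \<bullet> D (\<lambda>q. D F q (axis k 1)) u w +
      D (\<lambda>q. D F q (axis j 1)) u w \<bullet> D F u (axis k 1))) (at u)"
      unfolding gram_def metric_def vec_lambda_beta
      by (intro has_derivative_inner smooth_on_has_derivative[OF smooth_on_D[OF V(2)] V(1,3)])
  qed
  then show ?thesis
    unfolding christoffel_def
    using second_derivative_symmetric[OF V] by (simp add: inner_commute)
qed

text \<open>The Levi-Civita derivative is the tangential part of the ambient one. The intrinsic side
  of the second equation depends on the metric alone, the ambient side is an entry of the moving
  frame matrix; the first formula also gives the entries that pair a tangent vector with a normal
  one.\<close>

lemma tangent_connection_form_eq:
  assumes V: "open V" "smooth_on V F" "u \<in> V" and e1: "(e1 has_derivative D e1 u) (at u)"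
  shows "((\<lambda>q. D F q (e1 q)) has_derivative
      (\<lambda>v. D F u (D e1 u v) + (\<Sum>j\<in>UNIV. e1 u $ j *\<^sub>R D (\<lambda>q. D F q (axis j 1)) u v))) (at u)"
    and "tangent_connection_form F e1 e2 u v = D (\<lambda>q. D F q (e1 q)) u v \<bullet> D F u (e2 u)"
proof -
  note lin = smooth_on_linear[OF V(2,1)]
  have comp: "((\<lambda>q. e1 q $ k) has_derivative (\<lambda>w. D e1 u w $ k)) (at u)" for k
    using bounded_linear.has_derivative[OF bounded_linear_vec_nth e1] .
  have "((\<lambda>q. \<Sum>j\<in>UNIV. e1 q $ j *\<^sub>R D F q (axis j 1)) has_derivative
      (\<lambda>v. \<Sum>j\<in>UNIV. e1 u $ j *\<^sub>R D (\<lambda>q. D F q (axis j 1)) u v + D e1 u v $ j *\<^sub>R D F u (axis j 1))) (at u)"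
    by (intro has_derivative_sum has_derivative_scaleR comp smooth_on_has_derivative[OF smooth_on_D[OF V(2)] V(1,3)])
  moreover have "(\<Sum>j\<in>UNIV. e1 u $ j *\<^sub>R D (\<lambda>q. D F q (axis j 1)) u v + D e1 u v $ j *\<^sub>R D F u (axis j 1))
     = D F u (D e1 u v) + (\<Sum>j\<in>UNIV. e1 u $ j *\<^sub>R D (\<lambda>q. D F q (axis j 1)) u v)" for v
    by (subst D_axis_expansion[OF lin[OF V(3)], of "D e1 u v"]) (simp add: sum_2)
  ultimately have "((\<lambda>q. \<Sum>j\<in>UNIV. e1 q $ j *\<^sub>R D F q (axis j 1)) has_derivative
      (\<lambda>v. D F u (D e1 u v) + (\<Sum>j\<in>UNIV. e1 u $ j *\<^sub>R D (\<lambda>q. D F q (axis j 1)) u v))) (at u)"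
    by simp
  then show der: "((\<lambda>q. D F q (e1 q)) has_derivative
      (\<lambda>v. D F u (D e1 u v) + (\<Sum>j\<in>UNIV. e1 u $ j *\<^sub>R D (\<lambda>q. D F q (axis j 1)) u v))) (at u)"
  proof (rule has_derivative_transform_within_open[OF _ V(1,3)])
    fix q assume "q \<in> V"
    then show "(\<Sum>j\<in>UNIV. e1 q $ j *\<^sub>R D F q (axis j 1)) = D F q (e1 q)"
      by (subst D_axis_expansion[OF lin, of q "e1 q"]) (simp_all add: sum_2)
  qed
  have lin2: "linear (D (\<lambda>q. D F q (axis j 1)) u)" for j
    by (rule smooth_on_linear[OF smooth_on_D[OF V(2)] V(1,3)])
  have X: "D (\<lambda>q. D F q (axis j 1)) u v = v $ 1 *\<^sub>R D (\<lambda>q. D F q (axis j 1)) u (axis 1 1)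
      + v $ 2 *\<^sub>R D (\<lambda>q. D F q (axis j 1)) u (axis 2 1)" for j
    by (rule D_axis_expansion[OF lin2])
  have Y: "D F u (e2 u) = e2 u $ 1 *\<^sub>R D F u (axis 1 1) + e2 u $ 2 *\<^sub>R D F u (axis 2 1)"
    by (rule D_axis_expansion[OF lin[OF V(3)]])
  show "tangent_connection_form F e1 e2 u v = D (\<lambda>q. D F q (e1 q)) u v \<bullet> D F u (e2 u)"
    unfolding D_eqI[OF der] tangent_connection_form_def christoffel_eq[OF V]
    by (simp add: X Y metric_def sum_2 inner_add_left inner_add_right algebra_simps)
qed

lemma second_fundamental_form_inner:
  assumes "linear (D F u)" "n \<in> orthogonal_comp (range (D F u))"
  shows "second_fundamental_form F u v w \<bullet> n = D (\<lambda>q. D F q w) u v \<bullet> n"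
  unfolding second_fundamental_form_def by (rule normal_part_inner[OF assms])

definition bilin2 :: "(2 \<Rightarrow> 2 \<Rightarrow> real) \<Rightarrow> real^2 \<Rightarrow> real^2 \<Rightarrow> real" where
  "bilin2 a v w = (\<Sum>i\<in>UNIV. \<Sum>j\<in>UNIV. v $ i * w $ j * a i j)"

lemma mean_curvature_inner:
  assumes "linear (D F u)" "orthonormal_pair F u e1 e2"
  shows "mean_curvature F u \<bullet> n =
    (bilin2 (\<lambda>i j. second_fundamental_form F u (axis i 1) (axis j 1) \<bullet> n) e1 e1 +
     bilin2 (\<lambda>i j. second_fundamental_form F u (axis i 1) (axis j 1) \<bullet> n) e2 e2) / 2"
  by (simp add: mean_curvature_def bilin2_def gram_inverse_orthonormal_pair[OF assms] sum_2
      inner_add_left algebra_simps)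

text \<open>Since \<open>rot\<close> takes \<open>e1\<close> to \<open>e2\<close>, the (1,0)-part of
  \<open>e1\<close> is \<open>(e1 - i e2) / 2\<close>. Squaring it produces the factor 1/4 and the
  minus sign of the imaginary part.\<close>

lemma hopf_differential_inner:
  assumes lin: "linear (D F u)" and on: "orthonormal_pair F u e1 e2"
    and a: "a = (\<lambda>i j. second_fundamental_form F u (axis i 1) (axis j 1) \<bullet> n)"
  shows "(\<chi> k. Re (hopf_differential F u e1 e1 $ k)) \<bullet> n = (bilin2 a e1 e1 - bilin2 a e2 e2) / 4"
    and "(\<chi> k. Im (hopf_differential F u e1 e1 $ k)) \<bullet> n = - (bilin2 a e1 e2 + bilin2 a e2 e1) / 4"
proof -
  have rot: "rot F u e1 = e2"
    using on rot_frame[OF lin] unfolding orthonormal_pair_def by blast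
  show "(\<chi> k. Re (hopf_differential F u e1 e1 $ k)) \<bullet> n = (bilin2 a e1 e1 - bilin2 a e2 e2) / 4"
    "(\<chi> k. Im (hopf_differential F u e1 e1 $ k)) \<bullet> n = - (bilin2 a e1 e2 + bilin2 a e2 e1) / 4"
    by (simp_all add: hopf_differential_def second_fundamental_form_C_def part_1_0_def rot cvec_def
        bilin2_def a sum_2 inner_vec_def sum_4 algebra_simps)
qed

section \<open>Moving frames\<close>

text \<open>The vectors are the rows of a square matrix \<open>Q\<close>, so
  \<open>Q Q^T = 1\<close> implies \<open>Q^T Q = 1\<close>, which is the expansion.\<close>

lemma orthonormal_expansion:
  fixes g :: "'n::finite \<Rightarrow> real^'n"
  assumes "\<And>a b. g a \<bullet> g b = (if a = b then 1 else 0)"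
  shows "x = (\<Sum>a\<in>UNIV. (x \<bullet> g a) *\<^sub>R g a)"
proof -
  define Q where "Q = (\<chi> a. g a)"
  have "Q ** transpose Q = mat 1"
    using assms by (simp add: vec_eq_iff matrix_matrix_mult_def transpose_def mat_def Q_def inner_vec_def)
  then have "transpose Q ** Q = mat 1"
    by (simp add: matrix_left_right_inverse)
  then have "x = transpose Q *v (Q *v x)"
    by (simp add: matrix_vector_mul_assoc)
  also have "\<dots> = (\<Sum>a\<in>UNIV. (x \<bullet> g a) *\<^sub>R g a)"
    by (simp add: vec_eq_iff matrix_vector_mult_def transpose_def Q_def inner_vec_def mult.commute)
  finally show ?thesis .
qed

lemma orthonormal_eqI:
  fixes g :: "'n::finite \<Rightarrow> real^'n"
  assumes "\<And>a b. g a \<bullet> g b = (if a = b then 1 else 0)" "\<And>a. x \<bullet> g a = y \<bullet> g a"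
  shows "x = y"
  by (subst orthonormal_expansion[OF assms(1), of x], subst orthonormal_expansion[OF assms(1), of y])
     (simp add: assms(2))

lemma has_vector_derivative_inner:
  assumes "(f has_vector_derivative f') (at t)" "(g has_vector_derivative g') (at t)"
  shows "((\<lambda>t. f t \<bullet> g t) has_vector_derivative f t \<bullet> g' + f' \<bullet> g t) (at t)"
  using bounded_bilinear.has_vector_derivative[OF bounded_bilinear_inner assms] .

text \<open>The hypothesis \<open>conn\<close> asks for one of \<open>\<Omega>\<^sub>a\<^sub>b\<close>, \<open>\<Omega>\<^sub>b\<^sub>a\<close> only, by skew-symmetry.\<close>

lemma moving_frame_constant_motion:
  fixes G :: "'n::finite \<Rightarrow> 'a::euclidean_space \<times> real \<Rightarrow> real^'n"
  assumes O: "open O'" "convex O'" and r: "r > 0"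
    and G: "\<And>a. smooth_on (O' \<times> {-r<..<r}) (G a)"
    and ortho: "\<And>u t a b. u \<in> O' \<Longrightarrow> t \<in> {-r<..<r} \<Longrightarrow> G a (u, t) \<bullet> G b (u, t) = (if a = b then 1 else 0)"
    and conn: "\<And>u w a b. u \<in> O' \<Longrightarrow> a \<noteq> b \<Longrightarrow>
      delta_zero (\<lambda>t. D (\<lambda>q. G a (q, t)) u w \<bullet> G b (u, t)) \<or>
      delta_zero (\<lambda>t. D (\<lambda>q. G b (q, t)) u w \<bullet> G a (u, t))"
  shows "\<exists>B. transpose B = - B \<and>
    (\<forall>u\<in>O'. \<forall>a. ((\<lambda>t. G a (u, t)) has_vector_derivative B *v G a (u, 0)) (at 0))"
proof -
  define X where "X a u = G a (u, 0)" for a u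
  define Y where "Y a u = D (G a) (u, 0) (0, 1)" for a u
  define \<Omega> where "\<Omega> u w a b = D (X a) u w \<bullet> X b u" for u w a b
  have op: "open (O' \<times> {-r<..<r})" using O by (intro open_Times) auto
  have mem: "(u, 0) \<in> O' \<times> {-r<..<r}" if "u \<in> O'" for u using that r by auto
  have dt: "((\<lambda>t. G a (u, t)) has_vector_derivative Y a u) (at 0)" if "u \<in> O'" for a u
    unfolding Y_def by (rule derivative_in_time[OF G op mem[OF that]])
  have dX: "(X a has_derivative D (X a) u) (at u)" if "u \<in> O'" for a u
  proof -
    have "X a differentiable (at u)"
      unfolding X_def using derivative_in_space[OF G op mem[OF that]] differentiableI by blast
    then show ?thesis by (simp add: frechet_derivative_works)
  qed
  have dY: "(Y a has_derivative D (Y a) u) (at u)" if "u \<in> O'" for a u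
  proof -
    have "Y a differentiable (at u)"
      unfolding Y_def using derivative_in_space[OF smooth_on_D[OF G] op mem[OF that]] differentiableI by blast
    then show ?thesis by (simp add: frechet_derivative_works)
  qed
  have oX: "X a u \<bullet> X b u = (if a = b then 1 else 0)" if "u \<in> O'" for a b u
    using ortho[OF that, of 0] r by (simp add: X_def)
  \<comment> \<open>The constant Gram matrix of the frame, differentiated in time; below,
    \<open>skewG\<close> does the same in space.\<close>
  have skewY: "Y a u \<bullet> X b u = - (Y b u \<bullet> X a u)" if "u \<in> O'" for a b u
  proof -
    have "((\<lambda>t. G a (u, t) \<bullet> G b (u, t)) has_vector_derivative X a u \<bullet> Y b u + Y a u \<bullet> X b u) (at 0)"
      using has_vector_derivative_inner[OF dt[OF that] dt[OF that]] by (simp add: X_def)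
    moreover have "((\<lambda>t. G a (u, t) \<bullet> G b (u, t)) has_vector_derivative 0) (at 0)"
      by (rule has_vector_derivative_transform_within_open[where S = "{-r<..<r}"
            and f = "\<lambda>t. if a = b then 1 else 0"])
         (use r ortho[OF that] in auto)
    ultimately have "X a u \<bullet> Y b u + Y a u \<bullet> X b u = 0"
      by (rule vector_derivative_unique_at)
    then show ?thesis by (simp add: inner_commute)
  qed
  have skewG: "D (\<lambda>q. G a (q, t)) u w \<bullet> G b (u, t) = - (D (\<lambda>q. G b (q, t)) u w \<bullet> G a (u, t))"
    if u: "u \<in> O'" and t: "t \<in> {-r<..<r}" for u w a b t
  proof -
    have dG: "((\<lambda>q. G a (q, t)) has_derivative D (\<lambda>q. G a (q, t)) u) (at u)" for a
      using derivative_in_space[OF G op, of u t] u t differentiableI frechet_derivative_works by blast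
    have "((\<lambda>q. G a (q, t) \<bullet> G b (q, t)) has_derivative
        (\<lambda>w. G a (u, t) \<bullet> D (\<lambda>q. G b (q, t)) u w + D (\<lambda>q. G a (q, t)) u w \<bullet> G b (u, t))) (at u)"
      using has_derivative_inner[OF dG dG] .
    moreover have "((\<lambda>q. G a (q, t) \<bullet> G b (q, t)) has_derivative (\<lambda>w. 0)) (at u)"
      by (rule has_derivative_transform_within_open[OF has_derivative_const[of "if a = b then 1 else 0"] O(1) u])
         (use ortho[OF _ t] in auto)
    ultimately have "G a (u, t) \<bullet> D (\<lambda>q. G b (q, t)) u w + D (\<lambda>q. G a (q, t)) u w \<bullet> G b (u, t) = 0"
      by (rule has_derivative_unique[THEN fun_cong])
    then show ?thesis by (simp add: inner_commute)
  qed
  have connG: "delta_zero (\<lambda>t. D (\<lambda>q. G a (q, t)) u w \<bullet> G b (u, t))" if u: "u \<in> O'" for u w a b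
  proof -
    have flip: "delta_zero (\<lambda>t. D (\<lambda>q. G a (q, t)) u w \<bullet> G b (u, t))"
      if "delta_zero (\<lambda>t. - (D (\<lambda>q. G b (q, t)) u w \<bullet> G a (u, t)))" for a b
      by (rule has_vector_derivative_transform_within_open[OF that, where S = "{-r<..<r}"])
         (use r in \<open>auto intro: skewG[OF u, of _ a w b, symmetric]\<close>)
    show ?thesis
    proof (cases "a = b")
      case True
      have "D (\<lambda>q. G a (q, t)) u w \<bullet> G a (u, t) = 0" if "t \<in> {-r<..<r}" for t
        using skewG[OF u that, of a w a] by linarith
      then show ?thesis
        using r True has_vector_derivative_transform_within_open[where S = "{-r<..<r}",
            OF has_vector_derivative_const[of "0 :: real"]] by auto
    next
      case False
      show ?thesis
        using conn[OF u False, of w]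
      proof
        assume "delta_zero (\<lambda>t. D (\<lambda>q. G b (q, t)) u w \<bullet> G a (u, t))"
        from has_vector_derivative_minus[OF this] show ?thesis by (intro flip) simp
      qed
    qed
  qed
  have skew\<Omega>: "\<Omega> u w a b = - \<Omega> u w b a" if "u \<in> O'" for u w a b
    using skewG[OF that, of 0 a w b] r unfolding \<Omega>_def X_def[abs_def] by simp
  have DX: "D (X a) u w = (\<Sum>b\<in>UNIV. \<Omega> u w a b *\<^sub>R X b u)" if "u \<in> O'" for u w a
    unfolding \<Omega>_def by (rule orthonormal_expansion) (rule oX[OF that])
  \<comment> \<open>Differentiate the expansion of \<open>D G_a\<close> in the frame with respect to
    time. As the coefficients are stationary, the velocities \<open>Y\<close> satisfy the same
    linear system as the frame \<open>X\<close>.\<close>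
  have DY: "D (Y a) u w = (\<Sum>b\<in>UNIV. \<Omega> u w a b *\<^sub>R Y b u)" if "u \<in> O'" for u w a
  proof -
    have "((\<lambda>t. D (\<lambda>q. G a (q, t)) u w) has_vector_derivative D (Y a) u w) (at 0)"
      unfolding Y_def by (rule space_derivative_in_time[OF G op mem[OF that]])
    moreover have "((\<lambda>t. \<Sum>b\<in>UNIV. (D (\<lambda>q. G a (q, t)) u w \<bullet> G b (u, t)) *\<^sub>R G b (u, t))
        has_vector_derivative (\<Sum>b\<in>UNIV. \<Omega> u w a b *\<^sub>R Y b u)) (at 0)"
    proof (rule has_vector_derivative_sum)
      fix b
      show "((\<lambda>t. (D (\<lambda>q. G a (q, t)) u w \<bullet> G b (u, t)) *\<^sub>R G b (u, t))
        has_vector_derivative \<Omega> u w a b *\<^sub>R Y b u) (at 0)"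
        using bounded_bilinear.has_vector_derivative[OF bounded_bilinear_scaleR connG[OF that, of a w b] dt[OF that, of b]]
        by (simp add: \<Omega>_def X_def[abs_def])
    qed
    then have "((\<lambda>t. D (\<lambda>q. G a (q, t)) u w)
        has_vector_derivative (\<Sum>b\<in>UNIV. \<Omega> u w a b *\<^sub>R Y b u)) (at 0)"
      by (rule has_vector_derivative_transform_within_open[where S = "{-r<..<r}"])
         (use r in \<open>auto intro!: orthonormal_expansion[symmetric] ortho[OF that]\<close>)
    ultimately show ?thesis by (rule vector_derivative_unique_at)
  qed
  \<comment> \<open>The sum of the matrices \<open>Y_a X_a^T\<close>, the only matrix that takes
    each \<open>X_a\<close> to \<open>Y_a\<close>.\<close>
  define B where "B u = (\<chi> i j. \<Sum>a\<in>UNIV. Y a u $ i * X a u $ j)" for u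
  have BX: "B u *v X b u = Y b u" if "u \<in> O'" for u b
  proof -
    have "(B u *v X b u) $ i = Y b u $ i" for i
    proof -
      have "(B u *v X b u) $ i = (\<Sum>j\<in>UNIV. \<Sum>a\<in>UNIV. Y a u $ i * (X a u $ j * X b u $ j))"
        by (simp add: B_def matrix_vector_mult_def sum_distrib_right mult.assoc)
      also have "\<dots> = (\<Sum>a\<in>UNIV. Y a u $ i * (X a u \<bullet> X b u))"
        by (subst sum.swap) (simp add: inner_vec_def sum_distrib_left)
      finally show ?thesis by (simp add: oX[OF that] if_distrib cong: if_cong)
    qed
    then show ?thesis by (simp add: vec_eq_iff)
  qed
  have B0: "((\<lambda>q. B q $ i $ j) has_derivative (\<lambda>w. 0)) (at u)" if "u \<in> O'" for u i j
  proof -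
    have comp: "((\<lambda>q. Z q $ k) has_derivative (\<lambda>w. Z' w $ k)) (at u)"
      if "(Z has_derivative Z') (at u)" for Z :: "'a \<Rightarrow> real^'n" and Z' k
      using bounded_linear.has_derivative[OF bounded_linear_vec_nth that] .
    have "((\<lambda>q. B q $ i $ j) has_derivative
        (\<lambda>w. \<Sum>a\<in>UNIV. Y a u $ i * D (X a) u w $ j + D (Y a) u w $ i * X a u $ j)) (at u)"
      unfolding B_def vec_lambda_beta
      by (intro has_derivative_sum has_derivative_mult comp dX[OF that] dY[OF that])
    moreover have "(\<Sum>a\<in>UNIV. Y a u $ i * D (X a) u w $ j + D (Y a) u w $ i * X a u $ j) = 0" for w
    proof -
      \<comment> \<open>Both factors of \<open>Y_a X_a^T\<close> obey the system with matrix
        \<open>\<Omega>\<close>. After the summation indices are exchanged, skew-symmetry of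
        \<open>\<Omega>\<close> makes the two halves of the product rule cancel.\<close>
      have "(\<Sum>a\<in>UNIV. D (Y a) u w $ i * X a u $ j)
          = (\<Sum>a\<in>UNIV. \<Sum>b\<in>UNIV. \<Omega> u w a b * (Y b u $ i * X a u $ j))"
        by (simp add: DY[OF that] sum_distrib_right mult.assoc)
      also have "\<dots> = (\<Sum>b\<in>UNIV. \<Sum>a\<in>UNIV. - (\<Omega> u w b a * (Y b u $ i * X a u $ j)))"
        by (subst sum.swap) (subst skew\<Omega>[OF that], simp)
      also have "\<dots> = - (\<Sum>b\<in>UNIV. Y b u $ i * D (X b) u w $ j)"
        by (simp add: DX[OF that] sum_distrib_left sum_negf mult.left_commute)
      finally show ?thesis by (simp add: sum.distrib)
    qed
    ultimately show ?thesis by simp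
  qed
  have Bconst: "\<exists>c. \<forall>u\<in>O'. B u $ i $ j = c" for i j
    by (rule has_derivative_zero_constant[OF O(2)]) (use B0 has_derivative_at_withinI in blast)
  show ?thesis
  proof (cases "O' = {}")
    case True
    then show ?thesis by (intro exI[of _ 0]) (simp add: vec_eq_iff transpose_def)
  next
    case False
    then obtain u0 where u0: "u0 \<in> O'" by auto
    have eq: "B u = B u0" if "u \<in> O'" for u
      using Bconst that u0 by (simp add: vec_eq_iff) metis
    have "transpose (B u0) $ i $ j = (- B u0) $ i $ j" for i j
    proof -
      \<comment> \<open>In the orthonormal basis \<open>X\<close>, the matrix \<open>B\<close> has
        the coefficients \<open>Y_a \<bullet> X_b\<close>, which are skew by
        \<open>skewY\<close>.\<close>
      have "B u0 $ k $ l = (\<Sum>a\<in>UNIV. \<Sum>b\<in>UNIV. (Y a u0 \<bullet> X b u0) * (X b u0 $ k * X a u0 $ l))" for k l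
      proof -
        have "Y a u0 $ k = (\<Sum>b\<in>UNIV. (Y a u0 \<bullet> X b u0) * X b u0 $ k)" for a
          using arg_cong[where f = "\<lambda>v. v $ k", OF orthonormal_expansion[OF oX[OF u0], of "Y a u0"]] by simp
        then have "B u0 $ k $ l = (\<Sum>a\<in>UNIV. (\<Sum>b\<in>UNIV. (Y a u0 \<bullet> X b u0) * X b u0 $ k) * X a u0 $ l)"
          unfolding B_def by simp
        then show ?thesis by (simp add: sum_distrib_right mult.assoc)
      qed
      note expand = this
      have "B u0 $ j $ i = (\<Sum>b\<in>UNIV. \<Sum>a\<in>UNIV. (Y a u0 \<bullet> X b u0) * (X b u0 $ j * X a u0 $ i))"
        unfolding expand by (rule sum.swap)
      also have "\<dots> = (\<Sum>b\<in>UNIV. \<Sum>a\<in>UNIV. - ((Y b u0 \<bullet> X a u0) * (X a u0 $ i * X b u0 $ j)))"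
        by (subst skewY[OF u0]) (simp add: mult.commute)
      also have "\<dots> = - B u0 $ i $ j"
        unfolding expand by (simp add: sum_negf)
      finally show ?thesis by (simp add: transpose_def)
    qed
    then have "transpose (B u0) = - B u0" by (simp add: vec_eq_iff)
    moreover have "((\<lambda>t. G a (u, t)) has_vector_derivative B u0 *v G a (u, 0)) (at 0)" if "u \<in> O'" for u a
      using dt[OF that, of a] BX[OF that, of a] eq[OF that] by (simp add: X_def)
    ultimately show ?thesis by blast
  qed
qed

section \<open>Bendings of a parametrized surface\<close>

text \<open>The induced metric \<open>g + t\<^sup>2 h\<close> of a bent surface is even in \<open>t\<close>; this is how the stationarity of
  intrinsic quantities is obtained, without computing their derivatives.\<close>

lemma even_delta_zero:
  fixes G :: "'a::euclidean_space \<times> real \<Rightarrow> 'b::real_inner"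
  assumes G: "smooth_on S G" "open S" "(u, 0) \<in> S" and even: "\<And>t. G (u, - t) = G (u, t)"
  shows "delta_zero (\<lambda>t. G (u, t))"
proof -
  let ?d = "D G (u, 0) (0, 1)"
  have d: "((\<lambda>t. G (u, t)) has_vector_derivative ?d) (at 0)"
    by (rule derivative_in_time[OF G])
  have m: "(uminus has_real_derivative -1) (at (0::real))" by (auto intro!: derivative_eq_intros)
  have "((\<lambda>t. G (u, - t)) has_vector_derivative - ?d) (at 0)"
    using vector_diff_chain_at[of uminus "-1" 0 "\<lambda>t. G (u, t)" ?d] d m
    by (simp add: o_def has_real_derivative_iff_has_vector_derivative)
  then have "?d = - ?d" using d even vector_derivative_unique_at by auto
  then have "?d = 0" by (simp add: eq_neg_iff_add_eq_0 flip: scaleR_2)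
  then show ?thesis using d by simp
qed

lemma bilin2_add:
  "bilin2 a (v + v') w = bilin2 a v w + bilin2 a v' w"
  "bilin2 a v (w + w') = bilin2 a v w + bilin2 a v w'"
  by (simp_all add: bilin2_def sum_2 algebra_simps)

lemma bilin2_scale:
  "bilin2 a (c *\<^sub>R v) w = c * bilin2 a v w" "bilin2 a v (c *\<^sub>R w) = c * bilin2 a v w"
  by (simp_all add: bilin2_def sum_2 algebra_simps)

locale bent_patch =
  fixes V :: "(real^2) set" and F \<tau> :: "real^2 \<Rightarrow> real^4"
  assumes open_V: "open V" and smooth_F: "smooth_on V F" and smooth_\<tau>: "smooth_on V \<tau>"
    and inj_F: "u \<in> V \<Longrightarrow> inj (D F u)"
    and bending: "u \<in> V \<Longrightarrow> D \<tau> u v \<bullet> D F u w + D F u v \<bullet> D \<tau> u w = 0"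
begin

definition bent :: "real \<Rightarrow> real^2 \<Rightarrow> real^4" where
  "bent t u = F u + t *\<^sub>R \<tau> u"

lemma smooth_bent: "smooth_on V (bent t)"
  unfolding bent_def by (intro smooth open_V smooth_F smooth_\<tau>)

lemmas linear_bent = smooth_on_linear[OF smooth_bent open_V]

lemma D_bent:
  assumes "u \<in> V"
  shows "D (bent t) u v = D F u v + t *\<^sub>R D \<tau> u v"
proof (rule D_eqI)
  show "(bent t has_derivative (\<lambda>v. D F u v + t *\<^sub>R D \<tau> u v)) (at u)"
    unfolding bent_def
    by (intro has_derivative_add has_derivative_scaleR_right smooth_on_has_derivative[OF smooth_F open_V assms]
        smooth_on_has_derivative[OF smooth_\<tau> open_V assms])
qed

lemma D2_bent:
  assumes "u \<in> V"
  shows "D (\<lambda>q. D (bent t) q w) u v = D (\<lambda>q. D F q w) u v + t *\<^sub>R D (\<lambda>q. D \<tau> q w) u v"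
proof (rule D_eqI)
  have "((\<lambda>q. D F q w + t *\<^sub>R D \<tau> q w) has_derivative
      (\<lambda>v. D (\<lambda>q. D F q w) u v + t *\<^sub>R D (\<lambda>q. D \<tau> q w) u v)) (at u)"
    by (intro has_derivative_add has_derivative_scaleR_right
        smooth_on_has_derivative[OF smooth_on_D[OF smooth_F] open_V assms]
        smooth_on_has_derivative[OF smooth_on_D[OF smooth_\<tau>] open_V assms])
  then show "((\<lambda>q. D (bent t) q w) has_derivative
      (\<lambda>v. D (\<lambda>q. D F q w) u v + t *\<^sub>R D (\<lambda>q. D \<tau> q w) u v)) (at u)"
    by (rule has_derivative_transform_within_open[OF _ open_V assms]) (simp add: D_bent)
qed

text \<open>The term linear in \<open>t\<close> is the left side of the bending equation.\<close>

lemma metric_bent: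
  assumes "u \<in> V"
  shows "metric (bent t) u v w = metric F u v w + t\<^sup>2 * metric \<tau> u v w"
proof -
  have "D F u v \<bullet> D \<tau> u w = - (D \<tau> u v \<bullet> D F u w)"
    using bending[OF assms, of v w] by linarith
  then show ?thesis
    by (simp add: metric_def D_bent[OF assms] inner_add_left inner_add_right power2_eq_square algebra_simps)
qed

lemma metric_bent_even: "u \<in> V \<Longrightarrow> metric (bent (- t)) u v w = metric (bent t) u v w"
  by (simp add: metric_bent)

lemma gram_bent_even: "u \<in> V \<Longrightarrow> gram (bent (- t)) u = gram (bent t) u"
  by (simp add: gram_def metric_bent_even)

text \<open>The added term \<open>t^2 h\<close> is nonnegative, so the metric cannot degenerate.
  Hence the bent surface is immersed at every time, not only for small \<open>t\<close>, and the
  constructions below live on all of \<open>V \<times> UNIV\<close>.\<close>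

lemma inj_bent:
  assumes "u \<in> V"
  shows "inj (D (bent t) u)"
proof -
  have "v = 0" if "D (bent t) u v = 0" for v
  proof -
    have "metric F u v v + t\<^sup>2 * metric \<tau> u v v = 0"
      using metric_bent[OF assms, of t v v] that by (simp add: metric_def)
    moreover have "metric F u v v \<ge> 0" "t\<^sup>2 * metric \<tau> u v v \<ge> 0" by (simp_all add: metric_def)
    ultimately have "metric F u v v = 0" by linarith
    then have "D F u v = 0" by (simp add: metric_def)
    then show ?thesis using inj_F[OF assms] smooth_on_linear[OF smooth_F open_V assms]
      by (metis injD linear_0)
  qed
  then show ?thesis using linear_injective_0[OF linear_bent[OF assms]] by auto
qed

section \<open>The Gram-Schmidt frame as a smooth function of point and time\<close>

abbreviation cyl :: "((real^2) \<times> real) set" where "cyl \<equiv> V \<times> UNIV"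

lemma open_cyl: "open cyl" using open_V by (intro open_Times) auto

lemma smooth_on_cyl_fst: "smooth_on V G \<Longrightarrow> smooth_on cyl (\<lambda>z. G (fst z))"
  by (rule smooth_on_fst[OF _ open_V open_UNIV])

lemma smooth_D_bent: "smooth_on cyl (\<lambda>z. D (bent (snd z)) (fst z) v)"
proof (rule smooth_on_cong[OF open_cyl])
  show "smooth_on cyl (\<lambda>z. D F (fst z) v + snd z *\<^sub>R D \<tau> (fst z) v)"
    by (intro smooth open_cyl smooth_on_cyl_fst smooth_F smooth_\<tau>)
qed (auto simp: D_bent)

lemma smooth_on_component: "open S \<Longrightarrow> smooth_on S e \<Longrightarrow> smooth_on S (\<lambda>z. e z $ k)"
  by (rule smooth_on_linear_image[OF bounded_linear_vec_nth])

lemma smooth_D_bent_field: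
  assumes "smooth_on cyl (\<lambda>z. e (snd z) (fst z))"
  shows "smooth_on cyl (\<lambda>z. D (bent (snd z)) (fst z) (e (snd z) (fst z)))"
proof (rule smooth_on_cong[OF open_cyl])
  show "smooth_on cyl (\<lambda>z. e (snd z) (fst z) $ 1 *\<^sub>R D (bent (snd z)) (fst z) (axis 1 1) +
      e (snd z) (fst z) $ 2 *\<^sub>R D (bent (snd z)) (fst z) (axis 2 1))"
    by (intro smooth open_cyl smooth_D_bent smooth_on_component assms)
qed (auto simp: D_axis_expansion[OF linear_bent, symmetric])

lemma smooth_gram_bent: "smooth_on cyl (\<lambda>z. gram (bent (snd z)) (fst z) $ i $ j)"
  unfolding gram_def metric_def vec_lambda_beta by (intro smooth open_cyl smooth_D_bent)

lemma gram_bent_positive: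
  assumes "z \<in> cyl"
  shows "gram (bent (snd z)) (fst z) $ 1 $ 1 > 0" "det (gram (bent (snd z)) (fst z)) > 0"
  using assms gram_positive[OF linear_bent inj_bent] by auto

lemma smooth_frame1: "smooth_on cyl (\<lambda>z. frame1 (bent (snd z)) (fst z))"
  unfolding frame1_def by (intro smooth open_cyl smooth_gram_bent gram_bent_positive)

lemma smooth_frame2: "smooth_on cyl (\<lambda>z. frame2 (bent (snd z)) (fst z))"
proof -
  have "smooth_on cyl (\<lambda>z. det (gram (bent (snd z)) (fst z)))"
    unfolding det_gram by (intro smooth open_cyl smooth_gram_bent)
  then show ?thesis
    unfolding frame2_def by (intro smooth open_cyl smooth_gram_bent gram_bent_positive)
qed

lemma orthonormal_pair_bent:
  "u \<in> V \<Longrightarrow> orthonormal_pair (bent t) u (frame1 (bent t) u) (frame2 (bent t) u)"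
  by (rule orthonormal_pair_frame[OF linear_bent inj_bent])

abbreviation eps1 where "eps1 \<equiv> \<lambda>z. D (bent (snd z)) (fst z) (frame1 (bent (snd z)) (fst z))"
abbreviation eps2 where "eps2 \<equiv> \<lambda>z. D (bent (snd z)) (fst z) (frame2 (bent (snd z)) (fst z))"

lemma smooth_eps: "smooth_on cyl eps1" "smooth_on cyl eps2"
  using smooth_D_bent_field[of "\<lambda>t. frame1 (bent t)"] smooth_D_bent_field[of "\<lambda>t. frame2 (bent t)"]
    smooth_frame1 smooth_frame2 by auto

lemma even_delta_zero_cyl:
  fixes G :: "(real^2) \<times> real \<Rightarrow> 'b::real_inner"
  assumes "smooth_on cyl G" "u \<in> V" "\<And>t. G (u, - t) = G (u, t)"
  shows "delta_zero (\<lambda>t. G (u, t))"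
  using assms even_delta_zero[OF _ open_cyl] by auto

lemma frame_bent_even:
  "u \<in> V \<Longrightarrow> frame1 (bent (- t)) u = frame1 (bent t) u"
  "u \<in> V \<Longrightarrow> frame2 (bent (- t)) u = frame2 (bent t) u"
  by (simp_all add: frame1_def frame2_def gram_bent_even)

lemma frame_bent_has_derivative:
  assumes "u \<in> V"
  shows "(frame1 (bent t) has_derivative D (frame1 (bent t)) u) (at u)"
    "(frame2 (bent t) has_derivative D (frame2 (bent t)) u) (at u)"
proof -
  have "(u, t) \<in> cyl" using assms by auto
  then have "frame1 (bent t) differentiable (at u)" "frame2 (bent t) differentiable (at u)"
    using derivative_in_space[OF smooth_frame1 open_cyl, of u t]
      derivative_in_space[OF smooth_frame2 open_cyl, of u t]
    by (auto intro: differentiableI)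
  then show "(frame1 (bent t) has_derivative D (frame1 (bent t)) u) (at u)"
    "(frame2 (bent t) has_derivative D (frame2 (bent t)) u) (at u)"
    by (simp_all add: frechet_derivative_works)
qed

lemma frame_bent_delta_zero:
  assumes "u \<in> V"
  shows "delta_zero (\<lambda>t. frame1 (bent t) u)" "delta_zero (\<lambda>t. frame2 (bent t) u)"
  using even_delta_zero_cyl[OF smooth_frame1 assms] even_delta_zero_cyl[OF smooth_frame2 assms]
    frame_bent_even[OF assms] by simp_all

lemma tangent_connection_form_bent:
  assumes "u \<in> V"
  shows "tangent_connection_form (bent t) (frame1 (bent t)) (frame2 (bent t)) u v =
    D (\<lambda>q. eps1 (q, t)) u v \<bullet> eps2 (u, t)"
  using tangent_connection_form_eq(2)[OF open_V smooth_bent assms frame_bent_has_derivative(1)[OF assms]]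
  by simp

lemma tangent_connection_form_bent_even:
  assumes "u \<in> V"
  shows "tangent_connection_form (bent (- t)) (frame1 (bent (- t))) (frame2 (bent (- t))) u v =
    tangent_connection_form (bent t) (frame1 (bent t)) (frame2 (bent t)) u v"
proof -
  \<comment> \<open>The frames and Gram matrices at times \<open>t\<close> and \<open>-t\<close> are
    known to agree only on \<open>V\<close>; agreement near \<open>u\<close> suffices for their
    derivatives.\<close>
  have D_cong: "D X u w = D Y u w" if "(X has_derivative D X u) (at u)" "\<And>q. q \<in> V \<Longrightarrow> X q = Y q"
    for X Y :: "real^2 \<Rightarrow> 'b::real_normed_vector" and w
    using has_derivative_transform_within_open[OF that(1) open_V assms that(2)] D_eqI by metis
  have "D (\<lambda>q. gram (bent (- t)) q $ i $ j) u w = D (\<lambda>q. gram (bent t) q $ i $ j) u w" for i j w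
  proof (rule D_cong)
    show "((\<lambda>q. gram (bent (- t)) q $ i $ j) has_derivative D (\<lambda>q. gram (bent (- t)) q $ i $ j) u) (at u)"
      using derivative_in_space[OF smooth_gram_bent open_cyl, of u "- t" i j] assms
      by (auto intro!: frechet_derivative_works[THEN iffD1] intro: differentiableI)
  qed (simp add: gram_bent_even)
  moreover have "D (frame1 (bent (- t))) u w = D (frame1 (bent t)) u w" for w
    by (rule D_cong[OF frame_bent_has_derivative(1)[OF assms]]) (rule frame_bent_even)
  ultimately show ?thesis
    by (simp add: tangent_connection_form_def christoffel_def metric_bent_even frame_bent_even assms)
qed

text \<open>The two descriptions of the connection form are combined: evenness in \<open>t\<close>
  comes from the intrinsic one, smoothness in \<open>t\<close> from the ambient one.\<close>

lemma tangent_connection_form_bent_delta_zero: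
  assumes "u \<in> V"
  shows "delta_zero (\<lambda>t. tangent_connection_form (bent t) (frame1 (bent t)) (frame2 (bent t)) u v)"
proof -
  have eq: "tangent_connection_form (bent t) (frame1 (bent t)) (frame2 (bent t)) u v =
      D eps1 (u, t) (v, 0) \<bullet> eps2 (u, t)" for t
    using D_eqI[OF derivative_in_space[OF smooth_eps(1) open_cyl, of u t], of v] assms
    by (simp add: tangent_connection_form_bent)
  have "delta_zero (\<lambda>t. (\<lambda>z. D eps1 z (v, 0) \<bullet> eps2 z) (u, t))"
  proof (rule even_delta_zero_cyl[OF _ assms])
    show "smooth_on cyl (\<lambda>z. D eps1 z (v, 0) \<bullet> eps2 z)"
      by (intro smooth open_cyl smooth_eps)
  next
    fix t show "D eps1 (u, - t) (v, 0) \<bullet> eps2 (u, - t) = D eps1 (u, t) (v, 0) \<bullet> eps2 (u, t)"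
      using tangent_connection_form_bent_even[OF assms, of t v] unfolding eq .
  qed
  then show ?thesis unfolding eq .
qed

section \<open>The Gram-Schmidt frame and its dual coframe are stationary\<close>

definition theta1 where "theta1 t u v = metric (bent t) u v (frame1 (bent t) u)"
definition theta2 where "theta2 t u v = metric (bent t) u v (frame2 (bent t) u)"

lemma tangent_frame_bent: "tangent_frame bent V 1 (\<lambda>t. frame1 (bent t)) (\<lambda>t. frame2 (bent t))"
proof -
  have "V \<times> {-1<..<1} \<subseteq> cyl" "open (V \<times> {-1::real<..<1})" using open_V by (auto intro: open_Times)
  then have "smooth_on (V \<times> {-1<..<1}) (\<lambda>z. frame1 (bent (snd z)) (fst z))"
    "smooth_on (V \<times> {-1<..<1}) (\<lambda>z. frame2 (bent (snd z)) (fst z))"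
    using smooth_on_subset[OF smooth_frame1 open_cyl] smooth_on_subset[OF smooth_frame2 open_cyl] by auto
  then show ?thesis
    using orthonormal_pair_bent open_V
    by (simp add: tangent_frame_def orthonormal_pair_def case_prod_unfold)
qed

lemma dual_coframe_bent:
  "dual_coframe V 1 (\<lambda>t. frame1 (bent t)) (\<lambda>t. frame2 (bent t)) theta1 theta2"
proof -
  have "linear (\<lambda>v. metric (bent t) u v w)" if "u \<in> V" for t u w
    unfolding metric_def
    by (rule linearI)
       (simp_all add: linear_add[OF linear_bent[OF that]] linear_scale[OF linear_bent[OF that]] inner_add_left)
  then show ?thesis
    using orthonormal_pair_bent
    by (simp add: dual_coframe_def orthonormal_pair_def theta1_def[abs_def] theta2_def[abs_def])
       (simp add: metric_def inner_commute)
qed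

text \<open>Supplies the frame at which the hypothesis on the Hopf differential, universal over
  stationary frames, is evaluated.\<close>

lemma stationary_frame_bent:
  "stationary_frame bent V (\<lambda>t. frame1 (bent t)) (\<lambda>t. frame2 (bent t)) theta1 theta2"
proof -
  have "delta_zero (\<lambda>t. theta1 t u v)" "delta_zero (\<lambda>t. theta2 t u v)" if "u \<in> V" for u v
  proof -
    have "smooth_on cyl (\<lambda>z. D (bent (snd z)) (fst z) v \<bullet> eps1 z)"
      "smooth_on cyl (\<lambda>z. D (bent (snd z)) (fst z) v \<bullet> eps2 z)"
      by (intro smooth open_cyl smooth_D_bent smooth_eps)+
    from even_delta_zero_cyl[OF this(1) that] even_delta_zero_cyl[OF this(2) that]
    show "delta_zero (\<lambda>t. theta1 t u v)" "delta_zero (\<lambda>t. theta2 t u v)"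
      using metric_bent_even[OF that] frame_bent_even[OF that]
      by (simp_all add: theta1_def theta2_def metric_def)
  qed
  then show ?thesis
    by (simp add: stationary_frame_def frame_bent_delta_zero tangent_connection_form_bent_delta_zero)
qed

text \<open>The derivative of \<open>\<langle>\<alpha>(\<partial>\<^sub>i, \<partial>\<^sub>j), n(t)\<rangle>\<close> at \<open>t = 0\<close> when \<open>n(0) = n\<close> and \<open>n'(0) = n'\<close>.\<close>

definition second_form_variation :: "real^2 \<Rightarrow> real^4 \<Rightarrow> real^4 \<Rightarrow> 2 \<Rightarrow> 2 \<Rightarrow> real" where
  "second_form_variation u n n' i j =
    D (\<lambda>q. D F q (axis j 1)) u (axis i 1) \<bullet> n' + D (\<lambda>q. D \<tau> q (axis j 1)) u (axis i 1) \<bullet> n"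

lemma second_form_variation_symmetric:
  "u \<in> V \<Longrightarrow> second_form_variation u n n' i j = second_form_variation u n n' j i"
  using second_derivative_symmetric[OF open_V smooth_F, of u "axis i 1" "axis j 1"]
    second_derivative_symmetric[OF open_V smooth_\<tau>, of u "axis i 1" "axis j 1"]
  by (simp add: second_form_variation_def)

text \<open>Stationary tangent vectors contribute nothing, so only the coefficients are
  differentiated. Second derivatives stand in place of the second fundamental form: against a normal
  \<open>n(t)\<close> they have the same inner products, and they are affine in
  \<open>t\<close>.\<close>

lemma bilin2_second_form_delta:
  assumes u: "u \<in> V" and n: "(n has_vector_derivative n') (at 0)"
    and e: "delta_zero e" and e': "delta_zero e'"
  shows "((\<lambda>t. bilin2 (\<lambda>i j. D (\<lambda>q. D (bent t) q (axis j 1)) u (axis i 1) \<bullet> n t) (e t) (e' t))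
    has_vector_derivative bilin2 (second_form_variation u (n 0) n') (e 0) (e' 0)) (at 0)"
proof -
  have a: "((\<lambda>t. D (\<lambda>q. D (bent t) q (axis j 1)) u (axis i 1) \<bullet> n t)
      has_vector_derivative second_form_variation u (n 0) n' i j) (at 0)" for i j
  proof -
    have "((\<lambda>t. D (\<lambda>q. D (bent t) q (axis j 1)) u (axis i 1)) has_vector_derivative
        D (\<lambda>q. D \<tau> q (axis j 1)) u (axis i 1)) (at 0)"
      unfolding D2_bent[OF u] by (auto intro!: derivative_eq_intros)
    from has_vector_derivative_inner[OF this n] show ?thesis
      by (simp add: second_form_variation_def D2_bent[OF u])
  qed
  have c: "((\<lambda>t. e t $ i) has_vector_derivative 0) (at 0)" if "delta_zero e" for e :: "real \<Rightarrow> real^2" and i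
    using bounded_linear.has_vector_derivative[OF bounded_linear_vec_nth that, of i] by simp
  have m: "((\<lambda>t. f t * g t) has_vector_derivative f 0 * g' + f' * g 0) (at 0)"
    if "(f has_vector_derivative f') (at 0)" "(g has_vector_derivative g') (at 0)" for f g :: "real \<Rightarrow> real" and f' g'
    using bounded_bilinear.has_vector_derivative[OF bounded_bilinear_mult that] .
  show ?thesis
    unfolding bilin2_def
    by (intro has_vector_derivative_sum has_vector_derivative_eq_rhs[OF m[OF m[OF c[OF e] c[OF e']] a]]) simp
qed

end

section \<open>Variation of the second fundamental form\<close>

lemma skew_inner:
  fixes B :: "real^'n^'n"
  assumes "transpose B = - B"
  shows "(B *v x) \<bullet> y = - (x \<bullet> (B *v y))"
proof -
  have "(B *v x) \<bullet> y = y \<bullet> (B *v x)" by (rule inner_commute)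
  also have "\<dots> = (transpose B *v y) \<bullet> x"
    by (simp add: transpose_matrix_vector dot_lmul_matrix)
  also have "\<dots> = - (x \<bullet> (B *v y))"
    by (simp add: assms inner_commute matrix_vector_mult_def vec_eq_iff sum_negf inner_vec_def)
  finally show ?thesis .
qed

text \<open>A basis on which vectors and matrices can be compared separately in tangent and normal
  directions.\<close>

lemma adapted_orthonormal_basis:
  fixes F :: "real^2 \<Rightarrow> real^4"
  assumes lin: "linear (D F u)" and inj: "inj (D F u)"
    and n: "n3 \<in> orthogonal_comp (range (D F u))" "n4 \<in> orthogonal_comp (range (D F u))"
    and on: "norm n3 = 1" "norm n4 = 1" "n3 \<bullet> n4 = 0"
  obtains g :: "4 \<Rightarrow> real^4" where "\<And>a b. g a \<bullet> g b = (if a = b then 1 else 0)"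
    "\<And>a. g a \<in> range (D F u) \<union> {n3, n4}"
proof
  let ?g = "\<lambda>a::4. if a = 1 then D F u (frame1 F u) else if a = 2 then D F u (frame2 F u)
    else if a = 3 then n3 else n4"
  have o: "orthonormal_pair F u (frame1 F u) (frame2 F u)" by (rule orthonormal_pair_frame[OF lin inj])
  have z: "D F u v \<bullet> n3 = 0" "D F u v \<bullet> n4 = 0" for v using n by (auto simp: in_orthogonal_comp_range)
  have z': "n3 \<bullet> D F u v = 0" "n4 \<bullet> D F u v = 0" for v using z by (auto simp: inner_commute)
  have o': "n4 \<bullet> n3 = 0" "n3 \<bullet> n3 = 1" "n4 \<bullet> n4 = 1"
    using on by (auto simp: inner_commute norm_eq_1)
  show "?g a \<bullet> ?g b = (if a = b then 1 else 0)" for a b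
    using exhaust_4[of a] exhaust_4[of b] o
    by (elim disjE) (simp_all add: orthonormal_pair_def metric_def z z' o' on inner_commute)
  show "?g a \<in> range (D F u) \<union> {n3, n4}" for a by auto
qed

text \<open>Agreement to first order with the curve \<open>exp(tB) (g 0)\<close>. For skew-symmetric
  \<open>B\<close> the property survives every operation of Gram-Schmidt, which is how suitable
  normal frames are built for the converse.\<close>

definition rotates :: "real^'n^'n \<Rightarrow> (real \<Rightarrow> real^'n) \<Rightarrow> bool" where
  "rotates B g \<longleftrightarrow> (g has_vector_derivative B *v g 0) (at 0)"

lemma rotates_inner:
  assumes "transpose B = - B" "rotates B g" "rotates B h"
  shows "delta_zero (\<lambda>t. g t \<bullet> h t)"
  using has_vector_derivative_inner[OF assms(2,3)[unfolded rotates_def]] skew_inner[OF assms(1), of "g 0" "h 0"]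
  by simp

lemma rotates_scaleR:
  assumes "delta_zero c" "rotates B g"
  shows "rotates B (\<lambda>t. c t *\<^sub>R g t)"
  using bounded_bilinear.has_vector_derivative[OF bounded_bilinear_scaleR assms(1) assms(2)[unfolded rotates_def]]
  by (simp add: rotates_def linear_scale[OF matrix_vector_mul_linear])

lemma rotates_diff: "rotates B g \<Longrightarrow> rotates B h \<Longrightarrow> rotates B (\<lambda>t. g t - h t)"
  unfolding rotates_def using has_vector_derivative_diff by (fastforce simp: matrix_vector_mult_diff_distrib)

lemma rotates_affine: "rotates B (\<lambda>t. n + t *\<^sub>R (B *v n))"
  unfolding rotates_def by (auto intro!: derivative_eq_intros)

lemma delta_zero_transform:
  assumes "delta_zero g" "r > 0" "\<And>t. t \<in> {-r<..<r} \<Longrightarrow> g t = h t"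
  shows "delta_zero h"
  using assms has_vector_derivative_transform_within_open[of g 0 0 "{-r<..<r}" h] by simp

text \<open>Written with a reciprocal square root so that \<open>smooth_on_rsqrt\<close>
  applies.\<close>

definition unit :: "real^4 \<Rightarrow> real^4" where
  "unit a = (1 / sqrt (a \<bullet> a)) *\<^sub>R a"

lemma unit_inner:
  assumes "a \<bullet> a > 0"
  shows "unit a \<bullet> unit a = 1"
  using assms by (simp add: unit_def field_simps flip: real_sqrt_mult)

text \<open>The squared length is stationary by skew-symmetry, so the normalizing factor is
  too.\<close>

lemma rotates_unit:
  assumes B: "transpose B = - B" and g: "rotates B g" and pos: "g 0 \<bullet> g 0 > 0"
  shows "rotates B (\<lambda>t. unit (g t))"
  unfolding unit_def
proof (rule rotates_scaleR[OF _ g])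
  have "((\<lambda>t. g t \<bullet> g t) has_real_derivative 0) (at 0)"
    using rotates_inner[OF B g g] by (simp add: has_real_derivative_iff_has_vector_derivative)
  then have "((\<lambda>t. 1 / sqrt (g t \<bullet> g t)) has_real_derivative 0) (at 0)"
    using pos by (auto intro!: derivative_eq_intros) (metis inner_ge_zero not_less)
  then show "delta_zero (\<lambda>t. 1 / sqrt (g t \<bullet> g t))"
    by (simp add: has_real_derivative_iff_has_vector_derivative)
qed

section \<open>The preserved quantities differentiated in time, and rigidity of a patch\<close>

context bent_patch
begin

lemma bent_0: "bent 0 = F"
  by (simp add: bent_def fun_eq_iff)

lemma second_form_deltas:
  assumes u: "u \<in> V" and r: "r > 0" and n: "(n has_vector_derivative n') (at 0)"
    and normal: "\<And>t. t \<in> {-r<..<r} \<Longrightarrow> n t \<in> orthogonal_comp (range (D (bent t) u))"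
    and on: "\<And>t. t \<in> {-r<..<r} \<Longrightarrow> orthonormal_pair (bent t) u (e1 t) (e2 t)"
    and e1: "delta_zero e1" and e2: "delta_zero e2"
  shows "((\<lambda>t. mean_curvature (bent t) u \<bullet> n t) has_vector_derivative
      (bilin2 (second_form_variation u (n 0) n') (e1 0) (e1 0) +
       bilin2 (second_form_variation u (n 0) n') (e2 0) (e2 0)) / 2) (at 0)"
    and "((\<lambda>t. (\<chi> k. Re (hopf_differential (bent t) u (e1 t) (e1 t) $ k)) \<bullet> n t) has_vector_derivative
      (bilin2 (second_form_variation u (n 0) n') (e1 0) (e1 0) -
       bilin2 (second_form_variation u (n 0) n') (e2 0) (e2 0)) / 4) (at 0)"
    and "((\<lambda>t. (\<chi> k. Im (hopf_differential (bent t) u (e1 t) (e1 t) $ k)) \<bullet> n t) has_vector_derivative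
      - (bilin2 (second_form_variation u (n 0) n') (e1 0) (e2 0) +
         bilin2 (second_form_variation u (n 0) n') (e2 0) (e1 0)) / 4) (at 0)"
proof -
  define a where "a t = (\<lambda>i j. D (\<lambda>q. D (bent t) q (axis j 1)) u (axis i 1) \<bullet> n t)" for t
  have sff: "(\<lambda>i j. second_fundamental_form (bent t) u (axis i 1) (axis j 1) \<bullet> n t) = a t"
    if "t \<in> {-r<..<r}" for t
    unfolding a_def using second_fundamental_form_inner[OF linear_bent[OF u] normal[OF that]] by simp
  note d = bilin2_second_form_delta[OF u n, folded a_def]
  have "((\<lambda>t. (bilin2 (a t) (e1 t) (e1 t) + bilin2 (a t) (e2 t) (e2 t)) / 2) has_vector_derivative
      (bilin2 (second_form_variation u (n 0) n') (e1 0) (e1 0) +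
       bilin2 (second_form_variation u (n 0) n') (e2 0) (e2 0)) / 2) (at 0)"
    by (intro has_vector_derivative_divide has_vector_derivative_add d e1 e2)
  then show "((\<lambda>t. mean_curvature (bent t) u \<bullet> n t) has_vector_derivative
      (bilin2 (second_form_variation u (n 0) n') (e1 0) (e1 0) +
       bilin2 (second_form_variation u (n 0) n') (e2 0) (e2 0)) / 2) (at 0)"
    by (rule has_vector_derivative_transform_within_open[where S = "{-r<..<r}"])
       (use r in \<open>auto simp: mean_curvature_inner[OF linear_bent[OF u] on] sff\<close>)
  have "((\<lambda>t. (bilin2 (a t) (e1 t) (e1 t) - bilin2 (a t) (e2 t) (e2 t)) / 4) has_vector_derivative
      (bilin2 (second_form_variation u (n 0) n') (e1 0) (e1 0) -
       bilin2 (second_form_variation u (n 0) n') (e2 0) (e2 0)) / 4) (at 0)"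
    by (intro has_vector_derivative_divide has_vector_derivative_diff d e1 e2)
  then show "((\<lambda>t. (\<chi> k. Re (hopf_differential (bent t) u (e1 t) (e1 t) $ k)) \<bullet> n t) has_vector_derivative
      (bilin2 (second_form_variation u (n 0) n') (e1 0) (e1 0) -
       bilin2 (second_form_variation u (n 0) n') (e2 0) (e2 0)) / 4) (at 0)"
    by (rule has_vector_derivative_transform_within_open[where S = "{-r<..<r}"])
       (use r in \<open>auto simp: hopf_differential_inner(1)[OF linear_bent[OF u] on refl] sff\<close>)
  have "((\<lambda>t. - (bilin2 (a t) (e1 t) (e2 t) + bilin2 (a t) (e2 t) (e1 t)) / 4) has_vector_derivative
      - (bilin2 (second_form_variation u (n 0) n') (e1 0) (e2 0) +
         bilin2 (second_form_variation u (n 0) n') (e2 0) (e1 0)) / 4) (at 0)"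
    by (intro has_vector_derivative_divide has_vector_derivative_minus has_vector_derivative_add d e1 e2)
  then show "((\<lambda>t. (\<chi> k. Im (hopf_differential (bent t) u (e1 t) (e1 t) $ k)) \<bullet> n t) has_vector_derivative
      - (bilin2 (second_form_variation u (n 0) n') (e1 0) (e2 0) +
         bilin2 (second_form_variation u (n 0) n') (e2 0) (e1 0)) / 4) (at 0)"
    by (rule has_vector_derivative_transform_within_open[where S = "{-r<..<r}"])
       (use r in \<open>auto simp: hopf_differential_inner(2)[OF linear_bent[OF u] on refl] sff\<close>)
qed

text \<open>The variation is a symmetric matrix, because second derivatives are symmetric. The three
  hypotheses kill its trace, the difference of its diagonal entries and its off-diagonal entry in an
  orthonormal basis, hence the matrix.\<close>

lemma second_form_variation_eq_zero:
  assumes u: "u \<in> V" and r: "r > 0" and n: "(n has_vector_derivative n') (at 0)"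
    and normal: "\<And>t. t \<in> {-r<..<r} \<Longrightarrow> n t \<in> orthogonal_comp (range (D (bent t) u))"
    and H: "delta_zero (\<lambda>t. mean_curvature (bent t) u \<bullet> n t)"
    and Re: "delta_zero (\<lambda>t. (\<chi> k. Re (hopf_differential (bent t) u (frame1 (bent t) u) (frame1 (bent t) u) $ k)) \<bullet> n t)"
    and Im: "delta_zero (\<lambda>t. (\<chi> k. Im (hopf_differential (bent t) u (frame1 (bent t) u) (frame1 (bent t) u) $ k)) \<bullet> n t)"
  shows "second_form_variation u (n 0) n' i j = 0"
proof -
  define a where "a = second_form_variation u (n 0) n'"
  let ?e1 = "frame1 (bent 0) u" and ?e2 = "frame2 (bent 0) u"
  note d = second_form_deltas[OF u r n normal orthonormal_pair_bent[OF u] frame_bent_delta_zero[OF u], folded a_def]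
  have 1: "bilin2 a ?e1 ?e1 + bilin2 a ?e2 ?e2 = 0"
    using vector_derivative_unique_at[OF d(1) H] by simp
  have 2: "bilin2 a ?e1 ?e1 - bilin2 a ?e2 ?e2 = 0"
    using vector_derivative_unique_at[OF d(2) Re] by simp
  have 3: "bilin2 a ?e1 ?e2 + bilin2 a ?e2 ?e1 = 0"
    using vector_derivative_unique_at[OF d(3) Im] by simp
  have "a k l = a l k" for k l
    unfolding a_def by (rule second_form_variation_symmetric[OF u])
  then have "bilin2 a v w = bilin2 a w v" for v w by (simp add: bilin2_def sum_2 algebra_simps)
  with 1 2 3 have z: "bilin2 a ?e1 ?e1 = 0" "bilin2 a ?e2 ?e2 = 0" "bilin2 a ?e1 ?e2 = 0" "bilin2 a ?e2 ?e1 = 0"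
    by (smt (verit))+
  note ex = orthonormal_pair_expansion[OF linear_bent[OF u] orthonormal_pair_bent[OF u], of _ 0]
  have "bilin2 a v w = 0" for v w
    by (subst ex[of v], subst ex[of w]) (simp add: bilin2_add bilin2_scale z)
  from this[of "axis i 1" "axis j 1"] have "a i j = 0"
    using exhaust_2[of i] exhaust_2[of j] by (auto simp: bilin2_def sum_2 axis_def)
  then show ?thesis by (simp add: a_def)
qed

lemma tangent_variation:
  assumes "u \<in> V" "delta_zero e"
  shows "((\<lambda>t. D (bent t) u (e t)) has_vector_derivative D \<tau> u (e 0)) (at 0)"
proof -
  have lin: "bounded_linear (D F u)" "bounded_linear (D \<tau> u)"
    using smooth_on_linear[OF smooth_F open_V assms(1)] smooth_on_linear[OF smooth_\<tau> open_V assms(1)]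
    by (auto intro: linear_conv_bounded_linear[THEN iffD1])
  note d = bounded_linear.has_vector_derivative[OF _ assms(2)]
  have "((\<lambda>t. D F u (e t) + t *\<^sub>R D \<tau> u (e t)) has_vector_derivative
      D F u 0 + (0 *\<^sub>R D \<tau> u 0 + 1 *\<^sub>R D \<tau> u (e 0))) (at 0)"
    by (intro has_vector_derivative_add d[OF lin(1)]
        bounded_bilinear.has_vector_derivative[OF bounded_bilinear_scaleR] d[OF lin(2)] has_vector_derivative_id)
  then show ?thesis
    unfolding D_bent[OF assms(1)] using linear_0[OF bounded_linear.linear[OF lin(1)]] linear_0[OF bounded_linear.linear[OF lin(2)]] by simp
qed

text \<open>The six entries of the skew-symmetric connection matrix are dealt with separately: one
  by evenness of the metric, one by \<open>conn\<close>, four by \<open>var\<close>. The conclusion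
  keeps the motion of the tangent vectors and of the two normals, since they are needed to compare
  \<open>B\<close> with other frames.\<close>

lemma rigid_patch:
  assumes W: "W \<subseteq> V" "open W" "convex W" and r: "r > 0"
    and smooth_e: "smooth_on (W \<times> {-r<..<r}) (\<lambda>z. e3 (snd z) (fst z))"
      "smooth_on (W \<times> {-r<..<r}) (\<lambda>z. e4 (snd z) (fst z))"
    and normal: "\<And>t u. t \<in> {-r<..<r} \<Longrightarrow> u \<in> W \<Longrightarrow> e3 t u \<in> orthogonal_comp (range (D (bent t) u))"
      "\<And>t u. t \<in> {-r<..<r} \<Longrightarrow> u \<in> W \<Longrightarrow> e4 t u \<in> orthogonal_comp (range (D (bent t) u))"
    and on: "\<And>t u. t \<in> {-r<..<r} \<Longrightarrow> u \<in> W \<Longrightarrow> norm (e3 t u) = 1 \<and> norm (e4 t u) = 1 \<and> e3 t u \<bullet> e4 t u = 0"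
    and conn: "\<And>u v. u \<in> W \<Longrightarrow> delta_zero (\<lambda>t. normal_connection_form (bent t) (e3 t) (e4 t) u v)"
    and var: "\<And>u n' i j. u \<in> W \<Longrightarrow> ((\<lambda>t. e3 t u) has_vector_derivative n') (at 0) \<Longrightarrow>
        second_form_variation u (e3 0 u) n' i j = 0"
      "\<And>u n' i j. u \<in> W \<Longrightarrow> ((\<lambda>t. e4 t u) has_vector_derivative n') (at 0) \<Longrightarrow>
        second_form_variation u (e4 0 u) n' i j = 0"
  shows "\<exists>B c. transpose B = - B \<and> (\<forall>u\<in>W. \<tau> u = B *v F u + c \<and> (\<forall>v. D \<tau> u v = B *v D F u v) \<and>
    rotates B (\<lambda>t. e3 t u) \<and> rotates B (\<lambda>t. e4 t u))"
proof -
  define G :: "4 \<Rightarrow> (real^2) \<times> real \<Rightarrow> real^4" where "G a = (if a = 1 then eps1 else if a = 2 then eps2 else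
    if a = 3 then (\<lambda>z. e3 (snd z) (fst z)) else (\<lambda>z. e4 (snd z) (fst z)))" for a
  have G: "G 1 = eps1" "G 2 = eps2" "G 3 = (\<lambda>z. e3 (snd z) (fst z))" "G 4 = (\<lambda>z. e4 (snd z) (fst z))"
    by (simp_all add: G_def)
  have opW: "open (W \<times> {-r<..<r})" using W by (intro open_Times) auto
  have sub: "W \<times> {-r<..<r} \<subseteq> cyl" using W by auto
  have smooth_G: "smooth_on (W \<times> {-r<..<r}) (G a)" for a
    using exhaust_4[of a] smooth_on_subset[OF smooth_eps(1) open_cyl opW sub]
      smooth_on_subset[OF smooth_eps(2) open_cyl opW sub] smooth_e
    by (elim disjE) (simp_all add: G)
  have ortho: "G a (u, t) \<bullet> G b (u, t) = (if a = b then 1 else 0)" if u: "u \<in> W" and t: "t \<in> {-r<..<r}" for a b u t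
  proof -
    have uV: "u \<in> V" using u W by auto
    have z: "D (bent t) u v \<bullet> e3 t u = 0" "D (bent t) u v \<bullet> e4 t u = 0" for v
      using normal[OF t u] by (auto simp: in_orthogonal_comp_range)
    have z': "e3 t u \<bullet> D (bent t) u v = 0" "e4 t u \<bullet> D (bent t) u v = 0" for v
      using z by (auto simp: inner_commute)
    have o': "e4 t u \<bullet> e3 t u = 0" "e3 t u \<bullet> e4 t u = 0" "e3 t u \<bullet> e3 t u = 1" "e4 t u \<bullet> e4 t u = 1"
      using on[OF t u] by (auto simp: inner_commute norm_eq_1)
    show ?thesis
      using exhaust_4[of a] exhaust_4[of b] orthonormal_pair_bent[OF uV, of t]
      by (elim disjE) (simp_all add: G orthonormal_pair_def metric_def z z' o' inner_commute)
  qed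
  have zero12: "delta_zero (\<lambda>t. D (\<lambda>q. G 1 (q, t)) u w \<bullet> G 2 (u, t))" if u: "u \<in> W" for u w
    using tangent_connection_form_bent_delta_zero[of u w] tangent_connection_form_bent[of u] u W
    by (auto simp: G subset_iff)
  have zero34: "delta_zero (\<lambda>t. D (\<lambda>q. G 3 (q, t)) u w \<bullet> G 4 (u, t))" if u: "u \<in> W" for u w
  proof (rule delta_zero_transform[OF conn[OF u, of w] r])
    fix t assume t: "t \<in> {-r<..<r}"
    \<comment> \<open>Pairing with the normal vector \<open>e4\<close> makes the projection in the
      normal connection invisible.\<close>
    show "normal_connection_form (bent t) (e3 t) (e4 t) u w = D (\<lambda>q. G 3 (q, t)) u w \<bullet> G 4 (u, t)"
      using normal_part_inner[OF linear_bent normal(2)[OF t u]] u W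
      by (auto simp: normal_connection_form_def normal_connection_def G)
  qed
  \<comment> \<open>The derivative of a tangent field has a tangential term, from its components,
    which \<open>n\<close> annihilates; what is left is the second fundamental form, with vanishing
    variation.\<close>
  have mixed: "delta_zero (\<lambda>t. D (\<lambda>q. D (bent t) q (e t q)) u w \<bullet> n t)"
    if u: "u \<in> V" and e: "\<And>t. (e t has_derivative D (e t) u) (at u)" "delta_zero (\<lambda>t. e t u)"
      and n: "\<And>t. t \<in> {-r<..<r} \<Longrightarrow> n t \<in> orthogonal_comp (range (D (bent t) u))"
      and n': "(n has_vector_derivative n') (at 0)" "\<And>i j. second_form_variation u (n 0) n' i j = 0"
    for u w e n n'
  proof -
    have eq: "D (\<lambda>q. D (bent t) q (e t q)) u w \<bullet> n t =
        bilin2 (\<lambda>i j. D (\<lambda>q. D (bent t) q (axis j 1)) u (axis i 1) \<bullet> n t) w (e t u)"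
      if t: "t \<in> {-r<..<r}" for t
    proof -
      have z: "D (bent t) u v \<bullet> n t = 0" for v using n[OF t] by (auto simp: in_orthogonal_comp_range)
      have X: "D (\<lambda>q. D (bent t) q (axis j 1)) u w = w $ 1 *\<^sub>R D (\<lambda>q. D (bent t) q (axis j 1)) u (axis 1 1)
          + w $ 2 *\<^sub>R D (\<lambda>q. D (bent t) q (axis j 1)) u (axis 2 1)" for j
        by (rule D_axis_expansion[OF smooth_on_linear[OF smooth_on_D[OF smooth_bent] open_V u]])
      show ?thesis
        unfolding D_eqI[OF tangent_connection_form_eq(1)[OF open_V smooth_bent u e(1)]]
        by (simp add: inner_add_left z bilin2_def sum_2 X algebra_simps)
    qed
    have "((\<lambda>t. bilin2 (\<lambda>i j. D (\<lambda>q. D (bent t) q (axis j 1)) u (axis i 1) \<bullet> n t) w (e t u))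
        has_vector_derivative bilin2 (second_form_variation u (n 0) n') w (e 0 u)) (at 0)"
      using bilin2_second_form_delta[OF u n'(1) _ e(2), of "\<lambda>_. w"] by simp
    then have "delta_zero (\<lambda>t. bilin2 (\<lambda>i j. D (\<lambda>q. D (bent t) q (axis j 1)) u (axis i 1) \<bullet> n t) w (e t u))"
      by (simp add: bilin2_def n'(2))
    then show ?thesis by (rule delta_zero_transform[OF _ r]) (simp add: eq)
  qed
  have der: "((\<lambda>t. G a (u, t)) has_vector_derivative D (G a) (u, 0) (0, 1)) (at 0)" if "u \<in> W" for a u
    by (rule derivative_in_time[OF smooth_G opW]) (use that r in auto)
  have zeroin: "delta_zero (\<lambda>t. D (\<lambda>q. G a (q, t)) u w \<bullet> G b (u, t))"
    if u: "u \<in> W" and ab: "a \<in> {1, 2}" "b \<in> {3, 4}" for u w a b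
  proof -
    have uV: "u \<in> V" using u W by auto
    have n: "\<And>t. t \<in> {-r<..<r} \<Longrightarrow> G b (u, t) \<in> orthogonal_comp (range (D (bent t) u))"
      using ab(2) normal u by (auto simp: G)
    have v: "second_form_variation u (G b (u, 0)) (D (G b) (u, 0) (0, 1)) i j = 0" for i j
      using ab(2) der[OF u, of b] var[OF u] by (auto simp: G)
    note m = mixed[OF uV _ _ n der[OF u] v, of _ w]
    show ?thesis
      using ab(1) m[OF frame_bent_has_derivative(1)[OF uV] frame_bent_delta_zero(1)[OF uV]]
        m[OF frame_bent_has_derivative(2)[OF uV] frame_bent_delta_zero(2)[OF uV]]
      by (auto simp: G)
  qed
  have conn_G: "delta_zero (\<lambda>t. D (\<lambda>q. G a (q, t)) u w \<bullet> G b (u, t)) \<or>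
      delta_zero (\<lambda>t. D (\<lambda>q. G b (q, t)) u w \<bullet> G a (u, t))" if u: "u \<in> W" and ab: "a \<noteq> b" for u w a b
  proof -
    define P where "P a b \<longleftrightarrow> delta_zero (\<lambda>t. D (\<lambda>q. G a (q, t)) u w \<bullet> G b (u, t))" for a b
    have "P 1 2" "P 1 3" "P 1 4" "P 2 3" "P 2 4" "P 3 4"
      using zero12[OF u] zero34[OF u] zeroin[OF u] by (simp_all add: P_def)
    then have "P a b \<or> P b a" using exhaust_4[of a] exhaust_4[of b] ab by (elim disjE) simp_all
    then show ?thesis by (simp add: P_def)
  qed
  obtain B where B: "transpose B = - B"
    and rot: "\<And>u a. u \<in> W \<Longrightarrow> ((\<lambda>t. G a (u, t)) has_vector_derivative B *v G a (u, 0)) (at 0)"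
    using moving_frame_constant_motion[OF W(2,3) r smooth_G ortho conn_G] by auto
  have D\<tau>: "D \<tau> u v = B *v D F u v" if u: "u \<in> W" for u v
  proof -
    have uV: "u \<in> V" using u W by auto
    have lin: "linear (D F u)" "linear (D \<tau> u)"
      using smooth_on_linear[OF smooth_F open_V uV] smooth_on_linear[OF smooth_\<tau> open_V uV] by auto
    \<comment> \<open>The velocity of each tangent frame vector is computed twice: by
      \<open>tangent_variation\<close>, and as \<open>B\<close> applied to the vector.\<close>
    have e: "D \<tau> u (frame1 F u) = B *v D F u (frame1 F u)" "D \<tau> u (frame2 F u) = B *v D F u (frame2 F u)"
      using vector_derivative_unique_at[OF tangent_variation[OF uV frame_bent_delta_zero(1)[OF uV]]]
        vector_derivative_unique_at[OF tangent_variation[OF uV frame_bent_delta_zero(2)[OF uV]]]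
        rot[OF u, of 1] rot[OF u, of 2]
      by (auto simp: G bent_0)
    show ?thesis
      by (subst (1 2) orthonormal_pair_expansion[OF lin(1) orthonormal_pair_frame[OF lin(1) inj_F[OF uV]], of v])
         (simp add: linear_add[OF lin(1)] linear_scale[OF lin(1)] linear_add[OF lin(2)] linear_scale[OF lin(2)] e
           matrix_vector_right_distrib linear_scale[OF matrix_vector_mul_linear])
  qed
  have "\<exists>c. \<forall>u\<in>W. \<tau> u - B *v F u = c"
  proof (rule has_derivative_zero_constant[OF W(3)])
    fix u assume u: "u \<in> W"
    then have uV: "u \<in> V" using W by auto
    have "((\<lambda>u. \<tau> u - B *v F u) has_derivative (\<lambda>v. D \<tau> u v - B *v D F u v)) (at u)"
      by (intro has_derivative_diff bounded_linear.has_derivative[OF matrix_vector_mul_bounded_linear]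
          smooth_on_has_derivative[OF smooth_F open_V uV] smooth_on_has_derivative[OF smooth_\<tau> open_V uV])
    then show "((\<lambda>u. \<tau> u - B *v F u) has_derivative (\<lambda>v. 0)) (at u within W)"
      using D\<tau>[OF u] has_derivative_at_withinI by auto
  qed
  then obtain c where "\<And>u. u \<in> W \<Longrightarrow> \<tau> u = B *v F u + c"
    by (metis add.commute diff_add_cancel)
  then show ?thesis
    using B D\<tau> rot[of _ 3] rot[of _ 4] unfolding rotates_def G by (intro exI[of _ B] exI[of _ c]) simp
qed

text \<open>This is where coherence acts. For each \<open>m\<close> among the tangent vectors and
  \<open>a3\<close>, \<open>a4\<close>, the product of \<open>m(t)\<close> and \<open>n(t)\<close>
  is stationary while \<open>m\<close> turns with \<open>B\<close>; skew-symmetry then gives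
  \<open>n' \<bullet> m = Bn \<bullet> m\<close>. These \<open>m\<close> span the space.\<close>

lemma normal_motion_unique:
  assumes u: "u \<in> V" and B: "transpose B = - B" and D\<tau>: "\<And>v. D \<tau> u v = B *v D F u v"
    and r: "r > 0" and n: "(n has_vector_derivative n') (at 0)"
    and normal: "\<And>t. t \<in> {-r<..<r} \<Longrightarrow> n t \<in> orthogonal_comp (range (D (bent t) u))"
    and a: "a3 0 \<in> orthogonal_comp (range (D F u))" "a4 0 \<in> orthogonal_comp (range (D F u))"
      "norm (a3 0) = 1" "norm (a4 0) = 1" "a3 0 \<bullet> a4 0 = 0"
    and rot: "rotates B a3" "rotates B a4"
    and coh: "delta_zero (\<lambda>t. a3 t \<bullet> n t)" "delta_zero (\<lambda>t. a4 t \<bullet> n t)"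
  shows "n' = B *v n 0"
proof -
  obtain g :: "4 \<Rightarrow> real^4" where g: "\<And>a b. g a \<bullet> g b = (if a = b then 1 else 0)"
    "\<And>k. g k \<in> range (D F u) \<union> {a3 0, a4 0}"
    using adapted_orthonormal_basis[OF smooth_on_linear[OF smooth_F open_V u] inj_F[OF u] a] by blast
  have aux: "n' \<bullet> m 0 = (B *v n 0) \<bullet> m 0" if "rotates B m" "delta_zero (\<lambda>t. m t \<bullet> n t)" for m
  proof -
    have "m 0 \<bullet> n' + (B *v m 0) \<bullet> n 0 = 0"
      using vector_derivative_unique_at[OF has_vector_derivative_inner[OF that(1)[unfolded rotates_def] n] that(2)] .
    then show ?thesis using skew_inner[OF B, of "m 0" "n 0"] by (simp add: inner_commute)
  qed
  have "n' \<bullet> D F u v = (B *v n 0) \<bullet> D F u v" for v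
  proof -
    have "rotates B (\<lambda>t. D (bent t) u v)"
      using tangent_variation[OF u, of "\<lambda>_. v"] D\<tau> by (simp add: rotates_def bent_0)
    moreover have "delta_zero (\<lambda>t. D (bent t) u v \<bullet> n t)"
      by (rule delta_zero_transform[OF _ r, of "\<lambda>_. 0"]) (use normal in \<open>auto simp: in_orthogonal_comp_range\<close>)
    ultimately show ?thesis using aux[of "\<lambda>t. D (bent t) u v"] by (simp add: bent_0)
  qed
  moreover have "n' \<bullet> a3 0 = (B *v n 0) \<bullet> a3 0" "n' \<bullet> a4 0 = (B *v n 0) \<bullet> a4 0"
    using aux[OF rot(1) coh(1)] aux[OF rot(2) coh(2)] by auto
  ultimately have "n' \<bullet> g k = (B *v n 0) \<bullet> g k" for k using g(2)[of k] by auto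
  then show ?thesis by (rule orthonormal_eqI[OF g(1)])
qed

end

section \<open>Preservation implies triviality\<close>

locale bent_surface =
  fixes A :: "'m::{t2_space, second_countable_topology} chart set" and f T :: "'m \<Rightarrow> real^4"
  assumes atlas: "oriented_atlas A" and immersion: "immersion A f" and bending: "bending_field A f T"
begin

lemma chart:
  assumes "(V, x) \<in> A"
  shows "open V" "open (x ` V)" "inj_on x V" "continuous_on V x" "continuous_on (x ` V) (inv_into V x)"
proof -
  have *: "open V" "open (x ` V)" "homeomorphism V (x ` V) x (inv_into V x)"
    using atlas assms by (auto simp: oriented_atlas_def)
  then show "open V" "open (x ` V)" "continuous_on V x" "continuous_on (x ` V) (inv_into V x)"
    by (auto simp: homeomorphism_def)
  show "inj_on x V" using *(3) by (metis homeomorphism_apply1 inj_on_inverseI)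
qed

lemma open_chart_preimage:
  assumes "(V, x) \<in> A" "open U"
  shows "open {u\<in>V. x u \<in> U}"
proof -
  have "open (x -` U \<inter> V)"
    using chart[OF assms(1)] assms(2) continuous_on_open_vimage by blast
  then show ?thesis by (simp add: vimage_def Int_def conj_commute)
qed

lemma open_chart_image:
  assumes "(V, x) \<in> A" "open W" "W \<subseteq> V"
  shows "open (x ` W)"
proof -
  have "open (inv_into V x -` W \<inter> x ` V)"
    using chart[OF assms(1)] assms(2) continuous_on_open_vimage by blast
  moreover have "inv_into V x -` W \<inter> x ` V = x ` W"
    using assms(3) chart(3)[OF assms(1)] by (auto simp: subset_iff)
  ultimately show ?thesis by simp
qed

lemma patch:
  assumes "(V, x) \<in> A"
  shows "bent_patch V (f \<circ> x) (T \<circ> x)"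
  using chart[OF assms] immersion bending assms
  by unfold_locales (auto simp: immersion_def bending_field_def smooth_map_def split: prod.splits)

lemma bent_eq:
  assumes "(V, x) \<in> A"
  shows "bent_patch.bent (f \<circ> x) (T \<circ> x) = (\<lambda>t. deform f T t \<circ> x)"
  by (simp add: bent_patch.bent_def[OF patch[OF assms]] deform_def fun_eq_iff)

lemma surface_chartE:
  assumes "p \<in> surface A"
  obtains V x u where "(V, x) \<in> A" "u \<in> V" "p = x u"
  using assms by (auto simp: surface_def)

lemma normal_frameD:
  assumes "normal_frame A f T (U, r, e3, e4)"
  shows "open U" "U \<subseteq> surface A" "r > 0"
    and "\<And>t p. t \<in> {-r<..<r} \<Longrightarrow> p \<in> U \<Longrightarrow> norm (e3 t p) = 1 \<and> norm (e4 t p) = 1 \<and> e3 t p \<bullet> e4 t p = 0"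
    and "\<And>V x e. (V, x) \<in> A \<Longrightarrow> e \<in> {e3, e4} \<Longrightarrow>
      smooth_on ({u\<in>V. x u \<in> U} \<times> {-r<..<r}) (\<lambda>z. e (snd z) (x (fst z)))"
    and "\<And>V x e t u. (V, x) \<in> A \<Longrightarrow> e \<in> {e3, e4} \<Longrightarrow> t \<in> {-r<..<r} \<Longrightarrow> u \<in> V \<Longrightarrow> x u \<in> U \<Longrightarrow>
      e t (x u) \<in> orthogonal_comp (range (D (deform f T t \<circ> x) u))"
  using assms by (fastforce simp: normal_frame_def case_prod_unfold)+

lemma frame_derivative_exists:
  assumes E: "normal_frame A f T (U, r, e3, e4)" and e: "e \<in> {e3, e4}" and p: "p \<in> U"
  shows "\<exists>n'. ((\<lambda>t. e t p) has_vector_derivative n') (at 0)"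
proof -
  note E' = normal_frameD[OF E]
  obtain V x u where u: "(V, x) \<in> A" "u \<in> V" "p = x u"
    using surface_chartE E'(2) p by blast
  have "open ({u\<in>V. x u \<in> U} \<times> {-r<..<r})"
    using open_chart_preimage[OF u(1) E'(1)] by (intro open_Times) auto
  from derivative_in_time[OF E'(5)[OF u(1) e] this, of u 0] show ?thesis
    using u p E'(3) by auto
qed

text \<open>The clause on frames makes \<open>B\<close> unique even at points with a planar
  neighbourhood. The neighbourhood \<open>N\<close> makes the property open in \<open>p\<close>, so
  that uniqueness yields local constancy.\<close>

definition motion_at :: "'m normal_frame set \<Rightarrow> 'm \<Rightarrow> real^4^4 \<Rightarrow> real^4 \<Rightarrow> bool" where
  "motion_at \<E> p B c \<longleftrightarrow> transpose B = - B \<and> (\<exists>N. open N \<and> p \<in> N \<and> (\<forall>q\<in>N. T q = B *v f q + c \<and>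
     (\<forall>(U, r, e3, e4)\<in>\<E>. q \<in> U \<longrightarrow> rotates B (\<lambda>t. e3 t q) \<and> rotates B (\<lambda>t. e4 t q))))"

lemma preserved_second_form:
  assumes pf: "parallel_frame_system A f T \<E>" and H: "preserves_mean_curvature A f T \<E>"
    and Hopf: "preserves_hopf_differential A f T \<E>"
    and E: "(U, r, e3, e4) \<in> \<E>" and e: "e \<in> {e3, e4}"
    and x: "(V, x) \<in> A" and u: "u \<in> V" "x u \<in> U"
    and n': "((\<lambda>t. e t (x u)) has_vector_derivative n') (at 0)"
  shows "bent_patch.second_form_variation (f \<circ> x) (T \<circ> x) u (e 0 (x u)) n' i j = 0"
proof -
  interpret bent_patch V "f \<circ> x" "T \<circ> x" by (rule patch[OF x])
  note beq = bent_eq[OF x]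
  have beq': "deform f T t \<circ> x = bent t" for t using beq by (simp add: fun_eq_iff)
  have nf: "normal_frame A f T (U, r, e3, e4)"
    using pf E by (auto simp: parallel_frame_system_def parallel_frame_def)
  note nf' = normal_frameD[OF nf]
  \<comment> \<open>The time bound 1 is arbitrary: the Gram-Schmidt frame exists at all
    times.\<close>
  have psi: "hopf_coefficient bent V 1 theta1 theta2
      (\<lambda>t u. hopf_differential (bent t) u (frame1 (bent t) u) (frame1 (bent t) u))"
    by (rule hopf_coefficient_exists[OF _ tangent_frame_bent dual_coframe_bent]) (rule linear_bent)
  have "preserved \<E> x V (\<lambda>t u. \<chi> k. Re (hopf_differential (bent t) u (frame1 (bent t) u) (frame1 (bent t) u) $ k)) \<and>
    preserved \<E> x V (\<lambda>t u. \<chi> k. Im (hopf_differential (bent t) u (frame1 (bent t) u) (frame1 (bent t) u) $ k))"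
    by (rule bspec[OF Hopf[unfolded preserves_hopf_differential_def] x, unfolded prod.case beq[symmetric],
          rule_format, of V 1 "\<lambda>t. frame1 (bent t)" "\<lambda>t. frame2 (bent t)" theta1 theta2])
       (intro conjI subset_refl tangent_frame_bent dual_coframe_bent stationary_frame_bent psi)
  moreover have "preserved \<E> x V (\<lambda>t. mean_curvature (bent t))"
    using H x unfolding preserves_mean_curvature_def beq by auto
  ultimately have "delta_zero (\<lambda>t. mean_curvature (bent t) u \<bullet> e t (x u))"
    "delta_zero (\<lambda>t. (\<chi> k. Re (hopf_differential (bent t) u (frame1 (bent t) u) (frame1 (bent t) u) $ k)) \<bullet> e t (x u))"
    "delta_zero (\<lambda>t. (\<chi> k. Im (hopf_differential (bent t) u (frame1 (bent t) u) (frame1 (bent t) u) $ k)) \<bullet> e t (x u))"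
    using E e u unfolding preserved_def by auto
  then show ?thesis
    using second_form_variation_eq_zero[OF u(1) nf'(3) n'] nf'(6)[OF x e _ u] beq' by auto
qed

text \<open>A single frame of the system gives \<open>B\<close> and \<open>c\<close> on a small
  ball, convex so that vanishing derivatives mean constancy. Coherence then shows that every other
  frame met there turns with the same \<open>B\<close>.\<close>

lemma motion_exists:
  assumes pf: "parallel_frame_system A f T \<E>" and H: "preserves_mean_curvature A f T \<E>"
    and Hopf: "preserves_hopf_differential A f T \<E>" and p: "p \<in> surface A"
  shows "\<exists>B c. motion_at \<E> p B c"
proof -
  obtain V x u0 where x: "(V, x) \<in> A" and u0: "u0 \<in> V" "p = x u0"
    using surface_chartE[OF p] by blast
  interpret bent_patch V "f \<circ> x" "T \<circ> x" by (rule patch[OF x])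
  have beq: "deform f T t \<circ> x = bent t" for t using bent_eq[OF x] by (simp add: fun_eq_iff)
  obtain U r e3 e4 where E: "(U, r, e3, e4) \<in> \<E>" and pU: "p \<in> U"
    using pf p by (fastforce simp: parallel_frame_system_def)
  have E_par: "parallel_frame A f T (U, r, e3, e4)"
    using pf E by (auto simp: parallel_frame_system_def)
  then have nf: "normal_frame A f T (U, r, e3, e4)" by (simp add: parallel_frame_def)
  note nf' = normal_frameD[OF nf]
  obtain d where d: "d > 0" "ball u0 d \<subseteq> {u\<in>V. x u \<in> U}"
    using open_chart_preimage[OF x nf'(1)] u0 pU by (metis (mono_tags, lifting) mem_Collect_eq openE)
  define W where "W = ball u0 d"
  have W: "W \<subseteq> V" "open W" "convex W" "W \<subseteq> {u\<in>V. x u \<in> U}" "u0 \<in> W" using d by (auto simp: W_def)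
  have inU: "u \<in> V" "x u \<in> U" if "u \<in> W" for u using W(4) that by auto
  have sub: "W \<times> {-r<..<r} \<subseteq> {u\<in>V. x u \<in> U} \<times> {-r<..<r}" "open (W \<times> {-r<..<r})"
    "open ({u\<in>V. x u \<in> U} \<times> {-r<..<r})"
    using W open_chart_preimage[OF x nf'(1)] by (auto intro!: open_Times)
  have "\<exists>B c. transpose B = - B \<and> (\<forall>u\<in>W. (T \<circ> x) u = B *v (f \<circ> x) u + c \<and>
      (\<forall>v. D (T \<circ> x) u v = B *v D (f \<circ> x) u v) \<and>
      rotates B (\<lambda>t. (e3 t \<circ> x) u) \<and> rotates B (\<lambda>t. (e4 t \<circ> x) u))"
  proof (rule rigid_patch[OF W(1-3) nf'(3)])
    show "smooth_on (W \<times> {-r<..<r}) (\<lambda>z. (e3 (snd z) \<circ> x) (fst z))"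
      "smooth_on (W \<times> {-r<..<r}) (\<lambda>z. (e4 (snd z) \<circ> x) (fst z))"
      using smooth_on_subset[OF nf'(5)[OF x] sub(3,2,1)] by auto
  next
    show "(e3 t \<circ> x) u \<in> orthogonal_comp (range (D (bent t) u))"
      "(e4 t \<circ> x) u \<in> orthogonal_comp (range (D (bent t) u))"
      if "t \<in> {-r<..<r}" "u \<in> W" for t u
      using nf'(6)[OF x _ that(1) inU[OF that(2)]] beq by auto
  next
    show "norm ((e3 t \<circ> x) u) = 1 \<and> norm ((e4 t \<circ> x) u) = 1 \<and> (e3 t \<circ> x) u \<bullet> (e4 t \<circ> x) u = 0"
      if "t \<in> {-r<..<r}" "u \<in> W" for t u
      using nf'(4)[OF that(1) inU(2)[OF that(2)]] by simp
  next
    show "delta_zero (\<lambda>t. normal_connection_form (bent t) (e3 t \<circ> x) (e4 t \<circ> x) u v)" if "u \<in> W" for u v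
      using E_par x inU[OF that] unfolding parallel_frame_def beq[symmetric] by auto
  next
    note ps = preserved_second_form[OF pf H Hopf E _ x]
    show "second_form_variation u ((e3 0 \<circ> x) u) n' i j = 0"
      if "u \<in> W" "((\<lambda>t. (e3 t \<circ> x) u) has_vector_derivative n') (at 0)" for u n' i j
      using ps[of e3 u n' i j] inU[OF that(1)] that(2) by simp
    show "second_form_variation u ((e4 0 \<circ> x) u) n' i j = 0"
      if "u \<in> W" "((\<lambda>t. (e4 t \<circ> x) u) has_vector_derivative n') (at 0)" for u n' i j
      using ps[of e4 u n' i j] inU[OF that(1)] that(2) by simp
  qed
  then obtain B c where B: "transpose B = - B" and
    *: "\<And>u. u \<in> W \<Longrightarrow> T (x u) = B *v f (x u) + c"
      "\<And>u v. u \<in> W \<Longrightarrow> D (T \<circ> x) u v = B *v D (f \<circ> x) u v"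
      "\<And>u. u \<in> W \<Longrightarrow> rotates B (\<lambda>t. e3 t (x u))" "\<And>u. u \<in> W \<Longrightarrow> rotates B (\<lambda>t. e4 t (x u))"
    by auto
  have rot: "rotates B (\<lambda>t. e t (x u))"
    if u: "u \<in> W" and E': "(U', r', e3', e4') \<in> \<E>" "x u \<in> U'" and e: "e \<in> {e3', e4'}" for u U' r' e3' e4' e
  proof -
    have nfE: "normal_frame A f T (U', r', e3', e4')"
      using pf E' by (auto simp: parallel_frame_system_def parallel_frame_def)
    note nfE' = normal_frameD[OF nfE]
    obtain n' where n': "((\<lambda>t. e t (x u)) has_vector_derivative n') (at 0)"
      using frame_derivative_exists[OF nfE e E'(2)] by blast
    have coh: "coherent_frames (U, r, e3, e4) (U', r', e3', e4')"
      using pf E E' by (auto simp: parallel_frame_system_def)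
    have "n' = B *v e 0 (x u)"
    proof (rule normal_motion_unique[OF inU(1)[OF u] B *(2)[OF u] nfE'(3) n'])
      show "e t (x u) \<in> orthogonal_comp (range (D (bent t) u))" if "t \<in> {-r'<..<r'}" for t
        using nfE'(6)[OF x e that inU(1)[OF u] E'(2)] beq by simp
      show "rotates B (\<lambda>t. e3 t (x u))" "rotates B (\<lambda>t. e4 t (x u))" using * u by auto
      show "e3 0 (x u) \<in> orthogonal_comp (range (D (f \<circ> x) u))"
        "e4 0 (x u) \<in> orthogonal_comp (range (D (f \<circ> x) u))"
        using nf'(6)[OF x _ _ inU[OF u], of _ 0] nf'(3) beq[of 0] by (auto simp: bent_0)
      show "norm (e3 0 (x u)) = 1" "norm (e4 0 (x u)) = 1" "e3 0 (x u) \<bullet> e4 0 (x u) = 0"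
        using nf'(4)[OF _ inU(2)[OF u], of 0] nf'(3) by auto
      show "delta_zero (\<lambda>t. e3 t (x u) \<bullet> e t (x u))" "delta_zero (\<lambda>t. e4 t (x u) \<bullet> e t (x u))"
        using coh inU(2)[OF u] E'(2) e unfolding coherent_frames_def by auto
    qed
    then show ?thesis using n' by (simp add: rotates_def)
  qed
  have "motion_at \<E> p B c"
    unfolding motion_at_def
  proof (intro conjI exI[of _ "x ` W"] B)
    show "open (x ` W)" by (rule open_chart_image[OF x W(2,1)])
    show "p \<in> x ` W" using u0 W(5) by auto
    show "\<forall>q\<in>x ` W. T q = B *v f q + c \<and>
       (\<forall>(U, r, e3, e4)\<in>\<E>. q \<in> U \<longrightarrow> rotates B (\<lambda>t. e3 t q) \<and> rotates B (\<lambda>t. e4 t q))"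
      using *(1) rot by fastforce
  qed
  then show ?thesis by blast
qed

text \<open>Differentiating \<open>T = Bf + c\<close> fixes \<open>B\<close> on the tangent plane,
  and the velocities of any one frame fix it on the normal plane. The value of \<open>T\<close> at
  \<open>p\<close> then fixes \<open>c\<close>.\<close>

lemma motion_unique:
  assumes pf: "parallel_frame_system A f T \<E>" and p: "p \<in> surface A"
    and m: "motion_at \<E> p B c" and m': "motion_at \<E> p B' c'"
  shows "B = B' \<and> c = c'"
proof -
  obtain V x u where x: "(V, x) \<in> A" and u: "u \<in> V" "p = x u"
    using surface_chartE[OF p] by blast
  interpret bent_patch V "f \<circ> x" "T \<circ> x" by (rule patch[OF x])
  have beq: "deform f T t \<circ> x = bent t" for t using bent_eq[OF x] by (simp add: fun_eq_iff)
  obtain U r e3 e4 where E: "(U, r, e3, e4) \<in> \<E>" and pU: "p \<in> U"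
    using pf p by (fastforce simp: parallel_frame_system_def)
  have nf: "normal_frame A f T (U, r, e3, e4)"
    using pf E by (auto simp: parallel_frame_system_def parallel_frame_def)
  note nf' = normal_frameD[OF nf]
  have D\<tau>: "D (T \<circ> x) u v = B *v D (f \<circ> x) u v" if m: "motion_at \<E> p B c" for B c v
  proof -
    obtain N where N: "open N" "p \<in> N" "\<And>q. q \<in> N \<Longrightarrow> T q = B *v f q + c"
      using m unfolding motion_at_def by blast
    have "((\<lambda>u. B *v (f \<circ> x) u + c) has_derivative (\<lambda>v. B *v D (f \<circ> x) u v + 0)) (at u)"
      by (intro has_derivative_add has_derivative_const smooth_on_has_derivative[OF smooth_F open_V u(1)]
          bounded_linear.has_derivative[OF matrix_vector_mul_bounded_linear])
    then have "((T \<circ> x) has_derivative (\<lambda>v. B *v D (f \<circ> x) u v + 0)) (at u)"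
      by (rule has_derivative_transform_within_open[OF _ open_chart_preimage[OF x N(1)]])
         (use u N in auto)
    then show ?thesis using D_eqI by fastforce
  qed
  have rot: "rotates B (\<lambda>t. e3 t p)" "rotates B (\<lambda>t. e4 t p)" if m: "motion_at \<E> p B c" for B c
    using m E pU unfolding motion_at_def by fast+
  have normal: "e3 0 p \<in> orthogonal_comp (range (D (f \<circ> x) u))" "e4 0 p \<in> orthogonal_comp (range (D (f \<circ> x) u))"
    using nf'(6)[OF x _ _ u(1), of _ 0] nf'(3) beq[of 0] u pU by (auto simp: bent_0)
  have on: "norm (e3 0 p) = 1" "norm (e4 0 p) = 1" "e3 0 p \<bullet> e4 0 p = 0"
    using nf'(4)[OF _ pU, of 0] nf'(3) by auto
  obtain g :: "4 \<Rightarrow> real^4" where g: "\<And>a b. g a \<bullet> g b = (if a = b then 1 else 0)"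
    "\<And>k. g k \<in> range (D (f \<circ> x) u) \<union> {e3 0 p, e4 0 p}"
    using adapted_orthonormal_basis[OF smooth_on_linear[OF smooth_F open_V u(1)] inj_F[OF u(1)] normal on] by blast
  have "B *v D (f \<circ> x) u v = B' *v D (f \<circ> x) u v" for v using D\<tau>[OF m] D\<tau>[OF m'] by metis
  moreover have "B *v e3 0 p = B' *v e3 0 p" "B *v e4 0 p = B' *v e4 0 p"
    using rot[OF m] rot[OF m'] vector_derivative_unique_at unfolding rotates_def by blast+
  ultimately have Bg: "B *v g k = B' *v g k" for k using g(2)[of k] by auto
  have "B *v w = B' *v w" for w
  proof -
    have lin: "linear ((*v) M)" for M :: "real^4^4" by (rule matrix_vector_mul_linear)
    show ?thesis
      by (subst (1 2) orthonormal_expansion[OF g(1), of w])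
         (simp only: linear_sum[OF lin] linear_scale[OF lin] Bg)
  qed
  then have "B = B'" by (simp add: matrix_eq)
  moreover have "T p = B *v f p + c" "T p = B' *v f p + c'"
    using m m' unfolding motion_at_def by blast+
  ultimately show ?thesis by simp
qed

lemma preserving_imp_trivial:
  assumes conn: "connected (surface A)"
    and pres: "preserves_parallelly_mean_curvature_and_hopf A f T"
  shows "trivial_bending A f T"
proof (cases "surface A = {}")
  case True
  then show ?thesis
    unfolding trivial_bending_def by (intro exI[of _ 0]) (simp add: vec_eq_iff transpose_def)
next
  case False
  then obtain p0 where p0: "p0 \<in> surface A" by auto
  obtain \<E> where pf: "parallel_frame_system A f T \<E>" and H: "preserves_mean_curvature A f T \<E>"
    and Hopf: "preserves_hopf_differential A f T \<E>"
    using pres unfolding preserves_parallelly_mean_curvature_and_hopf_def by blast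
  define M where "M p = (SOME m. motion_at \<E> p (fst m) (snd m))" for p
  have M: "motion_at \<E> p (fst (M p)) (snd (M p))" if "p \<in> surface A" for p
    unfolding M_def using motion_exists[OF pf H Hopf that] by (intro someI_ex[of "\<lambda>m. motion_at \<E> p (fst m) (snd m)"]) auto
  \<comment> \<open>The choice in \<open>M\<close> is harmless by uniqueness, and a motion at
    \<open>p\<close> is also one at all nearby points, so \<open>M\<close> is locally
    constant.\<close>
  have "M constant_on surface A"
  proof (rule locally_constant_imp_constant[OF conn])
    fix p assume p: "p \<in> surface A"
    obtain N where N: "open N" "p \<in> N" "\<And>q. q \<in> N \<Longrightarrow> motion_at \<E> q (fst (M p)) (snd (M p))"
      using M[OF p] unfolding motion_at_def by blast
    have eq: "M q = M p" if q: "q \<in> surface A" "q \<in> N" for q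
      using motion_unique[OF pf q(1) M[OF q(1)] N(3)[OF q(2)]] by (intro prod_eqI) auto
    show "\<exists>S. openin (top_of_set (surface A)) S \<and> p \<in> S \<and> (\<forall>q\<in>S. M q = M p)"
    proof (intro exI conjI ballI)
      show "openin (top_of_set (surface A)) (surface A \<inter> N)" using N(1) by (rule openin_open_Int)
      show "p \<in> surface A \<inter> N" using p N(2) by simp
      show "M q = M p" if "q \<in> surface A \<inter> N" for q using that eq by blast
    qed
  qed
  then have "M p = M p0" if "p \<in> surface A" for p
    using that p0 unfolding constant_on_def by auto
  then have "T p = fst (M p0) *v f p + snd (M p0)" if "p \<in> surface A" for p
    using M[OF that] that unfolding motion_at_def by auto
  then show ?thesis
    using M[OF p0] unfolding trivial_bending_def motion_at_def by blast
qed

end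

section \<open>Triviality implies preservation\<close>

lemma smooth_on_unit [smooth]:
  "open S \<Longrightarrow> smooth_on S g \<Longrightarrow> (\<And>z. z \<in> S \<Longrightarrow> g z \<bullet> g z > 0) \<Longrightarrow> smooth_on S (\<lambda>z. unit (g z))"
  unfolding unit_def by (intro smooth)

lemma open_positive_part:
  fixes g :: "'a::euclidean_space \<Rightarrow> real"
  assumes "open S" "smooth_on S g"
  shows "open {z\<in>S. 0 < g z}"
proof -
  have "open (g -` {0<..} \<inter> S)"
    using continuous_on_open_vimage[OF assms(1), of g] smooth_on_continuous[OF assms(2)] open_greaterThan by metis
  then show ?thesis by (simp add: vimage_def Int_def conj_commute)
qed

text \<open>The image of \<open>L\<close> has dimension at most 2 in a space of dimension 4, so an
  orthonormal basis of its complement has at least two elements.\<close>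

lemma orthonormal_normal_pair_exists:
  fixes L :: "real^2 \<Rightarrow> real^4"
  assumes "linear L"
  obtains n3 n4 where "n3 \<in> orthogonal_comp (range L)" "n4 \<in> orthogonal_comp (range L)"
    "norm n3 = 1" "norm n4 = 1" "n3 \<bullet> n4 = 0"
proof -
  let ?S = "orthogonal_comp (range L)"
  have sub: "subspace (range L)" using assms by (simp add: linear_subspace_image)
  have "dim {y \<in> UNIV. \<forall>x\<in>range L. orthogonal x y} + dim (range L) = dim (UNIV :: (real^4) set)"
    by (rule dim_subspace_orthogonal_to_vectors) (use sub in auto)
  moreover have "dim (range L) \<le> 2" using dim_image_le[OF assms, of UNIV] by simp
  ultimately have "dim ?S \<ge> 2" by (simp add: orthogonal_comp_def)
  moreover obtain C where C: "C \<subseteq> ?S" "pairwise orthogonal C" "\<And>x. x \<in> C \<Longrightarrow> norm x = 1" "card C = dim ?S"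
    using orthonormal_basis_subspace[OF subspace_orthogonal_comp, of "range L"] by metis
  ultimately have "\<exists>n3 n4. n3 \<in> C \<and> n4 \<in> C \<and> n3 \<noteq> n4"
    by (metis (no_types, opaque_lifting) card_2_iff' card_le_Suc0_iff_eq card.infinite not_less_eq_eq numeral_2_eq_2 zero_le le_zero_eq Suc_n_not_le_n)
  then show ?thesis using that C unfolding pairwise_def orthogonal_def by (meson subset_iff)
qed

context bent_patch
begin

lemma smooth_normal_part:
  assumes "smooth_on cyl w"
  shows "smooth_on cyl (\<lambda>z. normal_part (bent (snd z)) (fst z) (w z))"
proof (rule smooth_on_cong[OF open_cyl])
  show "smooth_on cyl (\<lambda>z. w z - (w z \<bullet> eps1 z) *\<^sub>R eps1 z - (w z \<bullet> eps2 z) *\<^sub>R eps2 z)"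
    by (intro smooth open_cyl smooth_eps assms)
qed (auto simp: normal_part_orthonormal_pair[OF linear_bent orthonormal_pair_bent])

end

locale trivial_patch = bent_patch +
  fixes B :: "real^4^4" and c :: "real^4"
  assumes skew: "transpose B = - B" and \<tau>_eq: "u \<in> V \<Longrightarrow> \<tau> u = B *v F u + c"
begin

lemma D_\<tau>:
  assumes "u \<in> V"
  shows "D \<tau> u v = B *v D F u v"
proof (rule D_eqI)
  have "((\<lambda>u. B *v F u + c) has_derivative (\<lambda>v. B *v D F u v + 0)) (at u)"
    by (intro has_derivative_add has_derivative_const smooth_on_has_derivative[OF smooth_F open_V assms]
        bounded_linear.has_derivative[OF matrix_vector_mul_bounded_linear])
  then show "(\<tau> has_derivative (\<lambda>v. B *v D F u v)) (at u)"
    using has_derivative_transform_within_open[OF _ open_V assms, of "\<lambda>u. B *v F u + c" _ UNIV \<tau>] \<tau>_eq by simp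
qed

lemma D2_\<tau>:
  assumes "u \<in> V"
  shows "D (\<lambda>q. D \<tau> q w) u v = B *v D (\<lambda>q. D F q w) u v"
proof (rule D_eqI)
  have "((\<lambda>q. B *v D F q w) has_derivative (\<lambda>v. B *v D (\<lambda>q. D F q w) u v)) (at u)"
    by (intro smooth_on_has_derivative[OF smooth_on_D[OF smooth_F] open_V assms]
        bounded_linear.has_derivative[OF matrix_vector_mul_bounded_linear])
  then show "((\<lambda>q. D \<tau> q w) has_derivative (\<lambda>v. B *v D (\<lambda>q. D F q w) u v)) (at u)"
    by (rule has_derivative_transform_within_open[OF _ open_V assms]) (simp add: D_\<tau>)
qed

text \<open>Second derivatives of \<open>F\<close> and the normal both turn with \<open>B\<close>;
  skew-symmetry cancels the two contributions.\<close>

lemma second_form_variation_rotating: "u \<in> V \<Longrightarrow> second_form_variation u n (B *v n) i j = 0"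
  using skew_inner[OF skew] by (simp add: second_form_variation_def D2_\<tau>)

lemma second_form_deltas_rotating:
  assumes u: "u \<in> V" and r: "r > 0" and n: "rotates B n"
    and normal: "\<And>t. t \<in> {-r<..<r} \<Longrightarrow> n t \<in> orthogonal_comp (range (D (bent t) u))"
    and on: "\<And>t. t \<in> {-r<..<r} \<Longrightarrow> orthonormal_pair (bent t) u (e1 t) (e2 t)"
    and e: "delta_zero e1" "delta_zero e2"
  shows "delta_zero (\<lambda>t. mean_curvature (bent t) u \<bullet> n t)"
    and "delta_zero (\<lambda>t. (\<chi> k. Re (hopf_differential (bent t) u (e1 t) (e1 t) $ k)) \<bullet> n t)"
    and "delta_zero (\<lambda>t. (\<chi> k. Im (hopf_differential (bent t) u (e1 t) (e1 t) $ k)) \<bullet> n t)"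
  using second_form_deltas[OF u r n[unfolded rotates_def] normal on e]
  by (simp_all add: bilin2_def second_form_variation_rotating[OF u])

lemma rotates_tangent:
  assumes "u \<in> V" "delta_zero e"
  shows "rotates B (\<lambda>t. D (bent t) u (e t))"
  using tangent_variation[OF assms] by (simp add: rotates_def D_\<tau>[OF assms(1)] bent_0)

text \<open>The tangent frame used in the projection itself turns with \<open>B\<close>, so to first
  order projecting commutes with turning.\<close>

lemma rotates_normal_part:
  assumes u: "u \<in> V" and w: "rotates B w"
  shows "rotates B (\<lambda>t. normal_part (bent t) u (w t))"
  unfolding normal_part_orthonormal_pair[OF linear_bent[OF u] orthonormal_pair_bent[OF u]]
  by (intro rotates_diff rotates_scaleR rotates_inner[OF skew] w rotates_tangent u frame_bent_delta_zero)

end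

section \<open>Normal frames that turn with the motion\<close>

locale trivially_bent_surface = bent_surface +
  fixes B :: "real^4^4" and c :: "real^4"
  assumes skew: "transpose B = - B" and T_eq: "p \<in> surface A \<Longrightarrow> T p = B *v f p + c"
begin

lemma patch_trivial:
  assumes "(V, x) \<in> A"
  shows "trivial_patch V (f \<circ> x) (T \<circ> x) B c"
proof -
  have "x u \<in> surface A" if "u \<in> V" for u using assms that by (auto simp: surface_def)
  then show ?thesis
    using patch[OF assms] skew T_eq by (auto simp: trivial_patch_def trivial_patch_axioms_def)
qed

text \<open>All frames turning with \<open>B\<close> are taken at once. They are coherent for free,
  because inner products of turning vectors are stationary, so only existence near each point takes
  work.\<close>

definition rotating_frames :: "'a normal_frame set" where
  "rotating_frames = {(U, r, e3, e4). normal_frame A f T (U, r, e3, e4) \<and>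
     (\<forall>p\<in>U. rotates B (\<lambda>t. e3 t p) \<and> rotates B (\<lambda>t. e4 t p))}"

text \<open>Interchanging derivatives, the velocity of \<open>D e3\<close> is the space derivative
  of \<open>B e3\<close>, that is \<open>B\<close> applied to \<open>D e3\<close>. So
  \<open>D e3\<close> turns with \<open>B\<close> as well, and its product with \<open>e4\<close> is
  stationary.\<close>

lemma parallel_frame_rotating:
  assumes "(U, r, e3, e4) \<in> rotating_frames"
  shows "parallel_frame A f T (U, r, e3, e4)"
proof -
  have nf: "normal_frame A f T (U, r, e3, e4)"
    and rot: "\<And>p. p \<in> U \<Longrightarrow> rotates B (\<lambda>t. e3 t p)" "\<And>p. p \<in> U \<Longrightarrow> rotates B (\<lambda>t. e4 t p)"
    using assms by (auto simp: rotating_frames_def)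
  note nf' = normal_frameD[OF nf]
  have "delta_zero (\<lambda>t. normal_connection_form (deform f T t \<circ> x) (e3 t \<circ> x) (e4 t \<circ> x) u v)"
    if x: "(V, x) \<in> A" and u: "u \<in> V" "x u \<in> U" for V x u v
  proof -
    interpret trivial_patch V "f \<circ> x" "T \<circ> x" B c by (rule patch_trivial[OF x])
    have beq: "deform f T t \<circ> x = bent t" for t using bent_eq[OF x] by (simp add: fun_eq_iff)
    define S where "S = {u\<in>V. x u \<in> U}"
    define G where "G = (\<lambda>z. e3 (snd z) (x (fst z)))"
    have opS: "open S" unfolding S_def by (rule open_chart_preimage[OF x nf'(1)])
    have G: "smooth_on (S \<times> {-r<..<r}) G" "open (S \<times> {-r<..<r})"
      using nf'(5)[OF x, of e3] opS by (auto simp: G_def S_def intro!: open_Times)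
    have uS: "u \<in> S" using u by (simp add: S_def)
    have mem: "(q, t) \<in> S \<times> {-r<..<r}" if "q \<in> S" "t \<in> {-r<..<r}" for q t using that by simp
    have time: "D G (q, 0) (0, 1) = B *v G (q, 0)" if "q \<in> S" for q
    proof -
      have "((\<lambda>t. G (q, t)) has_vector_derivative D G (q, 0) (0, 1)) (at 0)"
        by (rule derivative_in_time[OF G mem]) (use that nf'(3) in auto)
      moreover have "((\<lambda>t. G (q, t)) has_vector_derivative B *v G (q, 0)) (at 0)"
        using rot(1)[of "x q"] that by (simp add: rotates_def G_def S_def)
      ultimately show ?thesis by (rule vector_derivative_unique_at)
    qed
    have "((\<lambda>q. B *v G (q, 0)) has_derivative (\<lambda>v. B *v D (\<lambda>q. G (q, 0)) u v)) (at u)"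
    proof (intro bounded_linear.has_derivative[OF matrix_vector_mul_bounded_linear])
      have "(\<lambda>q. G (q, 0)) differentiable (at u)"
        using derivative_in_space[OF G mem[OF uS], of 0] nf'(3) by (auto intro: differentiableI)
      then show "((\<lambda>q. G (q, 0)) has_derivative D (\<lambda>q. G (q, 0)) u) (at u)"
        by (simp add: frechet_derivative_works)
    qed
    then have "((\<lambda>q. D G (q, 0) (0, 1)) has_derivative (\<lambda>v. B *v D (\<lambda>q. G (q, 0)) u v)) (at u)"
      by (rule has_derivative_transform_within_open[OF _ opS uS]) (simp add: time)
    then have "D (\<lambda>q. D G (q, 0) (0, 1)) u v = B *v D (\<lambda>q. G (q, 0)) u v"
      by (rule D_eqI)
    moreover have "((\<lambda>t. D (\<lambda>q. G (q, t)) u v) has_vector_derivative D (\<lambda>q. D G (q, 0) (0, 1)) u v) (at 0)"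
      by (rule space_derivative_in_time[OF G mem[OF uS]]) (use nf'(3) in auto)
    ultimately have "rotates B (\<lambda>t. D (\<lambda>q. G (q, t)) u v)" by (simp add: rotates_def)
    from rotates_inner[OF skew this rot(2)[OF u(2)]]
    show ?thesis
    proof (rule delta_zero_transform[OF _ nf'(3)])
      fix t assume t: "t \<in> {-r<..<r}"
      show "D (\<lambda>q. G (q, t)) u v \<bullet> e4 t (x u) =
          normal_connection_form (deform f T t \<circ> x) (e3 t \<circ> x) (e4 t \<circ> x) u v"
      proof -
        have "(\<lambda>q. G (q, t)) = e3 t \<circ> x" by (simp add: G_def fun_eq_iff)
        moreover have "e4 t (x u) \<in> orthogonal_comp (range (D (bent t) u))"
          using nf'(6)[OF x _ t u, of e4] beq by simp
        ultimately show ?thesis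
          using normal_part_inner[OF linear_bent[OF u(1)]]
          by (simp add: normal_connection_form_def normal_connection_def beq del: o_apply) (simp add: o_def)
      qed
    qed
  qed
  then show ?thesis using nf by (auto simp: parallel_frame_def)
qed

text \<open>The chain rule for the transition map. Exchanging the charts gives the other inclusion,
  so the normal projection is well defined on the manifold.\<close>

lemma range_D_chart:
  assumes x: "(V, x) \<in> A" "u \<in> V" and x': "(V', x') \<in> A" "u' \<in> V'" and eq: "x u = x' u'"
  shows "range (D (deform f T t \<circ> x) u) \<subseteq> range (D (deform f T t \<circ> x') u')"
proof -
  interpret P: bent_patch V' "f \<circ> x'" "T \<circ> x'" by (rule patch[OF x'(1)])
  have beq: "deform f T t \<circ> x' = P.bent t" using bent_eq[OF x'(1)] by (simp add: fun_eq_iff)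
  define S where "S = {u\<in>V. x u \<in> x' ` V'}"
  define \<sigma> where "\<sigma> = inv_into V' x' \<circ> x"
  have S: "open S" "u \<in> S"
    using open_chart_preimage[OF x(1) chart(2)[OF x'(1)]] x x' eq by (auto simp: S_def)
  have "smooth_on S \<sigma>"
    using atlas x x' unfolding oriented_atlas_def S_def \<sigma>_def by (fastforce simp: Let_def)
  from smooth_on_has_derivative[OF this S] have \<sigma>: "(\<sigma> has_derivative D \<sigma> u) (at u)" .
  have "\<sigma> u = u'" using eq chart(3)[OF x'(1)] x'(2) by (simp add: \<sigma>_def)
  then have "((deform f T t \<circ> x') has_derivative D (deform f T t \<circ> x') u') (at (\<sigma> u))"
    using smooth_on_has_derivative[OF P.smooth_bent P.open_V x'(2)] beq by simp
  from has_derivative_compose[OF \<sigma> this]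
  have "((deform f T t \<circ> x) has_derivative (\<lambda>v. D (deform f T t \<circ> x') u' (D \<sigma> u v))) (at u)"
    by (rule has_derivative_transform_within_open[OF _ S]) (auto simp: \<sigma>_def S_def f_inv_into_f)
  from D_eqI[OF this] show ?thesis by auto
qed

text \<open>Computed in any chart around the point, so that frames built from it are defined on the manifold.\<close>

definition normal_at :: "real \<Rightarrow> 'a \<Rightarrow> real^4 \<Rightarrow> real^4" where
  "normal_at t p w = (THE n. \<forall>V x u. (V, x) \<in> A \<and> u \<in> V \<and> x u = p \<longrightarrow> n = normal_part (deform f T t \<circ> x) u w)"

lemma normal_at_chart:
  assumes "(V, x) \<in> A" "u \<in> V"
  shows "normal_at t (x u) w = normal_part (deform f T t \<circ> x) u w"
  unfolding normal_at_def
proof (rule the_equality)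
  show "\<forall>V' x' u'. (V', x') \<in> A \<and> u' \<in> V' \<and> x' u' = x u \<longrightarrow>
      normal_part (deform f T t \<circ> x) u w = normal_part (deform f T t \<circ> x') u' w"
  proof (intro allI impI)
    fix V' x' u' assume a: "(V', x') \<in> A \<and> u' \<in> V' \<and> x' u' = x u"
    have "range (D (deform f T t \<circ> x) u) = range (D (deform f T t \<circ> x') u')"
      using range_D_chart[OF assms, of V' x' u'] range_D_chart[of V' x' u', OF _ _ assms] a
      by (intro subset_antisym) simp_all
    then show "normal_part (deform f T t \<circ> x) u w = normal_part (deform f T t \<circ> x') u' w"
      by (simp add: normal_part_def)
  qed
qed (use assms in blast)

text \<open>Start from an orthonormal normal pair at \<open>p\<close>, let it move by
  \<open>n + t Bn\<close> independently of the point, project to the normal planes and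
  orthonormalize. Each operation preserves turning with \<open>B\<close>.\<close>

lemma rotating_frame_exists:
  assumes p: "p \<in> surface A"
  shows "\<exists>E\<in>rotating_frames. p \<in> fst E"
proof -
  obtain V0 x0 u0 where x0: "(V0, x0) \<in> A" and u0: "u0 \<in> V0" "p = x0 u0"
    using surface_chartE[OF p] by blast
  interpret P: trivial_patch V0 "f \<circ> x0" "T \<circ> x0" B c by (rule patch_trivial[OF x0])
  have beq0: "deform f T t \<circ> x0 = P.bent t" for t using bent_eq[OF x0] by (simp add: fun_eq_iff)
  obtain n3 n4 where n: "n3 \<in> orthogonal_comp (range (D (f \<circ> x0) u0))" "n4 \<in> orthogonal_comp (range (D (f \<circ> x0) u0))"
    "norm n3 = 1" "norm n4 = 1" "n3 \<bullet> n4 = 0"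
    using orthonormal_normal_pair_exists[OF smooth_on_linear[OF P.smooth_F P.open_V u0(1)]] by blast
  define X where "X n t q = normal_at t q (n + t *\<^sub>R (B *v n))" for n t q
  define e3 where "e3 t q = unit (X n3 t q)" for t q
  define Y where "Y t q = X n4 t q - (X n4 t q \<bullet> e3 t q) *\<^sub>R e3 t q" for t q
  define e4 where "e4 t q = unit (Y t q)" for t q
  have smooth_X: "smooth_on (V \<times> UNIV) (\<lambda>z. X n (snd z) (x (fst z)))" if x: "(V, x) \<in> A" for V x n
  proof -
    interpret bent_patch V "f \<circ> x" "T \<circ> x" by (rule patch[OF x])
    have beq: "deform f T t \<circ> x = bent t" for t using bent_eq[OF x] by (simp add: fun_eq_iff)
    show ?thesis
    proof (rule smooth_on_cong[OF open_cyl])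
      show "smooth_on cyl (\<lambda>z. normal_part (bent (snd z)) (fst z) (n + snd z *\<^sub>R (B *v n)))"
        by (intro smooth_normal_part smooth open_cyl)
    qed (auto simp: X_def normal_at_chart[OF x] beq)
  qed
  have X_normal: "X n t (x u) \<in> orthogonal_comp (range (D (deform f T t \<circ> x) u))"
    if x: "(V, x) \<in> A" "u \<in> V" for V x u n t
  proof -
    interpret bent_patch V "f \<circ> x" "T \<circ> x" by (rule patch[OF x(1)])
    have beq: "deform f T t \<circ> x = bent t" for t using bent_eq[OF x(1)] by (simp add: fun_eq_iff)
    show ?thesis
      using normal_part_decomposition[OF linear_bent[OF x(2)]] by (simp add: X_def normal_at_chart[OF x] beq)
  qed
  have smooth_Y: "smooth_on S (\<lambda>z. Y (snd z) (x (fst z)))"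
    if x: "(V, x) \<in> A" and S: "open S" "S \<subseteq> V \<times> UNIV"
      "\<And>z. z \<in> S \<Longrightarrow> X n3 (snd z) (x (fst z)) \<bullet> X n3 (snd z) (x (fst z)) > 0" for V x S
  proof -
    have "open (V \<times> (UNIV :: real set))" using chart(1)[OF x] by (intro open_Times) auto
    note s = smooth_on_subset[OF smooth_X[OF x] this S(1,2)]
    show ?thesis unfolding Y_def e3_def by (intro smooth S s)
  qed
  \<comment> \<open>Two stages are needed: \<open>Y\<close> contains the normalized
    \<open>e3\<close> and is known to be smooth only where \<open>X n3\<close> does not
    vanish.\<close>
  define P1 where "P1 = {z \<in> P.cyl. 0 < X n3 (snd z) (x0 (fst z)) \<bullet> X n3 (snd z) (x0 (fst z))}"
  have P1: "open P1" "P1 \<subseteq> P.cyl"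
    unfolding P1_def by (intro open_positive_part smooth P.open_cyl smooth_X[OF x0], blast)
  define P2 where "P2 = {z \<in> P1. 0 < Y (snd z) (x0 (fst z)) \<bullet> Y (snd z) (x0 (fst z))}"
  have "smooth_on P1 (\<lambda>z. Y (snd z) (x0 (fst z)))"
    by (rule smooth_Y[OF x0 P1]) (auto simp: P1_def)
  then have P2: "open P2"
    unfolding P2_def by (intro open_positive_part smooth P1)
  \<comment> \<open>At \<open>p\<close> and time 0 the construction returns the initial pair
    \<open>n3\<close>, \<open>n4\<close>, so both squared lengths are 1 there.\<close>
  have "(u0, 0) \<in> P2"
  proof -
    have X0: "X n 0 p = n" if "n \<in> orthogonal_comp (range (D (f \<circ> x0) u0))" for n
    proof -
      have lin: "linear (D (P.bent 0) u0)" by (rule P.linear_bent[OF u0(1)])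
      have "0 \<in> range (D (P.bent 0) u0)" using linear_0[OF lin] by (metis rangeI)
      then have "normal_part (P.bent 0) u0 n = n"
        using that by (intro normal_part_eqI[OF lin]) (auto simp: P.bent_0)
      then show ?thesis by (simp add: X_def u0(2) normal_at_chart[OF x0 u0(1)] beq0)
    qed
    have nn: "n3 \<bullet> n3 = 1" "n4 \<bullet> n4 = 1" "n4 \<bullet> n3 = 0" using n by (auto simp: norm_eq_1 inner_commute)
    have "e3 0 p = n3" by (simp add: e3_def X0[OF n(1)] unit_def nn)
    then have "Y 0 p = n4" by (simp add: Y_def X0[OF n(2)] nn)
    then show ?thesis using X0[OF n(1)] u0 nn by (auto simp: P2_def P1_def)
  qed
  \<comment> \<open>A frame needs one time interval valid for all its points, hence a product
    neighbourhood.\<close>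
  then obtain W I where W: "open W" "open I" "u0 \<in> W" "0 \<in> I" "W \<times> I \<subseteq> P2"
    using open_prod_elim[OF P2] by (metis mem_Sigma_iff)
  then obtain r where r: "r > 0" "ball 0 r \<subseteq> I" using openE by blast
  define U where "U = x0 ` W"
  have WV: "W \<subseteq> V0" using W(4,5) P1(2) by (auto simp: P2_def)
  have U: "open U" "U \<subseteq> surface A" "p \<in> U"
    using open_chart_image[OF x0 W(1) WV] WV x0 W(3) u0 by (auto simp: U_def surface_def)
  have pos: "X n3 t q \<bullet> X n3 t q > 0" "Y t q \<bullet> Y t q > 0" if q: "q \<in> U" and t: "t \<in> {-r<..<r}" for q t
  proof -
    obtain u where u: "u \<in> W" "q = x0 u" using q by (auto simp: U_def)
    have "t \<in> I" using r(2) t by (auto simp: subset_iff dist_real_def)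
    then have "(u, t) \<in> P2" using W(5) u by blast
    then show "X n3 t q \<bullet> X n3 t q > 0" "Y t q \<bullet> Y t q > 0" using u by (auto simp: P2_def P1_def)
  qed
  have nf: "normal_frame A f T (U, r, e3, e4)"
    unfolding normal_frame_def prod.case
  proof (intro conjI U r ballI)
    fix ch assume ch: "ch \<in> A"
    obtain V x where chx: "ch = (V, x)" by (cases ch)
    have x: "(V, x) \<in> A" using ch chx by simp
    let ?S = "{u\<in>V. x u \<in> U} \<times> {-r<..<r}"
    have S: "open ?S" "?S \<subseteq> V \<times> UNIV"
      using open_chart_preimage[OF x U(1)] by (auto intro!: open_Times)
    have "open (V \<times> (UNIV :: real set))" using chart(1)[OF x] by (intro open_Times) auto
    note sX = smooth_on_subset[OF smooth_X[OF x] this S]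
    have s3: "smooth_on ?S (\<lambda>z. e3 (snd z) (x (fst z)))"
      unfolding e3_def by (intro smooth S sX) (use pos in auto)
    have "smooth_on ?S (\<lambda>z. Y (snd z) (x (fst z)))"
      by (rule smooth_Y[OF x S]) (use pos in auto)
    then have s4: "smooth_on ?S (\<lambda>z. e4 (snd z) (x (fst z)))"
      unfolding e4_def by (intro smooth S) (use pos in auto)
    have "e3 t (x u) \<in> orthogonal_comp (range (D (deform f T t \<circ> x) u))"
      "e4 t (x u) \<in> orthogonal_comp (range (D (deform f T t \<circ> x) u))" if "u \<in> V" for t u
      unfolding e4_def Y_def e3_def unit_def
      by (intro subspace_scale subspace_diff subspace_orthogonal_comp X_normal[OF x that])+
    with s3 s4 show "case ch of (V, x) \<Rightarrow> \<forall>e\<in>{e3, e4}.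
        smooth_on ({u\<in>V. x u \<in> U} \<times> {-r<..<r}) (\<lambda>(u, t). e t (x u)) \<and>
        (\<forall>t\<in>{-r<..<r}. \<forall>u\<in>V. x u \<in> U \<longrightarrow>
           e t (x u) \<in> orthogonal_comp (range (D (deform f T t \<circ> x) u)))"
      by (simp add: chx case_prod_unfold)
  next
    fix t q assume t: "t \<in> {-r<..<r}" and q: "q \<in> U"
    have e33: "e3 t q \<bullet> e3 t q = 1" unfolding e3_def by (rule unit_inner[OF pos(1)[OF q t]])
    then show "norm (e3 t q) = 1" by (simp add: norm_eq_1)
    show "norm (e4 t q) = 1" using unit_inner[OF pos(2)[OF q t]] by (simp add: norm_eq_1 e4_def)
    have "e3 t q \<bullet> Y t q = 0" by (simp add: Y_def inner_diff_right e33 inner_commute)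
    then show "e3 t q \<bullet> e4 t q = 0" by (simp add: e4_def unit_def)
  qed
  have rot: "rotates B (\<lambda>t. e3 t q)" "rotates B (\<lambda>t. e4 t q)" if q: "q \<in> U" for q
  proof -
    obtain u where u: "u \<in> W" "q = x0 u" using q by (auto simp: U_def)
    have uV: "u \<in> V0" using u WV by auto
    have X: "rotates B (\<lambda>t. X n t q)" for n
      unfolding X_def u(2) normal_at_chart[OF x0 uV] beq0
      by (rule P.rotates_normal_part[OF uV rotates_affine])
    have 0: "0 \<in> {-r<..<r}" using r by auto
    show e3: "rotates B (\<lambda>t. e3 t q)"
      unfolding e3_def by (rule rotates_unit[OF skew X pos(1)[OF q 0]])
    have Y: "rotates B (\<lambda>t. Y t q)"
      unfolding Y_def by (intro rotates_diff rotates_scaleR rotates_inner[OF skew] X e3)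
    show "rotates B (\<lambda>t. e4 t q)"
      unfolding e4_def by (rule rotates_unit[OF skew Y pos(2)[OF q 0]])
  qed
  have "(U, r, e3, e4) \<in> rotating_frames" using nf rot by (simp add: rotating_frames_def)
  then show ?thesis using U(3) by force
qed

lemma rotating_frames_system: "parallel_frame_system A f T rotating_frames"
proof -
  have "coherent_frames E E'" if "E \<in> rotating_frames" "E' \<in> rotating_frames" for E E'
    using that rotates_inner[OF skew] by (auto simp: coherent_frames_def rotating_frames_def)
  then show ?thesis
    using rotating_frame_exists parallel_frame_rotating by (auto simp: parallel_frame_system_def)
qed

section \<open>Preservation in the rotating frames\<close>

lemma preserved_rotatingI:
  assumes "\<And>U r e3 e4 e u. (U, r, e3, e4) \<in> rotating_frames \<Longrightarrow> e \<in> {e3, e4} \<Longrightarrow> u \<in> W \<Longrightarrow> x u \<in> U \<Longrightarrow>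
    delta_zero (\<lambda>t. \<xi> t u \<bullet> e t (x u))"
  shows "preserved rotating_frames x W \<xi>"
  unfolding preserved_def using assms by blast

lemma rotating_framesD:
  assumes "(U, r, e3, e4) \<in> rotating_frames" "e \<in> {e3, e4}"
  shows "r > 0" "\<And>p. p \<in> U \<Longrightarrow> rotates B (\<lambda>t. e t p)"
    "\<And>V x t u. (V, x) \<in> A \<Longrightarrow> t \<in> {-r<..<r} \<Longrightarrow> u \<in> V \<Longrightarrow> x u \<in> U \<Longrightarrow>
      e t (x u) \<in> orthogonal_comp (range (D (deform f T t \<circ> x) u))"
proof -
  have nf: "normal_frame A f T (U, r, e3, e4)" using assms by (auto simp: rotating_frames_def)
  show "r > 0" by (rule normal_frameD(3)[OF nf])
  show "\<And>p. p \<in> U \<Longrightarrow> rotates B (\<lambda>t. e t p)" using assms by (auto simp: rotating_frames_def)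
  show "e t (x u) \<in> orthogonal_comp (range (D (deform f T t \<circ> x) u))"
    if "(V, x) \<in> A" "t \<in> {-r<..<r}" "u \<in> V" "x u \<in> U" for V x t u
    by (rule normal_frameD(6)[OF nf that(1) assms(2) that(2-4)])
qed

lemma preserves_mean_curvature_rotating: "preserves_mean_curvature A f T rotating_frames"
  unfolding preserves_mean_curvature_def
proof clarify
  fix V x assume x: "(V, x) \<in> A"
  interpret trivial_patch V "f \<circ> x" "T \<circ> x" B c by (rule patch_trivial[OF x])
  have beq: "deform f T t \<circ> x = bent t" for t using bent_eq[OF x] by (simp add: fun_eq_iff)
  show "preserved rotating_frames x V (\<lambda>t. mean_curvature (deform f T t \<circ> x))"
  proof (rule preserved_rotatingI)
    fix U r e3 e4 e u
    assume "(U, r, e3, e4) \<in> rotating_frames" "e \<in> {e3, e4}" and u: "u \<in> V" "x u \<in> U"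
    note E = rotating_framesD[OF this(1,2)]
    show "delta_zero (\<lambda>t. mean_curvature (deform f T t \<circ> x) u \<bullet> e t (x u))"
      unfolding beq
      by (rule second_form_deltas_rotating(1)[OF u(1) E(1) E(2)[OF u(2)] _ orthonormal_pair_bent[OF u(1)]
            frame_bent_delta_zero[OF u(1)]])
         (use E(3)[OF x _ u] beq in auto)
  qed
qed

lemma preserves_hopf_differential_rotating: "preserves_hopf_differential A f T rotating_frames"
  unfolding preserves_hopf_differential_def
proof clarify
  fix V x W r' e1 e2 \<omega>1 \<omega>2 \<psi>
  assume x: "(V, x) \<in> A" and W: "W \<subseteq> V"
    and tf: "tangent_frame (\<lambda>t. deform f T t \<circ> x) W r' e1 e2"
    and dual: "dual_coframe W r' e1 e2 \<omega>1 \<omega>2"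
    and stat: "stationary_frame (\<lambda>t. deform f T t \<circ> x) W e1 e2 \<omega>1 \<omega>2"
    and hopf: "hopf_coefficient (\<lambda>t. deform f T t \<circ> x) W r' \<omega>1 \<omega>2 \<psi>"
  interpret trivial_patch V "f \<circ> x" "T \<circ> x" B c by (rule patch_trivial[OF x])
  have beq: "deform f T t \<circ> x = bent t" for t using bent_eq[OF x] by (simp add: fun_eq_iff)
  have r': "r' > 0" using tf by (simp add: tangent_frame_def)
  \<comment> \<open>Evaluating at \<open>e1\<close>, where the coframe takes the values 1 and 0,
    forces the coefficient.\<close>
  have psi: "\<psi> t u = hopf_differential (bent t) u (e1 t u) (e1 t u)" if "u \<in> W" "t \<in> {-r'<..<r'}" for u t
  proof -
    have "\<omega>1 t u (e1 t u) = 1" "\<omega>2 t u (e1 t u) = 0" using dual that by (auto simp: dual_coframe_def)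
    then have "hopf_differential (bent t) u (e1 t u) (e1 t u) = (Complex 1 0 * Complex 1 0) *s \<psi> t u"
      using hopf that unfolding hopf_coefficient_def beq by metis
    then show ?thesis by (simp add: complex_eq_iff vec_eq_iff flip: one_complex.code)
  qed
  have deltas: "delta_zero (\<lambda>t. (\<chi> k. Re (\<psi> t u $ k)) \<bullet> e t (x u)) \<and>
      delta_zero (\<lambda>t. (\<chi> k. Im (\<psi> t u $ k)) \<bullet> e t (x u))"
    if E: "(U, r, e3, e4) \<in> rotating_frames" "e \<in> {e3, e4}" and u: "u \<in> W" "x u \<in> U" for U r e3 e4 e u
  proof -
    note E' = rotating_framesD[OF E]
    \<comment> \<open>The normal and the tangent frame have their own time intervals; derivatives at
      0 need only the common one.\<close>
    define s where "s = min r r'"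
    have s: "s > 0" "\<And>t. t \<in> {-s<..<s} \<Longrightarrow> t \<in> {-r<..<r}" "\<And>t. t \<in> {-s<..<s} \<Longrightarrow> t \<in> {-r'<..<r'}"
      using E'(1) r' by (auto simp: s_def)
    have uV: "u \<in> V" using u W by auto
    have on: "orthonormal_pair (bent t) u (e1 t u) (e2 t u)" if "t \<in> {-s<..<s}" for t
      using tf s(3)[OF that] u(1) by (simp add: tangent_frame_def orthonormal_pair_def beq)
    have d: "delta_zero (\<lambda>t. e1 t u)" "delta_zero (\<lambda>t. e2 t u)"
      using stat u(1) by (auto simp: stationary_frame_def)
    have nm: "e t (x u) \<in> orthogonal_comp (range (D (bent t) u))" if "t \<in> {-s<..<s}" for t
      using E'(3)[OF x s(2)[OF that] uV u(2)] beq by simp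
    note sd = second_form_deltas_rotating[OF uV s(1) E'(2)[OF u(2)] nm on d]
    show ?thesis
      using delta_zero_transform[OF sd(2) s(1)] delta_zero_transform[OF sd(3) s(1)] psi[OF u(1) s(3)] by simp
  qed
  show "preserved rotating_frames x W (\<lambda>t u. \<chi> k. Re (\<psi> t u $ k)) \<and>
      preserved rotating_frames x W (\<lambda>t u. \<chi> k. Im (\<psi> t u $ k))"
    using deltas by (blast intro: preserved_rotatingI)
qed

lemma trivial_imp_preserving: "preserves_parallelly_mean_curvature_and_hopf A f T"
  unfolding preserves_parallelly_mean_curvature_and_hopf_def
  using rotating_frames_system preserves_mean_curvature_rotating preserves_hopf_differential_rotating by blast

end

theorem theorem39:
  fixes A :: "'m::{t2_space, second_countable_topology} chart set"
    and f T :: "'m \<Rightarrow> real^4"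
  assumes "oriented_atlas A" and "connected (surface A)"
    and "immersion A f"
    and "bending_field A f T"
  shows "trivial_bending A f T \<longleftrightarrow> preserves_parallelly_mean_curvature_and_hopf A f T"
proof
  interpret bent_surface A f T using assms by unfold_locales
  show "preserves_parallelly_mean_curvature_and_hopf A f T \<Longrightarrow> trivial_bending A f T"
    by (rule preserving_imp_trivial[OF assms(2)])
  assume "trivial_bending A f T"
  then obtain B :: "real^4^4" and c where B: "transpose B = - B" "\<And>p. p \<in> surface A \<Longrightarrow> T p = B *v f p + c"
    unfolding trivial_bending_def by blast
  interpret trivially_bent_surface A f T B c using B by unfold_locales
  show "preserves_parallelly_mean_curvature_and_hopf A f T" by (rule trivial_imp_preserving)
qed

end
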